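(* Let $\mathcal{A}$ be a finite-dimensional $C^*$-algebra, let $\varphi \in \mathcal{S}(\mathcal{A})$ be a state on $\mathcal{A}$ and let $\Psi \subseteq \mathcal{S}(\mathcal{A})$ be a set of states on $\mathcal{A}$. Then there exists a sequence $\{p_n\}_{n\in\mathbb{N}}$ of orthogonal projections $p_n \in \mathcal{A}^{(n)} = \mathcal{A}^{\otimes n}$ such that $$\lim_{n\to\infty} \psi^{\otimes n}(p_n) = 1 \qquad \text{for all } \psi \in \Psi,$$ and $$\lim_{n\to\infty} \frac{1}{n}\log \varphi^{\otimes n}(p_n) = -\inf_{\psi\in\Psi} S(\psi,\varphi).$$ Moreover, for each sequence $\{\tilde p_n\}_{n\in\mathbb{N}}$ of orthogonal projections $\tilde p_n \in \mathcal{A}^{(n)}$ satisfying $\lim_{n\to\infty}\psi^{\otimes n}(\tilde p_n) = 1$ for all $\psi\in\Psi$, one has $$\liminf_{n\to\infty} \frac{1}{n}\log \varphi^{\otimes n}(\tilde p_n) \ge -\inf_{\psi\in\Psi} S(\psi,\varphi).$$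
   Context: $\mathcal{S}(\mathcal{A})$ denotes the set of states on $\mathcal{A}$, i.e. positive linear functionals $\varphi$ with $\varphi(\mathbf{1})=1$. $\mathcal{A}^{(n)} := \bigotimes_{i=1}^n \mathcal{A}$, and $\varphi^{\otimes n}$ denotes the product state on $\mathcal{A}^{(n)}$ built from $n$ copies of $\varphi$. $D_\psi$ denotes the density operator of $\psi$ with respect to the canonical trace $\mathrm{tr}_{\mathcal{A}}$ on $\mathcal{A}$ (the trace taking value $1$ on every minimal projection), i.e. $\psi(a)=\mathrm{tr}_{\mathcal{A}}(D_\psi a)$ for all $a \in \mathcal{A}$. $\log$ is the base $2$ logarithm, with the convention $\log 0 = -\infty$. The quantum relative entropy of $\psi$ with respect to $\varphi$ is $$S(\psi,\varphi) := \begin{cases} \mathrm{tr}_{\mathcal{A}}\, D_\psi(\log D_\psi - \log D_\varphi), & \text{if } \mathrm{supp}(\psi)\le \mathrm{supp}(\varphi),\\ \infty, & \text{otherwise,}\end{cases}$$ where $\mathrm{supp}$ denotes the support projection of a state (with the usual convention $0\log 0=0$). The infimum may equal $+\infty$. *)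

theory Defs
  imports
    "HOL-Analysis.Analysis"
    "HOL-Library.Poly_Mapping"
    "HOL-Library.Nonpos_Ints"
begin

section \<open>Finite-dimensional C*-algebras\<close>

class involution =
  fixes adj :: "'a \<Rightarrow> 'a"

text \<open>
  Unital C*-algebras.  A finite-dimensional C*-algebra always has a unit.  The condition
  \<open>norm 1 = 1\<close> contained in \<^class>\<open>real_normed_algebra_1\<close> (which also entails \<open>0 \<noteq> 1\<close>) follows from
  the C*-identity except for the zero algebra, which has no states.
\<close>
class cstar_algebra = real_normed_algebra_1 + banach + involution +
  fixes scaleC :: "complex \<Rightarrow> 'a \<Rightarrow> 'a"  (infixr \<open>*\<^sub>C\<close> 75)
  assumes scaleC_add_right: "c *\<^sub>C (x + y) = c *\<^sub>C x + c *\<^sub>C y"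
    and scaleC_add_left: "(c + d) *\<^sub>C x = c *\<^sub>C x + d *\<^sub>C x"
    and scaleC_scaleC: "c *\<^sub>C (d *\<^sub>C x) = (c * d) *\<^sub>C x"
    and scaleR_scaleC: "scaleR r x = complex_of_real r *\<^sub>C x"
    and mult_scaleC_left: "(c *\<^sub>C x) * y = c *\<^sub>C (x * y)"
    and mult_scaleC_right: "x * (c *\<^sub>C y) = c *\<^sub>C (x * y)"
    and norm_scaleC: "norm (c *\<^sub>C x) = cmod c * norm x"
    and adj_adj: "adj (adj x) = x"
    and adj_add: "adj (x + y) = adj x + adj y"
    and adj_scaleC: "adj (c *\<^sub>C x) = cnj c *\<^sub>C adj x"
    and adj_mult: "adj (x * y) = adj y * adj x"
    and cstar_identity: "norm (adj x * x) = (norm x)\<^sup>2"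

class fd_cstar_algebra = cstar_algebra +
  assumes finite_dimensional: "\<exists>B. finite B \<and> (\<forall>x. \<exists>c. x = (\<Sum>b\<in>B. c b *\<^sub>C b))"

lemma vector_space_scaleC: "vector_space (scaleC :: complex \<Rightarrow> 'a::cstar_algebra \<Rightarrow> 'a)"
proof
  fix x :: 'a
  show "1 *\<^sub>C x = x" using scaleR_scaleC[of 1 x] by simp
qed (simp_all add: scaleC_add_right scaleC_add_left scaleC_scaleC)

abbreviation clinear :: "('a::cstar_algebra \<Rightarrow> complex) \<Rightarrow> bool" where
  "clinear f \<equiv> Vector_Spaces.linear scaleC (*) f"

lemma clinear_iff:
  "clinear f \<longleftrightarrow> (\<forall>x y. f (x + y) = f x + f y) \<and> (\<forall>c x. f (c *\<^sub>C x) = c * f x)"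
proof -
  have "vector_space ((*) :: complex \<Rightarrow> complex \<Rightarrow> complex)"
    by unfold_locales (simp_all add: algebra_simps)
  with vector_space_scaleC show ?thesis
    unfolding Vector_Spaces.linear_def module_hom_def module_hom_axioms_def module_iff_vector_space
    by blast
qed


section \<open>Projections, states, density operators\<close>

definition is_projection :: "'a::{times,involution} \<Rightarrow> bool" where
  "is_projection p \<longleftrightarrow> p * p = p \<and> adj p = p"

definition proj_le :: "'a::{times,involution} \<Rightarrow> 'a \<Rightarrow> bool" where
  "proj_le p q \<longleftrightarrow> q * p = p"

definition minimal_projection :: "'a::cstar_algebra \<Rightarrow> bool" where
  "minimal_projection p \<longleftrightarrow> is_projection p \<and> p \<noteq> 0 \<and>
     (\<forall>q. is_projection q \<and> proj_le q p \<longrightarrow> q = 0 \<or> q = p)"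

definition states :: "('a::cstar_algebra \<Rightarrow> complex) set" where
  "states = {\<phi>. clinear \<phi> \<and> (\<forall>a. \<phi> (adj a * a) \<in> nonneg_Reals) \<and> \<phi> 1 = 1}"

text \<open>In finite dimension there is exactly one functional with the following properties.\<close>
definition canonical_trace :: "'a::fd_cstar_algebra \<Rightarrow> complex" where
  "canonical_trace = (THE \<tau>. clinear \<tau> \<and> (\<forall>a b. \<tau> (a * b) = \<tau> (b * a)) \<and>
     (\<forall>p. minimal_projection p \<longrightarrow> \<tau> p = 1))"

definition density :: "('a::fd_cstar_algebra \<Rightarrow> complex) \<Rightarrow> 'a" where
  "density \<psi> = (THE d. \<forall>a. \<psi> a = canonical_trace (d * a))"

text \<open>The support projection of a state is the smallest projection on which it takes the value 1.\<close>
definition supp_proj :: "('a::fd_cstar_algebra \<Rightarrow> complex) \<Rightarrow> 'a" where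
  "supp_proj \<psi> = (THE p. is_projection p \<and> \<psi> p = 1 \<and>
     (\<forall>q. is_projection q \<and> \<psi> q = 1 \<longrightarrow> proj_le p q))"


section \<open>Functional calculus and relative entropy\<close>

text \<open>Some of the projections \<open>P l\<close> may vanish; this does not affect the functional calculus.\<close>
definition spectral_decomposition :: "'a::fd_cstar_algebra \<Rightarrow> real set \<Rightarrow> (real \<Rightarrow> 'a) \<Rightarrow> bool" where
  "spectral_decomposition a L P \<longleftrightarrow> finite L \<and> (\<forall>l\<in>L. is_projection (P l)) \<and>
     (\<forall>l\<in>L. \<forall>m\<in>L. l \<noteq> m \<longrightarrow> P l * P m = 0) \<and> (\<Sum>l\<in>L. P l) = 1 \<and>
     a = (\<Sum>l\<in>L. l *\<^sub>R P l)"

definition functional_calculus :: "(real \<Rightarrow> real) \<Rightarrow> 'a::fd_cstar_algebra \<Rightarrow> 'a" where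
  "functional_calculus f a =
     (THE b. \<exists>L P. spectral_decomposition a L P \<and> b = (\<Sum>l\<in>L. f l *\<^sub>R P l))"

text \<open>
  The kernel of the operator is sent to 0.  In the relative entropy \<open>log D\<close> is only multiplied by
  density operators that annihilate this kernel, so this implements the convention
  \<open>0 \<cdot> log 0 = 0\<close>.
\<close>
definition log_op :: "'a::fd_cstar_algebra \<Rightarrow> 'a" where
  "log_op = functional_calculus (\<lambda>x. if x = 0 then 0 else log 2 x)"

definition relative_entropy ::
    "('a::fd_cstar_algebra \<Rightarrow> complex) \<Rightarrow> ('a \<Rightarrow> complex) \<Rightarrow> ereal" where
  "relative_entropy \<psi> \<phi> =
     (if proj_le (supp_proj \<psi>) (supp_proj \<phi>)
      then ereal (Re (canonical_trace (density \<psi> * (log_op (density \<psi>) - log_op (density \<phi>)))))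
      else \<infinity>)"

definition log2_ereal :: "real \<Rightarrow> ereal" where
  "log2_ereal x = (if x = 0 then -\<infinity> else ereal (log 2 x))"


section \<open>Algebraic tensor powers\<close>

text \<open>
  The type \<open>'a tensor\<close> is the direct sum of all the algebraic tensor powers of \<open>'a\<close>
  (for finite-dimensional \<open>'a\<close> each of these is the C*-tensor power): formal linear combinations
  of lists, the list \<open>[a\<^sub>1, \<dots>, a\<^sub>n]\<close> standing for the elementary tensor of its entries, modulo
  multilinearity.  The \<open>n\<close>-th power is the span of the lists of length \<open>n\<close>; the operations are
  defined on all powers simultaneously, products of different powers being 0.
\<close>

definition fscale :: "complex \<Rightarrow> ('b \<Rightarrow>\<^sub>0 complex) \<Rightarrow> ('b \<Rightarrow>\<^sub>0 complex)" where
  "fscale c f = Poly_Mapping.map ((*) c) f"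

inductive_set multilinear_relations :: "('a::cstar_algebra list \<Rightarrow>\<^sub>0 complex) set" where
  mr_zero: "0 \<in> multilinear_relations"
| mr_add: "f \<in> multilinear_relations \<Longrightarrow> g \<in> multilinear_relations
    \<Longrightarrow> f + g \<in> multilinear_relations"
| mr_scale: "f \<in> multilinear_relations \<Longrightarrow> fscale c f \<in> multilinear_relations"
| mr_additive: "Poly_Mapping.single (us @ (x + y) # vs) 1 - Poly_Mapping.single (us @ x # vs) 1
    - Poly_Mapping.single (us @ y # vs) 1 \<in> multilinear_relations"
| mr_homogeneous: "Poly_Mapping.single (us @ (c *\<^sub>C x) # vs) 1 - Poly_Mapping.single (us @ x # vs) c
    \<in> multilinear_relations"

lemma lookup_fscale [simp]: "Poly_Mapping.lookup (fscale c f) x = c * Poly_Mapping.lookup f x"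
  unfolding fscale_def by (simp add: Poly_Mapping.map.rep_eq when_def)

lemma fscale_minus_one: "fscale (-1) f = - f"
  by (rule poly_mapping_eqI) simp

lemma mr_uminus: "f \<in> multilinear_relations \<Longrightarrow> - f \<in> multilinear_relations"
  using mr_scale[of f "-1"] by (simp add: fscale_minus_one)

lemma mr_diff: "f \<in> multilinear_relations \<Longrightarrow> g \<in> multilinear_relations
    \<Longrightarrow> f - g \<in> multilinear_relations"
  using mr_add[OF _ mr_uminus, of f g] by simp

quotient_type (overloaded) 'a tensor = "'a::cstar_algebra list \<Rightarrow>\<^sub>0 complex" /
  "\<lambda>f g. f - g \<in> multilinear_relations"
proof (rule equivpI)
  show "reflp (\<lambda>f g :: 'a list \<Rightarrow>\<^sub>0 complex. f - g \<in> multilinear_relations)"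
    by (rule reflpI) (simp add: mr_zero)
  show "symp (\<lambda>f g :: 'a list \<Rightarrow>\<^sub>0 complex. f - g \<in> multilinear_relations)"
    by (rule sympI) (metis minus_diff_eq mr_uminus)
  show "transp (\<lambda>f g :: 'a list \<Rightarrow>\<^sub>0 complex. f - g \<in> multilinear_relations)"
  proof (rule transpI)
    fix f g h :: "'a list \<Rightarrow>\<^sub>0 complex"
    assume "f - g \<in> multilinear_relations" "g - h \<in> multilinear_relations"
    from mr_add[OF this] show "f - h \<in> multilinear_relations" by simp
  qed
qed

definition tensor_power :: "nat \<Rightarrow> 'a::cstar_algebra tensor set" where
  "tensor_power n =
     {abs_tensor f | f. \<forall>xs\<in>Poly_Mapping.keys f. length xs = n}"

lift_definition pure_tensor :: "'a::cstar_algebra list \<Rightarrow> 'a tensor" is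
  "\<lambda>xs. Poly_Mapping.single xs 1" .

lift_definition scale_tensor :: "complex \<Rightarrow> 'a::cstar_algebra tensor \<Rightarrow> 'a tensor" is fscale
proof -
  fix c and f g :: "'a list \<Rightarrow>\<^sub>0 complex"
  assume "f - g \<in> multilinear_relations"
  moreover have "fscale c f - fscale c g = fscale c (f - g)"
    by (rule poly_mapping_eqI) (simp add: lookup_minus right_diff_distrib)
  ultimately show "fscale c f - fscale c g \<in> multilinear_relations" by (simp add: mr_scale)
qed

instantiation tensor :: (cstar_algebra) ab_group_add
begin

lift_definition zero_tensor :: "'a tensor" is 0 .

lift_definition plus_tensor :: "'a tensor \<Rightarrow> 'a tensor \<Rightarrow> 'a tensor" is "(+)"
  by (drule (1) mr_add) (simp add: algebra_simps)

lift_definition minus_tensor :: "'a tensor \<Rightarrow> 'a tensor \<Rightarrow> 'a tensor" is "(-)"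
  by (drule (1) mr_diff) (simp add: algebra_simps)

lift_definition uminus_tensor :: "'a tensor \<Rightarrow> 'a tensor" is uminus
  by (drule mr_uminus) (simp add: algebra_simps)

instance
  by standard (transfer; simp add: mr_zero algebra_simps)+

end

lemma sum_keys_superset:
  fixes f :: "'b \<Rightarrow>\<^sub>0 complex"
  assumes "finite S" "Poly_Mapping.keys f \<subseteq> S" "\<And>x. h x 0 = (0::'c::comm_monoid_add)"
  shows "(\<Sum>x\<in>Poly_Mapping.keys f. h x (Poly_Mapping.lookup f x)) =
    (\<Sum>x\<in>S. h x (Poly_Mapping.lookup f x))"
  by (rule sum.mono_neutral_left) (use assms in \<open>auto simp: in_keys_iff\<close>)

lemma sum_keys_add:
  fixes f g :: "'b \<Rightarrow>\<^sub>0 complex"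
  assumes "\<And>x. h x 0 = (0::'c::comm_monoid_add)" "\<And>x c d. h x (c + d) = h x c + h x d"
  shows "(\<Sum>x\<in>Poly_Mapping.keys (f + g). h x (Poly_Mapping.lookup (f + g) x)) =
    (\<Sum>x\<in>Poly_Mapping.keys f. h x (Poly_Mapping.lookup f x)) +
    (\<Sum>x\<in>Poly_Mapping.keys g. h x (Poly_Mapping.lookup g x))"
proof -
  let ?S = "Poly_Mapping.keys f \<union> Poly_Mapping.keys g"
  have k: "Poly_Mapping.keys (f + g) \<subseteq> ?S" by (rule Poly_Mapping.keys_add)
  have "(\<Sum>x\<in>Poly_Mapping.keys u. h x (Poly_Mapping.lookup u x)) =
      (\<Sum>x\<in>?S. h x (Poly_Mapping.lookup u x))"
    if "Poly_Mapping.keys u \<subseteq> ?S" for u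
    by (rule sum_keys_superset) (use that assms in auto)
  from this[OF k] this[of f] this[of g] show ?thesis
    by (simp add: assms lookup_add sum.distrib)
qed

lemma sum_keys_fscale:
  fixes f :: "'b \<Rightarrow>\<^sub>0 complex"
  assumes "\<And>x. h x 0 = (0::'c::comm_monoid_add)"
  shows "(\<Sum>x\<in>Poly_Mapping.keys (fscale c f). h x (Poly_Mapping.lookup (fscale c f) x)) =
    (\<Sum>x\<in>Poly_Mapping.keys f. h x (c * Poly_Mapping.lookup f x))"
proof -
  have k: "Poly_Mapping.keys (fscale c f) \<subseteq> Poly_Mapping.keys f" by (auto simp: in_keys_iff)
  show ?thesis
    by (subst sum_keys_superset[OF _ k, of h]) (simp_all add: assms)
qed

lemma fscale_zero_right [simp]: "fscale c 0 = 0"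
  and fscale_add: "fscale c (f + g) = fscale c f + fscale c g"
  and fscale_single: "fscale c (Poly_Mapping.single x d) = Poly_Mapping.single x (c * d)"
  by (rule poly_mapping_eqI, simp add: lookup_add algebra_simps lookup_single when_def)+

lemma fscale_sum: "fscale c (sum F S) = (\<Sum>x\<in>S. fscale c (F x))"
  by (induction S rule: infinite_finite_induct) (auto simp: fscale_add)

definition fmult :: "('a::times list \<Rightarrow>\<^sub>0 complex) \<Rightarrow> ('a list \<Rightarrow>\<^sub>0 complex) \<Rightarrow> ('a list \<Rightarrow>\<^sub>0 complex)" where
  "fmult f g = (\<Sum>xs\<in>Poly_Mapping.keys f. \<Sum>ys\<in>Poly_Mapping.keys g.
     if length xs = length ys
     then Poly_Mapping.single (map2 (*) xs ys)
       (Poly_Mapping.lookup f xs * Poly_Mapping.lookup g ys)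
     else 0)"

definition fadj :: "('a::involution list \<Rightarrow>\<^sub>0 complex) \<Rightarrow> ('a list \<Rightarrow>\<^sub>0 complex)" where
  "fadj f = (\<Sum>xs\<in>Poly_Mapping.keys f.
     Poly_Mapping.single (map adj xs) (cnj (Poly_Mapping.lookup f xs)))"

definition fprod :: "('a \<Rightarrow> complex) \<Rightarrow> ('a list \<Rightarrow>\<^sub>0 complex) \<Rightarrow> complex" where
  "fprod \<phi> f = (\<Sum>xs\<in>Poly_Mapping.keys f. Poly_Mapping.lookup f xs * (\<Prod>x\<leftarrow>xs. \<phi> x))"

lemma fmult_commute_sums:
  "fmult f g = (\<Sum>ys\<in>Poly_Mapping.keys g. \<Sum>xs\<in>Poly_Mapping.keys f.
     if length xs = length ys
     then Poly_Mapping.single (map2 (*) xs ys)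
       (Poly_Mapping.lookup f xs * Poly_Mapping.lookup g ys)
     else 0)"
  unfolding fmult_def by (rule sum.swap)

lemma fmult_add_left: "fmult (f + g) h = fmult f h + fmult g h"
  unfolding fmult_def
  by (rule sum_keys_add[where h = "\<lambda>xs c. \<Sum>ys\<in>Poly_Mapping.keys h. if length xs = length ys
        then Poly_Mapping.single (map2 (*) xs ys) (c * Poly_Mapping.lookup h ys) else 0"])
     (auto simp: sum.distrib[symmetric] single_add distrib_right intro!: sum.cong sum.neutral)

lemma fmult_add_right: "fmult h (f + g) = fmult h f + fmult h g"
  unfolding fmult_commute_sums
  by (rule sum_keys_add[where h = "\<lambda>ys c. \<Sum>xs\<in>Poly_Mapping.keys h. if length xs = length ys
        then Poly_Mapping.single (map2 (*) xs ys) (Poly_Mapping.lookup h xs * c) else 0"])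
     (auto simp: sum.distrib[symmetric] single_add distrib_left intro!: sum.cong sum.neutral)

lemma fmult_scale_left: "fmult (fscale c f) g = fscale c (fmult f g)"
  unfolding fmult_def
  by (subst sum_keys_fscale[where h = "\<lambda>xs c. \<Sum>ys\<in>Poly_Mapping.keys g. if length xs = length ys
        then Poly_Mapping.single (map2 (*) xs ys) (c * Poly_Mapping.lookup g ys) else 0"])
     (auto simp: fscale_sum fscale_single mult.assoc if_distrib cong: if_cong
       intro!: sum.cong sum.neutral)

lemma fmult_scale_right: "fmult g (fscale c f) = fscale c (fmult g f)"
  unfolding fmult_commute_sums
  by (subst sum_keys_fscale[where h = "\<lambda>ys c. \<Sum>xs\<in>Poly_Mapping.keys g. if length xs = length ys
        then Poly_Mapping.single (map2 (*) xs ys) (Poly_Mapping.lookup g xs * c) else 0"])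
     (auto simp: fscale_sum fscale_single mult.left_commute if_distrib cong: if_cong
       intro!: sum.cong sum.neutral)

lemma fmult_zero [simp]: "fmult 0 g = 0" "fmult g 0 = 0"
  by (simp_all add: fmult_def)

lemma fmult_diff_left: "fmult (f - g) h = fmult f h - fmult g h"
  by (metis add_diff_cancel_right' diff_add_cancel fmult_add_left)

lemma fmult_diff_right: "fmult h (f - g) = fmult h f - fmult h g"
  by (metis add_diff_cancel_right' diff_add_cancel fmult_add_right)

lemma fmult_single: "fmult (Poly_Mapping.single xs c) (Poly_Mapping.single ys d) =
  (if length xs = length ys then Poly_Mapping.single (map2 (*) xs ys) (c * d) else 0)"
  by (cases "c = 0"; cases "d = 0") (auto simp: fmult_def)

lemma poly_mapping_single_induct [case_names single add]:
  fixes f :: "'b \<Rightarrow>\<^sub>0 complex"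
  assumes "\<And>x c. P (Poly_Mapping.single x c)" "\<And>f g. P f \<Longrightarrow> P g \<Longrightarrow> P (f + g)"
  shows "P f"
proof (induction f rule: Poly_Mapping.update_induct)
  case const
  then show ?case using assms(1)[of undefined 0] by simp
next
  case (update f a b)
  have "Poly_Mapping.update a b f = f + Poly_Mapping.single a b"
    using update(1) by (intro poly_mapping_eqI)
      (auto simp: lookup_update lookup_add lookup_single when_def in_keys_iff)
  then show ?case using update assms by auto
qed

lemma single_fscale: "Poly_Mapping.single x c = fscale c (Poly_Mapping.single x 1)"
  by (simp add: fscale_single)

lemma mr_additive': "Poly_Mapping.single (us @ (x + y) # vs) c - Poly_Mapping.single (us @ x # vs) c
    - Poly_Mapping.single (us @ y # vs) c \<in> multilinear_relations"
proof -
  have "fscale c (Poly_Mapping.single (us @ (x + y) # vs) 1 - Poly_Mapping.single (us @ x # vs) 1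
    - Poly_Mapping.single (us @ y # vs) 1) = Poly_Mapping.single (us @ (x + y) # vs) c
    - Poly_Mapping.single (us @ x # vs) c - Poly_Mapping.single (us @ y # vs) c"
    by (rule poly_mapping_eqI) (simp add: lookup_minus lookup_single when_def)
  then show ?thesis using mr_scale[OF mr_additive, of c us x y vs] by simp
qed

lemma mr_homogeneous': "Poly_Mapping.single (us @ (c *\<^sub>C x) # vs) d
    - Poly_Mapping.single (us @ x # vs) (d * c) \<in> multilinear_relations"
proof -
  have "fscale d (Poly_Mapping.single (us @ (c *\<^sub>C x) # vs) 1 - Poly_Mapping.single (us @ x # vs) c) =
    Poly_Mapping.single (us @ (c *\<^sub>C x) # vs) d - Poly_Mapping.single (us @ x # vs) (d * c)"
    by (rule poly_mapping_eqI) (simp add: lookup_minus lookup_single when_def algebra_simps)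
  then show ?thesis using mr_scale[OF mr_homogeneous, of d us c x vs] by simp
qed

lemma split_length_eq:
  assumes "length (us @ x # vs) = length ys"
  obtains us' y vs' where "ys = us' @ y # vs'" "length us' = length us" "length vs' = length vs"
proof
  show "ys = take (length us) ys @ ys ! length us # drop (Suc (length us)) ys"
    using assms by (simp add: id_take_nth_drop)
qed (use assms in auto)

lemma fmult_mr_left: "f \<in> multilinear_relations \<Longrightarrow> fmult f g \<in> multilinear_relations"
proof (induction g rule: poly_mapping_single_induct)
  case (single ys d)
  from single show ?case
  proof induction
    case (mr_additive us x y vs)
    show ?case
    proof (cases "length (us @ x # vs) = length ys")
      case True
      then obtain us' z vs' where "ys = us' @ z # vs'" "length us' = length us" "length vs' = length vs"
        by (rule split_length_eq)
      then show ?thesis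
        by (simp add: fmult_diff_left fmult_single distrib_right mr_additive')
    qed (simp add: fmult_diff_left fmult_single mr_zero)
  next
    case (mr_homogeneous us c x vs)
    show ?case
    proof (cases "length (us @ x # vs) = length ys")
      case True
      then obtain us' z vs' where "ys = us' @ z # vs'" "length us' = length us" "length vs' = length vs"
        by (rule split_length_eq)
      then show ?thesis
        using mr_homogeneous'[of "map2 (*) us us'" c "x * z" "map2 (*) vs vs'" d]
        by (simp add: fmult_diff_left fmult_single mult_scaleC_left mult.commute)
    qed (simp add: fmult_diff_left fmult_single mr_zero)
  qed (simp_all add: fmult_add_left fmult_scale_left multilinear_relations.intros(1-3))
qed (simp add: fmult_add_right mr_add)

lemma fmult_mr_right: "f \<in> multilinear_relations \<Longrightarrow> fmult g f \<in> multilinear_relations"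
proof (induction g rule: poly_mapping_single_induct)
  case (single ys d)
  from single show ?case
  proof induction
    case (mr_additive us x y vs)
    show ?case
    proof (cases "length (us @ x # vs) = length ys")
      case True
      then obtain us' z vs' where "ys = us' @ z # vs'" "length us' = length us" "length vs' = length vs"
        by (rule split_length_eq)
      then show ?thesis
        by (simp add: fmult_diff_right fmult_single distrib_left mr_additive')
    qed (auto simp add: fmult_diff_right fmult_single mr_zero)
  next
    case (mr_homogeneous us c x vs)
    show ?case
    proof (cases "length (us @ x # vs) = length ys")
      case True
      then obtain us' z vs' where "ys = us' @ z # vs'" "length us' = length us" "length vs' = length vs"
        by (rule split_length_eq)
      then show ?thesis
        using mr_homogeneous'[of "map2 (*) us' us" c "z * x" "map2 (*) vs' vs" d]
        by (simp add: fmult_diff_right fmult_single mult_scaleC_right)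
    qed (auto simp add: fmult_diff_right fmult_single mr_zero)
  qed (simp_all add: fmult_add_right fmult_scale_right multilinear_relations.intros(1-3))
qed (simp add: fmult_add_left mr_add)

lemma fadj_zero [simp]: "fadj 0 = 0"
  by (simp add: fadj_def)

lemma fadj_add: "fadj (f + g) = fadj f + fadj g"
  unfolding fadj_def
  by (rule sum_keys_add[where h = "\<lambda>xs c. Poly_Mapping.single (map adj xs) (cnj c)"])
     (auto simp: single_add)

lemma fadj_diff: "fadj (f - g) = fadj f - fadj g"
  by (metis add_diff_cancel_right' diff_add_cancel fadj_add)

lemma fadj_fscale: "fadj (fscale c f) = fscale (cnj c) (fadj f)"
  unfolding fadj_def
  by (subst sum_keys_fscale[where h = "\<lambda>xs c. Poly_Mapping.single (map adj xs) (cnj c)"])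
     (auto simp: fscale_sum fscale_single)

lemma fadj_single: "fadj (Poly_Mapping.single xs c) = Poly_Mapping.single (map adj xs) (cnj c)"
  by (cases "c = 0") (auto simp: fadj_def)

lemma fadj_mr: "f \<in> multilinear_relations \<Longrightarrow> fadj f \<in> multilinear_relations"
  by (induction rule: multilinear_relations.induct)
     (simp_all add: multilinear_relations.intros fadj_add fadj_diff fadj_fscale fadj_single
       adj_add adj_scaleC)

lemma fprod_zero [simp]: "fprod \<phi> 0 = 0"
  by (simp add: fprod_def)

lemma fprod_add: "fprod \<phi> (f + g) = fprod \<phi> f + fprod \<phi> g"
  unfolding fprod_def
  by (rule sum_keys_add[where h = "\<lambda>xs c. c * (\<Prod>x\<leftarrow>xs. \<phi> x)"]) (auto simp: distrib_right)

lemma fprod_diff: "fprod \<phi> (f - g) = fprod \<phi> f - fprod \<phi> g"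
  by (metis add_diff_cancel_right' diff_add_cancel fprod_add)

lemma fprod_fscale: "fprod \<phi> (fscale c f) = c * fprod \<phi> f"
  unfolding fprod_def
  by (subst sum_keys_fscale[where h = "\<lambda>xs c. c * (\<Prod>x\<leftarrow>xs. \<phi> x)"])
     (auto simp: sum_distrib_left mult.assoc)

lemma fprod_single: "fprod \<phi> (Poly_Mapping.single xs c) = c * (\<Prod>x\<leftarrow>xs. \<phi> x)"
  by (cases "c = 0") (auto simp: fprod_def)

lemma fprod_mr: "f \<in> multilinear_relations \<Longrightarrow> clinear \<phi> \<Longrightarrow> fprod \<phi> f = 0"
  by (induction rule: multilinear_relations.induct)
     (simp_all add: clinear_iff fprod_add fprod_diff fprod_fscale fprod_single algebra_simps)

instantiation tensor :: (cstar_algebra) "{ring, involution}"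
begin

lift_definition times_tensor :: "'a tensor \<Rightarrow> 'a tensor \<Rightarrow> 'a tensor" is fmult
proof -
  fix f f' g g' :: "'a list \<Rightarrow>\<^sub>0 complex"
  assume "f - f' \<in> multilinear_relations" "g - g' \<in> multilinear_relations"
  then have "fmult (f - f') g + fmult f' (g - g') \<in> multilinear_relations"
    by (intro mr_add fmult_mr_left fmult_mr_right)
  then show "fmult f g - fmult f' g' \<in> multilinear_relations"
    by (simp add: fmult_diff_left fmult_diff_right)
qed

lift_definition adj_tensor :: "'a tensor \<Rightarrow> 'a tensor" is fadj
  by (metis fadj_diff fadj_mr)

lemma fmult_assoc: "fmult (fmult f g) h = fmult f (fmult g (h :: 'a list \<Rightarrow>\<^sub>0 complex))"
proof (induction f rule: poly_mapping_single_induct)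
  case (single xs c)
  show ?case
  proof (induction g rule: poly_mapping_single_induct)
    case (single ys d)
    show ?case
    proof (induction h rule: poly_mapping_single_induct)
      case (single zs e)
      have "map2 (*) (map2 (*) xs ys) zs = map2 (*) xs (map2 (*) ys zs)"
        if "length xs = length ys" "length ys = length zs"
        using that by (induction xs ys zs rule: list_induct3) (auto simp: mult.assoc)
      then show ?case by (auto simp: fmult_single mult.assoc)
    qed (simp add: fmult_add_right)
  qed (simp add: fmult_add_right fmult_add_left)
qed (simp add: fmult_add_left)

instance
proof
  fix s t u :: "'a tensor"
  show "s * t * u = s * (t * u)" by transfer (simp add: fmult_assoc mr_zero)
  show "(s + t) * u = s * u + t * u" by transfer (simp add: fmult_add_left mr_zero)
  show "s * (t + u) = s * t + s * u" by transfer (simp add: fmult_add_right mr_zero)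
qed

end

text \<open>
  For linear \<open>\<phi>\<close> this is, on the \<open>n\<close>-th power, the \<open>n\<close>-fold product functional.
  Nonlinear \<open>\<phi>\<close>, for which there is no such functional, are mapped to 0.
\<close>
lift_definition product_functional ::
    "('a::cstar_algebra \<Rightarrow> complex) \<Rightarrow> 'a tensor \<Rightarrow> complex" is
  "\<lambda>\<phi> f. if clinear \<phi> then fprod \<phi> f else 0"
proof -
  fix \<phi> :: "'a \<Rightarrow> complex" and f g :: "'a list \<Rightarrow>\<^sub>0 complex"
  assume "f - g \<in> multilinear_relations"
  then show "(if clinear \<phi> then fprod \<phi> f else 0) = (if clinear \<phi> then fprod \<phi> g else 0)"
    using fprod_mr[of "f - g" \<phi>] by (simp add: fprod_diff)
qed

lemma pure_tensor_add:
  "pure_tensor (us @ (x + y) # vs) = pure_tensor (us @ x # vs) + pure_tensor (us @ y # vs)"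
  by transfer (metis diff_diff_eq mr_additive)

lemma pure_tensor_scaleC:
  "pure_tensor (us @ (c *\<^sub>C x) # vs) = scale_tensor c (pure_tensor (us @ x # vs))"
  by transfer (simp add: fscale_single mr_homogeneous)

lemma pure_tensor_mult:
  "length xs = length ys \<Longrightarrow> pure_tensor xs * pure_tensor ys = pure_tensor (map2 (*) xs ys)"
  by transfer (simp add: fmult_single mr_zero)

lemma adj_pure_tensor: "adj (pure_tensor xs) = pure_tensor (map adj xs)"
  by transfer (simp add: fadj_single mr_zero)

lemma product_functional_pure:
  "clinear \<phi> \<Longrightarrow> product_functional \<phi> (pure_tensor xs) = (\<Prod>x\<leftarrow>xs. \<phi> x)"
  by transfer (simp add: fprod_single)

lemma product_functional_add:
  "product_functional \<phi> (s + t) = product_functional \<phi> s + product_functional \<phi> t"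
  by transfer (simp add: fprod_add)

lemma product_functional_scale:
  "product_functional \<phi> (scale_tensor c t) = c * product_functional \<phi> t"
  by transfer (simp add: fprod_fscale)

lemma pure_tensor_in_tensor_power: "length xs = n \<Longrightarrow> pure_tensor xs \<in> tensor_power n"
  unfolding tensor_power_def pure_tensor_def
  by (auto intro!: exI[of _ "Poly_Mapping.single xs 1"])


definition projection_sequence :: "(nat \<Rightarrow> 'a::fd_cstar_algebra tensor) \<Rightarrow> bool" where
  "projection_sequence p \<longleftrightarrow> (\<forall>n\<ge>1. p n \<in> tensor_power n \<and> is_projection (p n))"

end

theory Submission
  imports Defs
    "HOL-Computational_Algebra.Fundamental_Theorem_Algebra"
    "HOL-Real_Asymp.Real_Asymp"
begin

text \<open>
  The proof uses only typical subspaces.  For a single \<open>\<psi>\<close> with \<open>supp \<psi> \<le> supp \<phi>\<close> let \<open>R\<close> be the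
  projection onto the words that are typical for \<open>\<psi>\<close> in an eigenbasis of \<open>D\<^sub>\<psi>\<close>, and \<open>S\<close> the projection
  onto the words that are typical for \<open>\<psi>\<close> in an eigenbasis of \<open>D\<^sub>\<phi>\<close>; by Chebyshev's inequality
  \<open>\<psi>\<close> gives both almost full weight.  Bounding eigenvalues of \<open>D\<^sub>\<psi>\<close> on \<open>R\<close> and of \<open>D\<^sub>\<phi>\<close> on \<open>S\<close> shows that
  \<open>y = R S\<close> satisfies \<open>\<phi>(y* y) \<lesssim> 2\<^bsup>-n S(\<psi>,\<phi>)\<^esup>\<close>, and, by the same estimates read backwards, that every
  projection \<open>q\<close> with \<open>\<psi>(q) \<rightarrow> 1\<close> satisfies \<open>\<phi>(q) \<gtrsim> 2\<^bsup>-n S(\<psi>,\<phi>)\<^esup>\<close>.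

  For a set \<open>\<Psi>\<close> choose polynomially many representatives \<open>\<psi>\<^sub>i \<in> \<Psi>\<close>, close enough to all
  other elements that their \<open>n\<close>-fold products are still close, and let \<open>p\<^sub>n\<close> be the spectral
  projection of \<open>\<Sum>\<^sub>i y\<^sub>i* y\<^sub>i\<close> for \<open>[1/n, \<infinity>)\<close>.  Then \<open>p\<^sub>n \<le> n \<Sum>\<^sub>i y\<^sub>i* y\<^sub>i\<close> bounds \<open>\<phi>(p\<^sub>n)\<close>, and the
  Cauchy-Schwarz inequality bounds each \<open>\<psi>\<^sub>i(1 - p\<^sub>n)\<close>.  States with infinite relative entropy are
  taken care of by the additional summand \<open>1 - supp(\<phi>)\<^bsup>\<otimes>n\<^esup>\<close>, which \<open>\<phi>\<close> annihilates.
\<close>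


section \<open>Finite-dimensional *-algebras and the spectral theorem\<close>

text \<open>The tensor powers come without a norm. The C*-identity is used once, as properness:
  \<open>adj x * x = 0\<close> forces \<open>x = 0\<close>. This already gives the spectral theorem
  and the canonical trace; by Parseval's identity the product of canonical traces is faithful on
  each tensor power, which is thus proper as well. One locale with a carrier \<open>V\<close> and
  its own unit \<open>e\<close> serves the algebra and its powers, which all live in one type.

  The obstacle is that the two densities need not commute, so R S need not be self-adjoint. All
  rearrangements rest on one fact: R commutes with the n-th power of the density of \<psi>, and S
  with that of \<phi>, so each product state is tracial against its own projection.

  The representatives vary with n, so the constant in Chebyshev's inequality must not depend on
  \<psi>. It does not, because l (log l)^2 is bounded on (0,1] and the logarithms of the positive
  eigenvalues of the density of \<phi> form a fixed finite set. Changing \<psi> by O(1/n^2) moves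
  its n-fold product by O(1/n), and a net that fine has only polynomially many points.\<close>

locale star_alg = vector_space sc
  for sc :: "complex \<Rightarrow> 'b::{ring,involution} \<Rightarrow> 'b" +
  fixes V :: "'b set" and e :: 'b
  assumes sc_mult_left: "sc c x * y = sc c (x * y)"
    and sc_mult_right: "x * sc c y = sc c (x * y)"
    and star_star: "adj (adj x) = (x::'b)"
    and star_add: "adj (x + y) = adj x + adj (y::'b)"
    and star_sc: "adj (sc c x) = sc (cnj c) (adj x)"
    and star_mult: "adj (x * y) = adj y * adj (x::'b)"
    and V_subspace: "subspace V"
    and V_mult: "x \<in> V \<Longrightarrow> y \<in> V \<Longrightarrow> x * y \<in> V"
    and V_star: "x \<in> V \<Longrightarrow> adj x \<in> V"
    and V_unit: "e \<in> V"
    and unit_left: "x \<in> V \<Longrightarrow> e * x = x"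
    and unit_right: "x \<in> V \<Longrightarrow> x * e = x"
    and V_finite_dim: "\<exists>B. finite B \<and> V \<subseteq> span B"
begin

lemma star_zero [simp]: "adj 0 = (0::'b)"
  using star_add[of 0 0] by simp

lemma star_minus: "adj (- x) = - adj (x::'b)"
  using star_add[of x "- x"] by (simp add: eq_neg_iff_add_eq_0 add.commute)

lemma star_diff: "adj (x - y) = adj x - adj (y::'b)"
  using star_add[of x "- y"] by (simp add: star_minus)

lemma star_sum: "adj (sum f A) = (\<Sum>i\<in>A. adj (f i :: 'b))"
  by (induction A rule: infinite_finite_induct) (auto simp: star_add)

lemmas V_add = subspace_add[OF V_subspace]
lemmas V_diff = subspace_diff[OF V_subspace]
lemmas V_sc = subspace_scale[OF V_subspace]
lemmas V_zero = subspace_0[OF V_subspace]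
lemmas V_sum = subspace_sum[OF V_subspace]
lemmas V_closed = V_add V_diff V_sc V_zero V_mult V_star V_unit

lemma star_unit [simp]: "adj e = e"
  by (metis V_star V_unit star_mult star_star unit_left)

lemma is_projection_star: "is_projection p \<Longrightarrow> adj p = p"
  and is_projection_idem: "is_projection p \<Longrightarrow> p * p = p"
  by (auto simp: is_projection_def)

lemma is_projection_unit [simp]: "is_projection e"
  by (simp add: is_projection_def V_unit unit_left)

lemma is_projection_compl: "p \<in> V \<Longrightarrow> is_projection p \<Longrightarrow> is_projection (e - p)"
  by (simp add: is_projection_def star_diff algebra_simps unit_left unit_right V_closed)

lemma independent_bound:
  "\<exists>N. \<forall>S. S \<subseteq> V \<longrightarrow> independent S \<longrightarrow> finite S \<and> card S \<le> N"
proof -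
  obtain B where B: "finite B" "V \<subseteq> span B" using V_finite_dim by blast
  have "finite S \<and> card S \<le> card B" if "S \<subseteq> V" "independent S" for S
    by (rule independent_span_bound[OF B(1) that(2) order_trans[OF that(1) B(2)]])
  then show ?thesis by (intro exI[of _ "card B"] allI impI)
qed

lemma sum_projections:
  assumes "finite I" "\<And>i. i \<in> I \<Longrightarrow> is_projection (P i :: 'b)"
    "\<And>i j. i \<in> I \<Longrightarrow> j \<in> I \<Longrightarrow> i \<noteq> j \<Longrightarrow> P i * P j = 0"
  shows "is_projection (\<Sum>i\<in>I. P i)"
proof -
  have "(\<Sum>i\<in>I. P i) * (\<Sum>i\<in>I. P i) = (\<Sum>i\<in>I. \<Sum>j\<in>I. if i = j then P i else 0)"
    unfolding sum_product using assms(2,3) by (intro sum.cong) (auto simp: is_projection_def)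
  also have "\<dots> = (\<Sum>i\<in>I. P i)" using assms(1) by (simp add: sum.delta)
  finally show ?thesis using assms(2) by (simp add: is_projection_def star_sum)
qed

section \<open>Polynomials in one element\<close>

fun ev_list :: "'b \<Rightarrow> complex list \<Rightarrow> 'b" where
  "ev_list a [] = 0"
| "ev_list a (c # cs) = sc c e + a * ev_list a cs"

text \<open>Horner evaluation with \<open>e\<close> as constant term: the ring type has no unit of
  its own, and each tensor power brings a different one.\<close>

definition ev :: "'b \<Rightarrow> complex poly \<Rightarrow> 'b" where
  "ev a p = ev_list a (coeffs p)"

lemma ev_0 [simp]: "ev a 0 = 0"
  by (simp add: ev_def)

lemma ev_pCons: "ev a (pCons c p) = sc c e + a * ev a p"
  by (cases "pCons c p = 0") (auto simp: ev_def cCons_def)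

lemma ev_in_V: "a \<in> V \<Longrightarrow> ev a p \<in> V"
  by (induction p) (auto simp: ev_pCons intro!: V_closed)

lemma ev_add: "a \<in> V \<Longrightarrow> ev a (p + q) = ev a p + ev a q"
  by (induction p q rule: poly_induct2) (auto simp: ev_pCons algebra_simps scale_left_distrib)

lemma ev_smult: "ev a (smult c p) = sc c (ev a p)"
  by (induction p) (auto simp: ev_pCons scale_right_distrib sc_mult_right)

lemma ev_mult: "a \<in> V \<Longrightarrow> ev a (p * q) = ev a p * ev a q"
  by (induction p)
     (auto simp: ev_pCons ev_add ev_smult distrib_right sc_mult_left unit_left ev_in_V mult.assoc)

lemma ev_1: "ev a 1 = e"
  unfolding one_pCons by (simp add: ev_pCons)

lemma ev_diff: "a \<in> V \<Longrightarrow> ev a (p - q) = ev a p - ev a q"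
  using ev_add[of a "p - q" q] by simp

lemma ev_sum: "a \<in> V \<Longrightarrow> ev a (sum f A) = (\<Sum>i\<in>A. ev a (f i))"
  by (induction A rule: infinite_finite_induct) (auto simp: ev_add)

lemma ev_X: "a \<in> V \<Longrightarrow> ev a [:0, 1:] = a"
  by (simp add: ev_pCons unit_right)

lemma ev_commute: "a \<in> V \<Longrightarrow> ev a p * ev a q = ev a q * ev a p"
  using ev_mult[of a p q] ev_mult[of a q p] by (simp add: mult.commute)

lemma star_ev:
  assumes "a \<in> V" "adj a = a"
  shows "\<exists>q. adj (ev a p) = ev a q"
proof (induction p)
  case (pCons c p)
  then obtain q where q: "adj (ev a p) = ev a q" by blast
  have "adj (ev a (pCons c p)) = sc (cnj c) e + ev a q * ev a [:0, 1:]"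
    using assms by (simp add: ev_pCons star_add star_sc star_mult q unit_right)
  also have "\<dots> = ev a (pCons (cnj c) q)"
    using assms by (subst ev_commute) (auto simp: ev_pCons ev_X unit_right)
  finally show ?case ..
qed (auto intro: exI[of _ 0])

lemma annihilating_polynomial:
  assumes "a \<in> V"
  obtains p where "p \<noteq> 0" "ev a p = 0"
proof -
  obtain N where N: "\<forall>S. S \<subseteq> V \<longrightarrow> independent S \<longrightarrow> finite S \<and> card S \<le> N"
    by (rule exE[OF independent_bound])
  define f where "f k = ev a (monom 1 k)" for k
  show ?thesis
  \<comment> \<open>Independence is a property of sets, so repeated powers would collapse in the
    image. A repetition gives the polynomial \<open>X^i - X^j\<close> directly; otherwise the
    \<open>N + 1\<close> distinct powers exceed the dimension bound.\<close>
  proof (cases "inj_on f {..N}")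
    case False
    then obtain i j where ij: "i \<noteq> j" "f i = f j" by (auto simp: inj_on_def)
    have "coeff (monom 1 i - monom 1 j :: complex poly) i \<noteq> 0" using ij by simp
    then have "monom 1 i - monom 1 j \<noteq> (0 :: complex poly)" by force
    moreover have "ev a (monom 1 i - monom 1 j) = 0" using ij assms by (simp add: ev_diff f_def)
    ultimately show ?thesis by (rule that)
  next
    case True
    have "dependent (f ` {..N})"
    proof (rule ccontr)
      assume "independent (f ` {..N})"
      moreover have "f ` {..N} \<subseteq> V" using assms by (auto simp: f_def ev_in_V)
      ultimately have "card (f ` {..N}) \<le> N" using N by blast
      then show False using True by (simp add: card_image)
    qed
    then obtain u v where u: "(\<Sum>v\<in>f ` {..N}. sc (u v) v) = 0" "v \<in> f ` {..N}" "u v \<noteq> 0"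
      by (auto simp: dependent_finite)
    then obtain i where i: "i \<le> N" "u (f i) \<noteq> 0" by auto
    define p where "p = (\<Sum>k\<le>N. smult (u (f k)) (monom 1 k))"
    have "coeff p i = (\<Sum>k\<le>N. if k = i then u (f i) else 0)"
      unfolding p_def coeff_sum by (intro sum.cong) auto
    also have "\<dots> = u (f i)" using i by (subst sum.delta) auto
    finally have "p \<noteq> 0" using i by auto
    moreover have "ev a p = (\<Sum>k\<le>N. sc (u (f k)) (f k))"
      unfolding p_def using assms by (simp add: ev_sum ev_smult f_def)
    then have "ev a p = 0" using u(1) True by (simp add: sum.reindex)
    ultimately show ?thesis by (rule that)
  qed
qed

text \<open>The notion \<open>spectral_decomposition\<close>, but for a carrier with its own unit,
  so that it also makes sense in a tensor power.\<close>

definition spectral :: "'b \<Rightarrow> real set \<Rightarrow> (real \<Rightarrow> 'b) \<Rightarrow> bool" where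
  "spectral a L P \<longleftrightarrow> finite L \<and> (\<forall>l\<in>L. P l \<in> V \<and> is_projection (P l)) \<and>
     (\<forall>l\<in>L. \<forall>m\<in>L. l \<noteq> m \<longrightarrow> P l * P m = 0) \<and> (\<Sum>l\<in>L. P l) = e \<and>
     a = (\<Sum>l\<in>L. sc (of_real l) (P l))"

lemma spectralD:
  assumes "spectral a L P"
  shows "finite L" "l \<in> L \<Longrightarrow> P l \<in> V" "l \<in> L \<Longrightarrow> is_projection (P l)"
    "l \<in> L \<Longrightarrow> m \<in> L \<Longrightarrow> P l * P m = (if l = m then P l else 0)"
    "(\<Sum>l\<in>L. P l) = e" "a = (\<Sum>l\<in>L. sc (of_real l) (P l))"
proof -
  note s = assms[unfolded spectral_def]
  show "finite L" "(\<Sum>l\<in>L. P l) = e" "a = (\<Sum>l\<in>L. sc (of_real l) (P l))" using s by blast+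
  show "P l \<in> V" if "l \<in> L" using s that by blast
  show "is_projection (P l)" if "l \<in> L" using s that by blast
  then have "P l * P l = P l" if "l \<in> L" using that is_projection_idem by blast
  moreover have "l \<noteq> m \<Longrightarrow> P l * P m = 0" if "l \<in> L" "m \<in> L" using s that by blast
  ultimately show "P l * P m = (if l = m then P l else 0)" if "l \<in> L" "m \<in> L"
    using that by (cases "l = m") auto
qed

lemma spectral_eigen:
  assumes "spectral a L P" "l \<in> L"
  shows "a * P l = sc (of_real l) (P l)" "P l * a = sc (of_real l) (P l)"
proof -
  note s = spectralD[OF assms(1)]
  have "a * P l = (\<Sum>m\<in>L. if m = l then sc (of_real l) (P l) else 0)"
    unfolding s(6) sum_distrib_right using s(4) assms(2)
    by (intro sum.cong) (auto simp: sc_mult_left)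
  then show "a * P l = sc (of_real l) (P l)" using s(1) assms(2) by (simp add: sum.delta')
  have "P l * a = (\<Sum>m\<in>L. if m = l then sc (of_real l) (P l) else 0)"
    unfolding s(6) sum_distrib_left using s(4) assms(2)
    by (intro sum.cong) (auto simp: sc_mult_right)
  then show "P l * a = sc (of_real l) (P l)" using s(1) assms(2) by (simp add: sum.delta')
qed

end

text \<open>Properness is what is kept of the C*-identity when no norm is given.\<close>

locale proper_star_alg = star_alg +
  assumes proper: "x \<in> V \<Longrightarrow> adj x * x = 0 \<Longrightarrow> x = 0"
begin

text \<open>By normality the square of \<open>adj x * x\<close> contains the factor
  \<open>x * x\<close>. As \<open>adj x * x\<close> is self-adjoint, properness applies first to it
  and then to \<open>x\<close>.\<close>

lemma normal_square_zero:
  assumes "x \<in> V" "adj x * x = x * adj x" "x * x = 0"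
  shows "x = 0"
proof -
  have c: "x * (adj x * y) = adj x * (x * y)" for y
    by (simp only: mult.assoc[symmetric] assms(2))
  have "adj (adj x * x) * (adj x * x) = adj x * (x * (adj x * x))"
    by (simp only: star_mult star_star mult.assoc)
  also have "\<dots> = 0" by (simp only: c assms(3) mult_zero_right)
  finally have "adj x * x = 0" by (rule proper[OF V_mult[OF V_star[OF assms(1)] assms(1)]])
  then show ?thesis by (rule proper[OF assms(1)])
qed

text \<open>The element \<open>x - adj x * x\<close> is a null vector, so \<open>x\<close> equals
  the self-adjoint element \<open>adj x * x\<close>.\<close>

lemma normal_idempotent:
  assumes "x \<in> V" "adj x * x = x * adj x" "x * x = x"
  shows "is_projection x"
proof -
  let ?y = "x - adj x * x"
  have c: "x * (adj x * y) = adj x * (x * y)" for y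
    by (simp only: mult.assoc[symmetric] assms(2))
  have d: "adj x * (adj x * y) = adj x * y" for y
    by (simp only: mult.assoc[symmetric] star_mult[symmetric] assms(3))
  have "adj ?y * ?y = 0"
    by (simp only: star_diff star_mult star_star left_diff_distrib right_diff_distrib mult.assoc
      assms(3) c d) simp
  moreover have "?y \<in> V" using assms(1) by (intro V_diff V_mult V_star)
  ultimately have "?y = 0" by (rule proper[rotated])
  then have x: "adj x * x = x" by simp
  have "adj x = adj (adj x * x)" by (simp only: x)
  also have "\<dots> = x" unfolding star_mult star_star by (rule x)
  finally show ?thesis using assms(3) by (simp add: is_projection_def)
qed

lemma ev_normal:
  assumes "a \<in> V" "adj a = a"
  shows "adj (ev a p) * ev a p = ev a p * adj (ev a p)"
proof -
  obtain q where "adj (ev a p) = ev a q" using star_ev[OF assms] by blast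
  then show ?thesis by (simp add: ev_commute[OF assms(1), of q p])
qed

text \<open>Multiplicities of roots are irrelevant: by the Nullstellensatz a power of
  \<open>g\<close> is a multiple of \<open>p\<close>, so \<open>ev a g\<close> is nilpotent, and a
  normal nilpotent element vanishes. Hence \<open>ev a\<close> only sees the values of a polynomial
  on the roots of \<open>p\<close>.\<close>

lemma ev_eq_0:
  assumes "a \<in> V" "adj a = a" "p \<noteq> 0" "ev a p = 0" "\<And>z. poly p z = 0 \<Longrightarrow> poly g z = 0"
  shows "ev a g = 0"
proof -
  have red: "ev a f = 0" if "ev a (f ^ (2 ^ k)) = 0" for f k
    using that
  proof (induction k)
    case (Suc k)
    have "ev a (f ^ (2 ^ k)) * ev a (f ^ (2 ^ k)) = 0"
      using Suc.prems assms(1) by (simp flip: ev_mult power_add add: mult_2)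
    then have "ev a (f ^ (2 ^ k)) = 0"
      by (rule normal_square_zero[OF ev_in_V[OF assms(1)] ev_normal[OF assms(1,2)]])
    then show ?case by (rule Suc.IH)
  qed simp
  have "p dvd g ^ degree p" using assms(3,5) nullstellensatz_univariate[of p g] by blast
  \<comment> \<open>\<open>red\<close> removes exponents by repeated halving, so the exponent is
    first enlarged to a power of two.\<close>
  moreover have "g ^ degree p dvd g ^ (2 ^ degree p)"
    by (intro le_imp_power_dvd) (simp add: less_imp_le)
  ultimately obtain h where "g ^ (2 ^ degree p) = p * h" by (meson dvd_def dvd_trans)
  then have "ev a (g ^ (2 ^ degree p)) = 0" using assms by (simp add: ev_mult)
  then show ?thesis by (rule red)
qed

theorem spectral_theorem:
  assumes a: "a \<in> V" "adj a = a"
  obtains L P where "spectral a L P"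
proof -
  obtain p where p: "p \<noteq> 0" "ev a p = 0" using annihilating_polynomial[OF a(1)] .
  define Z where "Z = {z. poly p z = 0}"
  have fin: "finite Z" unfolding Z_def using p(1) by (rule poly_roots_finite)
  have zero: "ev a g = 0" if "\<And>z. z \<in> Z \<Longrightarrow> poly g z = 0" for g
    using ev_eq_0[OF a p] that by (auto simp: Z_def)
  have eq: "ev a g = ev a h" if "\<And>z. z \<in> Z \<Longrightarrow> poly g z = poly h z" for g h
    using zero[of "g - h"] that a(1) by (simp add: ev_diff)
  \<comment> \<open>Lagrange interpolation: \<open>q z\<close> is 1 at \<open>z\<close> and 0 at the
    other roots, so its value at \<open>a\<close> is the spectral projection for
    \<open>z\<close>.\<close>
  define q where "q z = (\<Prod>w\<in>Z - {z}. smult (1 / (z - w)) [:- w, 1:])" for z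
  have q: "poly (q z) w = (if z = w then 1 else 0)" if "z \<in> Z" "w \<in> Z" for z w
  proof (cases "z = w")
    case True
    have "poly (q z) z = (\<Prod>w\<in>Z - {z}. 1)"
      unfolding q_def poly_prod
    proof (rule prod.cong)
      fix w assume "w \<in> Z - {z}"
      then have "z - w \<noteq> 0" by auto
      then show "poly (smult (1 / (z - w)) [:- w, 1:]) z = 1" by (simp flip: diff_divide_distrib)
    qed simp
    then show ?thesis using True by simp
  next
    case False
    then show ?thesis using that fin by (auto simp: q_def poly_prod intro!: prod_zero bexI[of _ w])
  qed
  define E where "E z = ev a (q z)" for z
  have EV: "E z \<in> V" for z using a(1) by (simp add: E_def ev_in_V)
  have orth: "E z * E w = (if z = w then E z else 0)" if "z \<in> Z" "w \<in> Z" for z w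
  proof -
    have "ev a (q z * q w) = ev a (if z = w then q z else 0)"
      by (rule eq) (use q that in auto)
    then show ?thesis using a(1) by (simp add: ev_mult E_def split: if_splits)
  qed
  have proj: "is_projection (E z)" if "z \<in> Z" for z
    by (rule normal_idempotent[OF EV ev_normal[OF a, of "q z", folded E_def]])
      (simp add: orth[OF that that])
  have sumE: "(\<Sum>z\<in>Z. E z) = e"
  proof -
    have "ev a (\<Sum>z\<in>Z. q z) = ev a 1"
      by (rule eq) (use q fin in \<open>simp add: poly_sum sum.delta'\<close>)
    then show ?thesis using a(1) by (simp add: ev_sum ev_1 E_def)
  qed
  have aE: "a * E z = sc z (E z)" if "z \<in> Z" for z
  proof -
    have "ev a ([:0, 1:] * q z) = ev a (smult z (q z))"
      by (rule eq) (use q that in auto)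
    then show ?thesis using a(1) by (simp only: ev_mult ev_smult ev_X E_def)
  qed
  have sumaE: "(\<Sum>z\<in>Z. sc z (E z)) = a"
  proof -
    have "(\<Sum>z\<in>Z. sc z (E z)) = a * (\<Sum>z\<in>Z. E z)" by (simp add: sum_distrib_left aE)
    then show ?thesis using a(1) by (simp add: sumE unit_right)
  qed
  \<comment> \<open>\<open>p\<close> may have roots that are not eigenvalues. At a nonreal root
    self-adjointness of \<open>a\<close> forces the projection to vanish, so only real roots are
    kept below.\<close>
  have nonreal: "E z = 0" if z: "z \<in> Z" "z \<notin> \<real>" for z
  proof -
    have pE: "adj (E z) = E z" using proj[OF z(1)] by (rule is_projection_star)
    have EaE: "E z * (a * E z) = sc z (E z)"
      using aE[OF z(1)] orth[OF z(1) z(1)] by (simp add: sc_mult_right)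
    have "adj (E z * (a * E z)) = E z * (a * E z)"
      by (simp add: star_mult pE a(2) mult.assoc)
    then have "sc (cnj z) (E z) = sc z (E z)" by (simp add: EaE star_sc pE)
    then show ?thesis using z(2) by (auto simp: Reals_cnj_iff)
  qed
  define L where "L = {l. complex_of_real l \<in> Z}"
  have ZL: "of_real ` L = Z \<inter> \<real>" by (auto simp: L_def Reals_def)
  have L: "finite L"
    by (rule finite_imageD[where f = complex_of_real]) (use fin ZL in \<open>auto simp: inj_on_def\<close>)
  have red: "(\<Sum>l\<in>L. f (of_real l)) = (\<Sum>z\<in>Z. f z)" if "\<And>z. z \<in> Z \<Longrightarrow> z \<notin> \<real> \<Longrightarrow> f z = 0"
    for f :: "complex \<Rightarrow> 'a"
  proof -
    have "(\<Sum>l\<in>L. f (of_real l)) = sum f (Z \<inter> \<real>)"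
      unfolding ZL[symmetric] by (subst sum.reindex) (auto simp: inj_on_def)
    also have "\<dots> = sum f Z" using fin that by (intro sum.mono_neutral_left) auto
    finally show ?thesis .
  qed
  have "spectral a L (\<lambda>l. E (of_real l))"
    unfolding spectral_def
  proof (intro conjI ballI impI L)
    fix l m assume lm: "l \<in> L" "m \<in> L"
    then show "E (of_real l) \<in> V" "is_projection (E (of_real l))" using EV proj by (auto simp: L_def)
    assume "l \<noteq> m"
    then show "E (of_real l) * E (of_real m) = 0" using lm orth by (auto simp: L_def)
  next
    show "(\<Sum>l\<in>L. E (of_real l)) = e" using red[of E] nonreal sumE by simp
    show "a = (\<Sum>l\<in>L. sc (of_real l) (E (of_real l)))"
      by (rule trans[OF sumaE[symmetric] red[of "\<lambda>z. sc z (E z)", symmetric]]) (simp add: nonreal)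
  qed
  then show ?thesis by (rule that)
qed

end

section \<open>Minimal projections and the trace\<close>

context proper_star_alg
begin

definition minimal :: "'a \<Rightarrow> bool" where
  "minimal p \<longleftrightarrow> p \<in> V \<and> is_projection p \<and> p \<noteq> 0 \<and>
     (\<forall>q\<in>V. is_projection q \<and> p * q = q \<longrightarrow> q = 0 \<or> q = p)"

lemma minimalD:
  assumes "minimal p"
  shows "p \<in> V" "is_projection p" "p \<noteq> 0" "p * p = p" "adj p = p"
  using assms by (auto simp: minimal_def is_projection_def)

text \<open>A spectral projection of \<open>y\<close> for a nonzero eigenvalue lies below
  \<open>p\<close>, because \<open>p * y = y\<close>; minimality makes it equal to \<open>p\<close>,
  and then \<open>y = y * p\<close> is the eigenvalue times \<open>p\<close>.\<close>

lemma minimal_selfadjoint_scalar: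
  assumes p: "minimal p" and y: "y \<in> V" "adj y = y" "p * y = y"
  shows "\<exists>c. y = sc c p"
proof -
  obtain L P where s: "spectral y L P" using spectral_theorem[OF y(1,2)] .
  show ?thesis
  proof (cases "\<exists>l\<in>L. l \<noteq> 0 \<and> P l \<noteq> 0")
    case True
    then obtain l where l: "l \<in> L" "l \<noteq> 0" "P l \<noteq> 0" by blast
    have yP: "y * P l = sc (of_real l) (P l)" by (rule spectral_eigen(1)[OF s l(1)])
    have "sc (of_real l) (p * P l) = p * (y * P l)" by (simp add: yP sc_mult_right)
    also have "\<dots> = y * P l" by (simp only: mult.assoc[symmetric] y(3))
    also have "\<dots> = sc (of_real l) (P l)" by (rule yP)
    finally have "p * P l = P l" using l(2) by simp
    then have "P l = p"
      using p l(3) spectralD(2,3)[OF s l(1)] by (auto simp: minimal_def)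
    moreover have "y * p = y"
      using arg_cong[OF y(3), of adj] by (simp add: star_mult y(2) minimalD(5)[OF p])
    ultimately show ?thesis using yP by auto
  next
    case False
    then have "y = (\<Sum>l\<in>L. 0)"
      by (subst spectralD(6)[OF s], intro sum.cong) auto
    then show ?thesis by (intro exI[of _ 0]) simp
  qed
qed

lemma minimal_scalar:
  assumes p: "minimal p" and x: "x \<in> V"
  shows "\<exists>c. p * x * p = sc c p"
proof -
  note m = minimalD[OF p]
  define y where "y = p * x * p"
  have y: "y \<in> V" using m x by (auto simp: y_def intro!: V_closed)
  have py: "p * y = y" "p * adj y = adj y"
    by (simp_all add: y_def star_mult m(5) m(4) flip: mult.assoc)
  obtain c where c: "y + adj y = sc c p"
    using minimal_selfadjoint_scalar[OF p, of "y + adj y"] y py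
    by (auto simp: star_add star_star distrib_left add.commute intro!: V_closed)
  have "adj (sc \<i> (y - adj y)) = sc \<i> (y - adj y)"
    by (simp add: star_sc star_diff star_star scale_right_diff_distrib)
  then obtain d where d: "sc \<i> (y - adj y) = sc d p"
    using minimal_selfadjoint_scalar[OF p, of "sc \<i> (y - adj y)"] y py
    by (auto simp: sc_mult_right right_diff_distrib intro!: V_closed)
  have "y = sc (1/2) (y + adj y) + sc (- \<i> / 2) (sc \<i> (y - adj y))"
    by (simp add: scale_right_diff_distrib scale_right_distrib flip: scale_left_distrib)
  also have "\<dots> = sc (1/2 * c + (- \<i> / 2) * d) p"
    by (simp only: c d scale_scale scale_left_distrib)
  finally show ?thesis unfolding y_def by blast
qed

text \<open>The corner of a minimal projection is one-dimensional, so compression to it is a scalar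
  functional.\<close>

definition coef :: "'a \<Rightarrow> 'a \<Rightarrow> complex" where
  "coef p x = (THE c. p * x * p = sc c p)"

lemma coef_eqI: "minimal p \<Longrightarrow> p * x * p = sc c p \<Longrightarrow> coef p x = c"
  unfolding coef_def by (rule the_equality) (auto dest: minimalD)

lemma coef: "minimal p \<Longrightarrow> x \<in> V \<Longrightarrow> p * x * p = sc (coef p x) p"
  using minimal_scalar[of p x] by (auto simp: coef_eqI)

lemma coef_add: "minimal p \<Longrightarrow> x \<in> V \<Longrightarrow> y \<in> V \<Longrightarrow> coef p (x + y) = coef p x + coef p y"
  by (rule coef_eqI) (simp_all add: coef distrib_left distrib_right scale_left_distrib)

lemma coef_sc: "minimal p \<Longrightarrow> x \<in> V \<Longrightarrow> coef p (sc c x) = c * coef p x"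
  by (rule coef_eqI) (simp_all add: coef sc_mult_left sc_mult_right)

lemma coef_zero: "minimal p \<Longrightarrow> coef p 0 = 0"
  by (rule coef_eqI) simp_all

lemma coef_sum:
  assumes "minimal p" "\<And>i. i \<in> I \<Longrightarrow> f i \<in> V"
  shows "coef p (\<Sum>i\<in>I. f i) = (\<Sum>i\<in>I. coef p (f i))"
  using assms(2)
  by (induction I rule: infinite_finite_induct) (simp_all add: coef_zero coef_add V_sum assms(1))

text \<open>Positivity is not an axiom of the locale; in a one-dimensional corner it can be derived
  from properness. Positivity and faithfulness of the trace are inherited from these two
  statements.\<close>

lemma coef_star_mult:
  assumes p: "minimal p" and x: "x \<in> V"
  shows "coef p (adj x * x) \<in> nonneg_Reals" "coef p (adj x * x) = 0 \<Longrightarrow> x * p = 0"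
proof -
  note m = minimalD[OF p]
  define y where "y = x * p"
  have yp: "y * p = y" by (simp add: y_def m(4) mult.assoc)
  have py: "p * adj y = adj y" using arg_cong[OF yp, of adj] by (simp add: star_mult m(5))
  have y: "y \<in> V" using m x by (auto simp: y_def intro!: V_closed)
  have yy: "adj y * y = sc (coef p (adj x * x)) p"
    unfolding y_def using coef[OF p V_mult[OF V_star[OF x] x]]
    by (simp add: star_mult m(5) mult.assoc)
  show "x * p = 0" if "coef p (adj x * x) = 0"
    using proper[OF y] yy that by (simp add: y_def)
  have "sc (cnj (coef p (adj x * x))) p = adj (adj y * y)" by (simp add: yy star_sc m(5))
  also have "\<dots> = adj y * y" by (simp add: star_mult star_star)
  also have "\<dots> = sc (coef p (adj x * x)) p" by (rule yy)
  finally have "sc (cnj (coef p (adj x * x))) p = sc (coef p (adj x * x)) p" .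
  then have "coef p (adj x * x) \<in> \<real>" using m(3) by (simp add: Reals_cnj_iff)
  then obtain c where c: "coef p (adj x * x) = of_real c" by (auto elim: Reals_cases)
  have "c \<ge> 0"
  proof (rule ccontr)
    \<comment> \<open>Otherwise \<open>y + b p\<close> is a null vector for a suitable real \<open>b\<close>, hence \<open>y = - b p\<close> and \<open>c = b\<^sup>2\<close>.\<close>
    assume "\<not> c \<ge> 0"
    define g where "g = coef p y"
    have g: "p * y = sc g p" using coef[OF p y] yp by (simp add: g_def mult.assoc)
    have g': "adj y * p = sc (cnj g) p" using arg_cong[OF g, of adj] by (simp add: star_mult star_sc m(5))
    define b where "b = - Re g + sqrt ((Re g)\<^sup>2 - c)"
    have "(Re g)\<^sup>2 - c \<ge> 0" using \<open>\<not> c \<ge> 0\<close> zero_le_power2[of "Re g"] by linarith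
    then have "(b + Re g)\<^sup>2 = (Re g)\<^sup>2 - c" by (simp add: b_def)
    then have b: "c + 2 * b * Re g + b\<^sup>2 = 0" by (simp add: power2_eq_square algebra_simps)
    define z where "z = y + sc (of_real b) p"
    have "adj z * z = sc (of_real c + of_real b * cnj g + (of_real b * g + of_real b * of_real b)) p"
      unfolding z_def star_add star_sc m(5)
      by (simp add: distrib_left distrib_right sc_mult_left sc_mult_right m(4) g g' yy c
        scale_left_distrib scale_right_distrib add.assoc)
    also have "of_real c + of_real b * cnj g + (of_real b * g + of_real b * of_real b) =
        complex_of_real (c + 2 * b * Re g + b\<^sup>2)"
      by (simp add: complex_eq_iff power2_eq_square algebra_simps)
    finally have "adj z * z = 0" using b by simp
    moreover have "z \<in> V" unfolding z_def by (intro V_add V_sc y m(1))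
    ultimately have "z = 0" by (rule proper[rotated])
    then have "y = sc (- of_real b) p" by (simp add: z_def eq_neg_iff_add_eq_0)
    then have "adj y * y = sc (of_real (b\<^sup>2)) p"
      by (simp add: star_sc star_minus m(4,5) sc_mult_left sc_mult_right power2_eq_square)
    then have "of_real c = complex_of_real (b\<^sup>2)" using yy c m(3) by simp
    then have "c = b\<^sup>2" by (simp only: of_real_eq_iff)
    then show False using \<open>\<not> c \<ge> 0\<close> by simp
  qed
  then show "coef p (adj x * x) \<in> nonneg_Reals" by (simp add: c)
qed

section \<open>Resolutions of the unit into minimal projections\<close>

definition resolution :: "'a set \<Rightarrow> bool" where
  "resolution F \<longleftrightarrow> finite F \<and> F \<subseteq> V \<and> (\<forall>p\<in>F. is_projection p \<and> p \<noteq> 0) \<and>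
     (\<forall>p\<in>F. \<forall>q\<in>F. p \<noteq> q \<longrightarrow> p * q = 0) \<and> \<Sum>F = e"

lemma resolution_independent:
  assumes "resolution F"
  shows "independent F"
proof (rule ccontr)
  assume "\<not> independent F"
  moreover have F: "finite F" using assms by (simp add: resolution_def)
  ultimately obtain u v where u: "(\<Sum>w\<in>F. sc (u w) w) = 0" "v \<in> F" "u v \<noteq> 0"
    by (auto simp: dependent_finite)
  have "0 = v * (\<Sum>w\<in>F. sc (u w) w)" using u by simp
  also have "\<dots> = (\<Sum>w\<in>F. if w = v then sc (u v) v else 0)"
    unfolding sum_distrib_left using assms u(2)
    by (intro sum.cong) (auto simp: resolution_def is_projection_def sc_mult_right)
  also have "\<dots> = sc (u v) v" using F u(2) by simp
  finally have "sc (u v) v = 0" by simp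
  then show False using u(2,3) assms by (auto simp: resolution_def)
qed

lemma resolution_split:
  assumes F: "resolution F" and p: "p \<in> F" and q: "q \<in> V" "is_projection q" "p * q = q" "q \<noteq> 0" "q \<noteq> p"
  shows "resolution (insert q (insert (p - q) (F - {p})))"
    and "card (insert q (insert (p - q) (F - {p}))) = Suc (card F)"
proof -
  let ?G = "insert q (insert (p - q) (F - {p}))"
  note F' = F[unfolded resolution_def]
  have pp: "p * p = p" "adj p = p" "q * q = q" "adj q = q" "p \<in> V" using F' p q by (auto simp: is_projection_def)
  have qp: "q * p = q" using arg_cong[OF q(3), of adj] by (simp add: star_mult pp)
  have rq: "r * q = 0" "q * r = 0" "r * p = 0" "p * r = 0" if "r \<in> F - {p}" for r
  proof -
    show rp: "r * p = 0" "p * r = 0" using F' p that by auto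
    have "r * q = r * p * q" "q * r = q * (p * r)"
      by (simp_all add: mult.assoc q(3)) (simp add: qp flip: mult.assoc)
    then show "r * q = 0" "q * r = 0" by (simp_all add: rp)
  qed
  have nz: "r * r \<noteq> 0" if "r \<in> F" for r using F' that by (auto simp: is_projection_def)
  have d: "q \<noteq> p - q"
  proof
    assume "q = p - q"
    then have "q * q = q * (p - q)" by (rule arg_cong)
    then show False using q(4) by (simp add: right_diff_distrib qp pp)
  qed
  have qF: "q \<notin> F - {p}" using rq(1) nz by auto
  have pqF: "p - q \<notin> F - {p}"
  proof
    assume "p - q \<in> F - {p}"
    from rq(1,3)[OF this] have "(p - q) * (p - q) = 0" by (simp add: right_diff_distrib)
    then show False using nz \<open>p - q \<in> F - {p}\<close> by blast
  qed
  have fin: "finite F" using F' by simp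
  show "card ?G = Suc (card F)"
    using d qF pqF fin card.remove[OF fin p] by simp
  have sum_eq: "\<Sum>?G = \<Sum>F"
    using d qF pqF fin sum.remove[OF fin p, of "\<lambda>x. x"] by simp
  have "is_projection (p - q)"
    by (simp add: is_projection_def star_diff pp left_diff_distrib right_diff_distrib q(3) qp)
  show "resolution ?G"
    unfolding resolution_def
  proof (intro conjI)
    show "finite ?G" using fin by simp
    show "?G \<subseteq> V" using F' q(1) pp(5) by (auto intro!: V_diff)
    show "\<forall>r\<in>?G. is_projection r \<and> r \<noteq> 0"
      using F' q \<open>is_projection (p - q)\<close> by auto
    have "q * (p - q) = 0" "(p - q) * q = 0" by (simp_all add: right_diff_distrib left_diff_distrib qp pp q(3))
    moreover have "r * (p - q) = 0" "(p - q) * r = 0" if "r \<in> F - {p}" for r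
      using rq[OF that] by (simp_all add: right_diff_distrib left_diff_distrib)
    moreover have "r * r' = 0" if "r \<in> F - {p}" "r' \<in> F - {p}" "r \<noteq> r'" for r r'
      using F' that by auto
    ultimately show "\<forall>r\<in>?G. \<forall>r'\<in>?G.
        r \<noteq> r' \<longrightarrow> r * r' = 0"
      using rq(1,2) by (intro ballI impI) (elim insertE; simp)
    show "\<Sum>?G = e"
      unfolding sum_eq using F' by simp
  qed
qed

text \<open>Splitting a non-minimal member raises the cardinality, which linear independence bounds
  by the dimension. A resolution of greatest cardinality therefore has only minimal members.\<close>

lemma minimal_resolution_exists: "\<exists>F. resolution F \<and> (\<forall>p\<in>F. minimal p)"
proof -
  obtain N where N: "\<forall>S. S \<subseteq> V \<longrightarrow> independent S \<longrightarrow> finite S \<and> card S \<le> N"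
    by (rule exE[OF independent_bound])
  have bound: "card F < Suc N" if "resolution F" for F
    using N resolution_independent[OF that] that unfolding resolution_def by (auto simp: less_Suc_eq_le)
  \<comment> \<open>Members have to be nonzero, so in the degenerate case \<open>e = 0\<close> the
    starting point is the empty family.\<close>
  have ex: "resolution ({e} - {0})"
  proof (cases "e = 0")
    case True
    then have "{e} - {0} = {}" by simp
    then show ?thesis unfolding resolution_def using True by simp
  next
    case False
    then have "{e} - {0} = {e}" by simp
    then show ?thesis using False by (simp add: resolution_def V_unit)
  qed
  obtain F where F: "resolution F" "\<And>G. resolution G \<Longrightarrow> card G \<le> card F"
    using ex_has_greatest_nat[of resolution, OF ex, of card "Suc N"] bound by blast
  have "minimal p" if "p \<in> F" for p
  proof (unfold minimal_def, intro conjI ballI impI)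
    show "p \<in> V" "is_projection p" "p \<noteq> 0" using F(1) that by (auto simp: resolution_def)
    fix q assume q: "q \<in> V" "is_projection q \<and> p * q = q"
    show "q = 0 \<or> q = p"
    proof (rule ccontr)
      assume "\<not> ?thesis"
      then have "q \<noteq> 0" "q \<noteq> p" by auto
      note split = resolution_split[OF F(1) that q(1) conjunct1[OF q(2)] conjunct2[OF q(2)] this]
      show False using F(2)[OF split(1)] split(2) by simp
    qed
  qed
  then show ?thesis using F(1) by blast
qed

definition res :: "'a set" where
  "res = (SOME F. resolution F \<and> (\<forall>p\<in>F. minimal p))"

lemma res: "resolution res" "p \<in> res \<Longrightarrow> minimal p"
  using someI_ex[OF minimal_resolution_exists] unfolding res_def by auto

lemma sum_res: "\<Sum>res = e" and finite_res: "finite res"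
  using res(1) by (auto simp: resolution_def)

section \<open>The trace of a proper *-algebra\<close>

definition tr :: "'a \<Rightarrow> complex" where
  "tr x = (\<Sum>p\<in>res. coef p x)"

lemma tr_add: "x \<in> V \<Longrightarrow> y \<in> V \<Longrightarrow> tr (x + y) = tr x + tr y"
  unfolding tr_def by (simp add: coef_add res(2) sum.distrib)

lemma tr_sc: "x \<in> V \<Longrightarrow> tr (sc c x) = c * tr x"
  unfolding tr_def by (simp add: coef_sc res(2) sum_distrib_left)

text \<open>With \<open>x = p * a * q\<close> and \<open>y = q * b * p\<close>, the product
  \<open>x * y\<close> is a multiple of \<open>p\<close> and \<open>y * x\<close> a multiple of
  \<open>q\<close>. Evaluating \<open>x * y * x\<close> in both ways equates the two scalars when
  \<open>x\<close> is nonzero; otherwise both are 0. Cyclicity of \<open>tr\<close> and its value on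
  every minimal projection follow from this.\<close>

lemma coef_exchange:
  assumes p: "minimal p" and q: "minimal q" and ab: "a \<in> V" "b \<in> V"
  shows "coef p (a * q * b) = coef q (b * p * a)"
proof -
  note mp = minimalD[OF p] and mq = minimalD[OF q]
  define x where "x = p * a * q"
  define y where "y = q * b * p"
  have "x * y = p * (a * q * b) * p" by (simp add: x_def y_def mult.assoc) (simp add: mq(4) flip: mult.assoc)
  also have "\<dots> = sc (coef p (a * q * b)) p" by (rule coef[OF p]) (intro V_mult ab mq(1))
  finally have xy: "x * y = sc (coef p (a * q * b)) p" .
  have "y * x = q * (b * p * a) * q" by (simp add: x_def y_def mult.assoc) (simp add: mp(4) flip: mult.assoc)
  also have "\<dots> = sc (coef q (b * p * a)) q" by (rule coef[OF q]) (intro V_mult ab mp(1))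
  finally have yx: "y * x = sc (coef q (b * p * a)) q" .
  have px: "p * x = x" "x * q = x"
    by (simp_all add: x_def mult.assoc mq(4)) (simp add: mp(4) flip: mult.assoc)
  have "sc (coef p (a * q * b)) x = (x * y) * x" unfolding xy by (simp add: sc_mult_left px)
  also have "\<dots> = x * (y * x)" by (rule mult.assoc)
  also have "\<dots> = sc (coef q (b * p * a)) x" unfolding yx by (simp add: sc_mult_right px)
  finally show ?thesis using xy yx mp(3) mq(3) by (cases "x = 0") auto
qed

lemma tr_commute:
  assumes "a \<in> V" "b \<in> V"
  shows "tr (a * b) = tr (b * a)"
proof -
  have *: "tr (a * b) = (\<Sum>p\<in>res. \<Sum>q\<in>res. coef p (a * q * b))" if "a \<in> V" "b \<in> V" for a b
  proof -
    have "a * b = (\<Sum>q\<in>res. a * q * b)"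
      using that by (simp add: sum_res unit_right flip: sum_distrib_left sum_distrib_right)
    moreover have "coef p (\<Sum>q\<in>res. a * q * b) = (\<Sum>q\<in>res. coef p (a * q * b))" if "p \<in> res" for p
      by (intro coef_sum res(2) V_mult \<open>a \<in> V\<close> \<open>b \<in> V\<close> minimalD(1) that)
    ultimately show ?thesis unfolding tr_def by simp
  qed
  have "tr (a * b) = (\<Sum>p\<in>res. \<Sum>q\<in>res. coef q (b * p * a))"
    unfolding *[OF assms] by (intro sum.cong coef_exchange res(2) assms refl)
  also have "\<dots> = tr (b * a)" unfolding *[OF assms(2,1)] by (rule sum.swap)
  finally show ?thesis .
qed

text \<open>Exchanging \<open>p\<close> with the members of \<open>res\<close> turns the sum into
  the coefficient of the unit in the corner of \<open>p\<close>, so the choice made in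
  \<open>res\<close> leaves no trace in the result.\<close>

lemma tr_minimal:
  assumes p: "minimal p"
  shows "tr p = 1"
proof -
  note m = minimalD[OF p]
  have "tr p = (\<Sum>q\<in>res. coef q (e * p * e))"
    unfolding tr_def by (simp add: unit_left unit_right m)
  also have "\<dots> = (\<Sum>q\<in>res. coef p (e * q * e))"
    by (intro sum.cong coef_exchange res(2) p V_unit refl)
  also have "\<dots> = (\<Sum>q\<in>res. coef p q)"
    by (intro sum.cong) (simp_all add: unit_left unit_right minimalD(1) res(2))
  also have "\<dots> = coef p (\<Sum>q\<in>res. q)"
    by (rule coef_sum[symmetric, OF p]) (simp add: minimalD(1) res(2))
  also have "\<dots> = coef p e" by (simp add: sum_res)
  also have "\<dots> = 1" by (rule coef_eqI[OF p]) (simp add: unit_right m)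
  finally show ?thesis .
qed

text \<open>Cyclicity moves \<open>x * p\<close> into the corner of \<open>p\<close>, where the
  normalisation on minimal projections fixes the value.\<close>

lemma tr_unique:
  assumes add: "\<And>x y. t (x + y) = t x + t y" and sca: "\<And>c x. t (sc c x) = c * t x"
    and comm: "\<And>x y. t (x * y) = t (y * x)"
    and one: "\<And>p. minimal p \<Longrightarrow> t p = (1::complex)" and x: "x \<in> V"
  shows "t x = tr x"
proof -
  have t0: "t 0 = 0" using sca[of 0 0] by simp
  have tsum: "t (sum f I) = (\<Sum>i\<in>I. t (f i))" for f and I :: "'a set"
    by (induction I rule: infinite_finite_induct) (auto simp: t0 add)
  have "t x = t (\<Sum>p\<in>res. x * p)" by (simp add: sum_res unit_right x flip: sum_distrib_left)
  also have "\<dots> = (\<Sum>p\<in>res. t (x * p))" by (rule tsum)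
  also have "\<dots> = (\<Sum>p\<in>res. coef p x)"
  proof (rule sum.cong)
    fix p assume "p \<in> res"
    then have p: "minimal p" by (rule res(2))
    have "t (x * p) = t (x * p * p)" by (simp add: minimalD(4)[OF p] mult.assoc)
    also have "\<dots> = t (p * (x * p))" by (rule comm)
    also have "\<dots> = t (p * x * p)" by (simp add: mult.assoc)
    also have "\<dots> = coef p x" by (simp add: coef[OF p x] sca one[OF p])
    finally show "t (x * p) = coef p x" .
  qed simp
  finally show ?thesis by (simp add: tr_def)
qed

lemma tr_pos: "x \<in> V \<Longrightarrow> tr (adj x * x) \<in> nonneg_Reals"
proof -
  assume "x \<in> V"
  then have "coef p (adj x * x) \<in> nonneg_Reals" if "p \<in> res" for p
    by (rule coef_star_mult(1)[OF res(2)[OF that]])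
  then show ?thesis
    by (simp add: tr_def complex_nonneg_Reals_iff sum_nonneg sum.neutral)
qed

lemma tr_faithful:
  assumes "x \<in> V" "tr (adj x * x) = 0"
  shows "x = 0"
proof -
  have nn: "coef p (adj x * x) \<in> nonneg_Reals" if "p \<in> res" for p
    by (rule coef_star_mult[OF res(2)[OF that] assms(1)])
  then have "(\<Sum>p\<in>res. Re (coef p (adj x * x))) = 0 \<longleftrightarrow> (\<forall>p\<in>res. Re (coef p (adj x * x)) = 0)"
    by (intro sum_nonneg_eq_0_iff finite_res) (auto simp: complex_nonneg_Reals_iff)
  moreover have "(\<Sum>p\<in>res. Re (coef p (adj x * x))) = 0"
    using arg_cong[OF assms(2), of Re] by (simp add: tr_def)
  ultimately have "coef p (adj x * x) = 0" if "p \<in> res" for p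
    using nn that by (auto simp: complex_nonneg_Reals_iff complex_eq_iff)
  then have "x * p = 0" if "p \<in> res" for p
    using coef_star_mult(2)[OF res(2)[OF that] assms(1)] that by blast
  then have "x * \<Sum>res = 0" by (simp add: sum_distrib_left)
  then show ?thesis by (simp add: sum_res unit_right assms(1))
qed

end

section \<open>Positive functionals and faithful traces\<close>

context star_alg
begin

definition pos_fun :: "('b \<Rightarrow> complex) \<Rightarrow> bool" where
  "pos_fun \<omega> \<longleftrightarrow> (\<forall>x y. \<omega> (x + y) = \<omega> x + \<omega> y) \<and> (\<forall>c x. \<omega> (sc c x) = c * \<omega> x) \<and>
     (\<forall>x\<in>V. \<omega> (adj x * x) \<in> nonneg_Reals)"

text \<open>The squared GNS seminorm of \<omega>. Closeness to the unit is measured in it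
  throughout, because products of projections that do not commute are not projections.\<close>

definition nsq :: "('b \<Rightarrow> complex) \<Rightarrow> 'b \<Rightarrow> real" where
  "nsq \<omega> x = Re (\<omega> (adj x * x))"

lemma pos_funD:
  assumes "pos_fun \<omega>"
  shows "\<omega> (x + y) = \<omega> x + \<omega> y" "\<omega> (sc c x) = c * \<omega> x" "x \<in> V \<Longrightarrow> \<omega> (adj x * x) \<in> nonneg_Reals"
  using assms by (auto simp: pos_fun_def)

lemma pos_fun_zero: "pos_fun \<omega> \<Longrightarrow> \<omega> 0 = 0"
  using pos_funD(2)[of \<omega> 0 0] by simp

lemma pos_fun_diff: "pos_fun \<omega> \<Longrightarrow> \<omega> (x - y) = \<omega> x - \<omega> y"
  using pos_funD(1)[of \<omega> "x - y" y] by simp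

lemma pos_fun_sum: "pos_fun \<omega> \<Longrightarrow> \<omega> (\<Sum>i\<in>I. f i) = (\<Sum>i\<in>I. \<omega> (f i))"
  by (induction I rule: infinite_finite_induct) (simp_all add: pos_fun_zero pos_funD(1))

lemma nsq_nonneg: "pos_fun \<omega> \<Longrightarrow> x \<in> V \<Longrightarrow> nsq \<omega> x \<ge> 0"
  using pos_funD(3)[of \<omega> x] by (simp add: nsq_def complex_nonneg_Reals_iff)

lemma pos_fun_nsq: "pos_fun \<omega> \<Longrightarrow> x \<in> V \<Longrightarrow> \<omega> (adj x * x) = of_real (nsq \<omega> x)"
  using pos_funD(3)[of \<omega> x] by (simp add: nsq_def complex_nonneg_Reals_iff complex_eq_iff)

text \<open>Polarisation: \<omega> is real on \<open>adj z * z\<close> for \<open>z = e + x\<close>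
  and for \<open>z = e + sc \<i> x\<close>, which fixes the imaginary and the real part.\<close>

lemma pos_fun_star:
  assumes w: "pos_fun \<omega>" and x: "x \<in> V"
  shows "\<omega> (adj x) = cnj (\<omega> x)"
proof -
  have *: "Im (\<omega> (adj z * z)) = 0" if "z \<in> V" for z
    using pos_funD(3)[OF w that] by (simp add: complex_nonneg_Reals_iff)
  have "adj (e + x) * (e + x) = e + x + adj x + adj x * x"
    by (simp add: star_add distrib_left distrib_right unit_left unit_right V_unit V_star x)
  then have 1: "Im (\<omega> e) + Im (\<omega> x) + Im (\<omega> (adj x)) = 0"
    using *[of "e + x"] *[OF x] by (simp add: V_add V_unit x pos_funD(1)[OF w])
  have "adj (e + sc \<i> x) * (e + sc \<i> x) = e + sc \<i> x + sc (- \<i>) (adj x) + adj x * x"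
    by (simp add: star_add star_sc distrib_left distrib_right unit_left unit_right V_unit V_star V_sc x
        sc_mult_left sc_mult_right left_diff_distrib scale_right_diff_distrib)
  then have "Im (\<omega> e) + Re (\<omega> x) - Re (\<omega> (adj x)) = 0"
    using *[of "e + sc \<i> x"] *[OF x]
    by (simp add: V_add V_unit V_sc x pos_funD(1)[OF w] pos_funD(2)[OF w] pos_fun_diff[OF w])
  moreover have "Im (\<omega> e) = 0" using *[OF V_unit] by (simp add: unit_left V_unit)
  ultimately show ?thesis using 1 by (simp add: complex_eq_iff)
qed

lemma nsq_add_scaled:
  assumes w: "pos_fun \<omega>" and xy: "x \<in> V" "y \<in> V"
  shows "nsq \<omega> (x + sc (of_real s) y) = nsq \<omega> x + 2 * s * Re (\<omega> (adj x * y)) + s\<^sup>2 * nsq \<omega> y"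
proof -
  have "adj y * x = adj (adj x * y)" by (simp add: star_mult star_star)
  then have "Re (\<omega> (adj y * x)) = Re (\<omega> (adj x * y))"
    using pos_fun_star[OF w V_mult[OF V_star[OF xy(1)] xy(2)]] by simp
  then show ?thesis
    by (simp add: nsq_def star_add star_sc distrib_left distrib_right sc_mult_left sc_mult_right
        pos_funD(1,2)[OF w] power2_eq_square algebra_simps)
qed

lemma cauchy_schwarz:
  assumes w: "pos_fun \<omega>" and xy: "x \<in> V" "y \<in> V"
  shows "\<bar>Re (\<omega> (adj x * y))\<bar> \<le> sqrt (nsq \<omega> x) * sqrt (nsq \<omega> y)"
proof -
  define a b c where "a = nsq \<omega> x" and "b = nsq \<omega> y" and "c = Re (\<omega> (adj x * y))"
  have nn: "a + 2 * s * c + s\<^sup>2 * b \<ge> 0" for s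
    using nsq_nonneg[OF w V_add[OF xy(1) V_sc[OF xy(2)]], of "of_real s"]
    by (simp add: nsq_add_scaled[OF w xy] a_def b_def c_def)
  have ab: "a \<ge> 0" "b \<ge> 0" using nsq_nonneg[OF w] xy by (auto simp: a_def b_def)
  have "c\<^sup>2 \<le> a * b"
  proof (cases "b = 0")
    case True
    have "c = 0"
    proof (rule ccontr)
      assume "c \<noteq> 0"
      \<comment> \<open>For \<open>b = 0\<close> the quadratic is linear in \<open>s\<close>; this
        \<open>s\<close> gives it the value -1.\<close>
      then show False using nn[of "- (a + 1) / (2 * c)"] True by (simp add: field_simps)
    qed
    then show ?thesis using ab by simp
  next
    case False
    then have "b > 0" using ab by simp
    have "a + 2 * (- c / b) * c + (- c / b)\<^sup>2 * b = a - c\<^sup>2 / b"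
      using \<open>b > 0\<close> by (simp add: power2_eq_square field_simps)
    then have "c\<^sup>2 / b \<le> a" using nn[of "- c / b"] by simp
    then show ?thesis using \<open>b > 0\<close> by (simp add: field_simps)
  qed
  then have "sqrt (c\<^sup>2) \<le> sqrt (a * b)" by (rule real_sqrt_le_mono)
  then show ?thesis by (simp add: real_sqrt_mult a_def b_def c_def)
qed

text \<open>The parallelogram law with the nonnegative term of \<open>x - y\<close> dropped.\<close>

lemma nsq_add_le:
  assumes w: "pos_fun \<omega>" and xy: "x \<in> V" "y \<in> V"
  shows "nsq \<omega> (x + y) \<le> 2 * nsq \<omega> x + 2 * nsq \<omega> y"
  using nsq_add_scaled[OF w xy, of 1] nsq_add_scaled[OF w xy, of "-1"]
    nsq_nonneg[OF w V_add[OF xy(1) V_sc[OF xy(2)]], of "-1"] by simp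

lemma nsq_projection: "is_projection p \<Longrightarrow> nsq \<omega> p = Re (\<omega> p)"
  by (simp add: nsq_def is_projection_def)

lemma pos_fun_projection:
  assumes "pos_fun \<omega>" "p \<in> V" "is_projection p"
  shows "Re (\<omega> p) \<ge> 0" "Im (\<omega> p) = 0"
  using pos_funD(3)[OF assms(1,2)] assms(3) by (simp_all add: is_projection_def complex_nonneg_Reals_iff)

lemma pos_fun_projection_le:
  assumes "pos_fun \<omega>" "p \<in> V" "is_projection p"
  shows "Re (\<omega> p) \<le> Re (\<omega> e)"
  using pos_fun_projection(1)[OF assms(1) V_diff[OF V_unit assms(2)] is_projection_compl[OF assms(2,3)]]
  by (simp add: pos_fun_diff[OF assms(1)])

lemma projection_mult_split:
  assumes "is_projection q" "z \<in> V"
  shows "adj z * z = adj (q * z) * (q * z) + adj ((e - q) * z) * ((e - q) * z)"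
proof -
  have q: "q * (q * z) = q * z" "adj q = q"
    using assms(1) by (auto simp: is_projection_def simp flip: mult.assoc)
  show ?thesis
    by (simp add: star_mult star_diff q left_diff_distrib right_diff_distrib unit_left unit_right
        assms(2) V_star mult.assoc)
qed

lemma nsq_projection_mult_le:
  assumes w: "pos_fun \<omega>" and q: "q \<in> V" "is_projection q" and z: "z \<in> V"
  shows "nsq \<omega> (q * z) \<le> nsq \<omega> z"
proof -
  have "nsq \<omega> z = nsq \<omega> (q * z) + nsq \<omega> ((e - q) * z)"
    unfolding nsq_def projection_mult_split[OF q(2) z] by (simp add: pos_funD(1)[OF w])
  moreover have "nsq \<omega> ((e - q) * z) \<ge> 0"
    by (intro nsq_nonneg w V_mult V_diff V_unit q z)
  ultimately show ?thesis by simp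
qed

end

context proper_star_alg
begin

text \<open>Some member \<open>p\<close> of \<open>res\<close> is not annihilated by
  \<open>P\<close>, and then \<open>P\<close> dominates a projection equivalent to \<open>p\<close>,
  of trace 1. This is what makes the eigenvalues of a density at most 1.\<close>

lemma tr_projection_ge_1:
  assumes P: "P \<in> V" "is_projection P" "P \<noteq> 0"
  shows "Re (tr P) \<ge> 1"
proof -
  have PP: "P * P = P" "adj P = P" using P by (auto simp: is_projection_def)
  have "\<exists>p\<in>res. P * p \<noteq> 0"
  proof (rule ccontr)
    assume "\<not> ?thesis"
    then have "(\<Sum>p\<in>res. P * p) = 0" by (intro sum.neutral) auto
    then have "P * \<Sum>res = 0" by (simp add: sum_distrib_left)
    then show False using P by (simp add: sum_res unit_right)
  qed
  then obtain p where p: "p \<in> res" "P * p \<noteq> 0" by blast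
  note m = res(2)[OF p(1)] and mm = minimalD[OF res(2)[OF p(1)]]
  define x where "x = P * p"
  have xV: "x \<in> V" unfolding x_def by (intro V_mult P mm)
  have "adj x * x = p * P * p" by (simp add: x_def star_mult mm PP mult.assoc) (simp add: PP flip: mult.assoc)
  then have xx: "adj x * x = sc (coef p P) p" using coef[OF m P(1)] by simp
  have "coef p (adj P * P) \<in> nonneg_Reals" by (rule coef_star_mult[OF m P(1)])
  then obtain r where r: "coef p P = of_real r" "r \<ge> 0" by (auto simp: PP elim: nonneg_Reals_cases)
  have "r \<noteq> 0"
    using coef_star_mult(2)[OF m P(1)] p(2) r by (auto simp: PP)
  \<comment> \<open>The range projection of \<open>x\<close>: as \<open>adj x * x\<close> is
    \<open>r\<close> times \<open>p\<close>, the element \<open>x * adj x\<close> only has to be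
    divided by \<open>r\<close>.\<close>
  define R where "R = sc (of_real (1 / r)) (x * adj x)"
  have xp: "x * p = x" by (simp add: x_def mm mult.assoc)
  have Px: "P * x = x" by (simp add: x_def PP flip: mult.assoc)
  have RV: "R \<in> V" unfolding R_def by (intro V_sc V_mult V_star xV)
  have adjR: "adj R = R" by (simp add: R_def star_sc star_mult star_star)
  have "x * adj x * (x * adj x) = x * (adj x * x) * adj x" by (simp add: mult.assoc)
  also have "\<dots> = sc (of_real r) (x * adj x)" by (simp add: xx r sc_mult_left sc_mult_right xp)
  finally have RR: "R * R = R"
    using \<open>r \<noteq> 0\<close> by (simp add: R_def sc_mult_left sc_mult_right)
  have PR: "P * R = R" by (simp add: R_def sc_mult_right Px flip: mult.assoc)
  have RP: "R * P = R" using arg_cong[OF PR, of adj] by (simp add: star_mult adjR PP)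
  have "tr R = of_real (1 / r) * tr (adj x * x)"
    unfolding R_def by (subst tr_sc) (simp_all add: V_mult V_star xV tr_commute[of x "adj x"])
  also have "\<dots> = 1" using \<open>r \<noteq> 0\<close> by (simp add: xx r tr_sc mm tr_minimal[OF m])
  finally have "tr R = 1" .
  have "adj (P - R) * (P - R) = P - R"
    by (simp add: star_diff PP adjR left_diff_distrib right_diff_distrib PR RP RR)
  then have "tr (P - R) \<in> nonneg_Reals" using tr_pos[OF V_diff[OF P(1) RV]] by simp
  moreover have "tr P = tr (P - R) + tr R" using tr_add[OF V_diff[OF P(1) RV] RV] by simp
  ultimately show ?thesis using \<open>tr R = 1\<close> by (simp add: complex_nonneg_Reals_iff)
qed

end

text \<open>The trace is arbitrary rather than \<open>tr\<close>, so the product trace can be used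
  on a tensor power without determining the minimal projections there.\<close>

locale tracial_star_alg = star_alg +
  fixes \<tau> :: "'a \<Rightarrow> complex"
  assumes tau_add: "\<tau> (x + y) = \<tau> x + \<tau> y"
    and tau_sc: "\<tau> (sc c x) = c * \<tau> x"
    and tau_commute: "x \<in> V \<Longrightarrow> y \<in> V \<Longrightarrow> \<tau> (x * y) = \<tau> (y * x)"
    and tau_pos: "x \<in> V \<Longrightarrow> \<tau> (adj x * x) \<in> nonneg_Reals"
    and tau_faithful: "x \<in> V \<Longrightarrow> \<tau> (adj x * x) = 0 \<Longrightarrow> x = 0"
begin

lemma pos_fun_tau: "pos_fun \<tau>"
  by (simp add: pos_fun_def tau_add tau_sc tau_pos)

sublocale proper_star_alg
proof
  fix x assume "x \<in> V" "adj x * x = 0"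
  then show "x = 0" using tau_faithful[of x] pos_fun_zero[OF pos_fun_tau] by simp
qed

text \<open>Cyclicity turns the value at \<open>adj x * x\<close> into the trace of the square of
  \<open>x * adj h\<close>.\<close>

lemma pos_fun_mult:
  assumes h: "h \<in> V"
  shows "pos_fun (\<lambda>x. \<tau> (adj h * h * x))"
  unfolding pos_fun_def
proof (intro conjI allI ballI)
  fix x assume x: "x \<in> V"
  have "\<tau> (adj h * h * (adj x * x)) = \<tau> (adj h * (h * (adj x * x)))" by (simp add: mult.assoc)
  also have "\<dots> = \<tau> (h * (adj x * x) * adj h)" by (intro tau_commute V_mult V_star x h)
  also have "\<dots> = \<tau> (adj (x * adj h) * (x * adj h))" by (simp add: star_mult star_star mult.assoc)
  also have "\<dots> \<in> nonneg_Reals" by (intro tau_pos V_mult V_star x h)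
  finally show "\<tau> (adj h * h * (adj x * x)) \<in> nonneg_Reals" .
qed (simp_all add: distrib_left tau_add tau_sc sc_mult_right)

lemma tau_projection_mult:
  assumes "p \<in> V" "is_projection p" "z \<in> V"
  shows "Re (\<tau> (p * (z * adj z))) \<ge> 0"
  using nsq_nonneg[OF pos_fun_mult[OF assms(1)] V_star[OF assms(3)]] assms(2)
  by (simp add: nsq_def is_projection_def star_star)

lemma tau_projection_pos:
  assumes "p \<in> V" "is_projection p" "p \<noteq> 0"
  shows "Re (\<tau> p) > 0"
  using tau_pos[OF assms(1)] tau_faithful[OF assms(1)] assms(2,3)
  by (auto simp: is_projection_def complex_nonneg_Reals_iff complex_eq_iff order_le_less)

text \<open>The bounds are stated for all positive functionals at once because the same
  \<open>p\<close> has to serve \<phi> and every \<psi>. For the second one,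
  \<open>q = e - p\<close> is split as \<open>y q + (e - y) q\<close>; Cauchy-Schwarz then leaves
  \<open>e - y\<close> as a left factor, which is why its adjoint appears in the bound.\<close>

lemma union_projection:
  assumes I: "finite I" and y: "\<And>i. i \<in> I \<Longrightarrow> y i \<in> V" and eps: "\<epsilon> > 0"
  obtains p where "p \<in> V" "is_projection p"
    "\<And>\<omega>. pos_fun \<omega> \<Longrightarrow> Re (\<omega> p) \<le> (\<Sum>i\<in>I. nsq \<omega> (y i)) / \<epsilon>"
    "\<And>\<omega> i. pos_fun \<omega> \<Longrightarrow> \<omega> e = 1 \<Longrightarrow> i \<in> I \<Longrightarrow>
      Re (\<omega> (e - p)) \<le> sqrt \<epsilon> + sqrt (nsq \<omega> (adj (e - y i)))"
proof -
  define A where "A = (\<Sum>i\<in>I. adj (y i) * y i)"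
  have AV: "A \<in> V" unfolding A_def by (intro V_sum V_mult V_star y)
  have "adj A = A" by (simp add: A_def star_sum star_mult star_star)
  then obtain L P where s: "spectral A L P" using spectral_theorem[OF AV] by blast
  note sD = spectralD[OF s]
  have conj: "adj z * (A * z) = (\<Sum>i\<in>I. adj (y i * z) * (y i * z))" for z
    by (simp add: A_def star_mult sum_distrib_left sum_distrib_right mult.assoc)
  \<comment> \<open>Positivity of the eigenvalues of \<open>A\<close> is tested with the faithful
    trace. It is needed to extend the sum over \<open>L1\<close> to all of \<open>L\<close>.\<close>
  have nonneg: "l \<ge> 0" if l: "l \<in> L" "P l \<noteq> 0" for l
  proof -
    have pl: "adj (P l) = P l" "P l * P l = P l" using sD(3)[OF l(1)] by (auto simp: is_projection_def)
    have "of_real l * \<tau> (P l) = \<tau> (adj (P l) * (A * P l))"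
      by (simp add: spectral_eigen(1)[OF s l(1)] pl sc_mult_right tau_sc)
    also have "\<dots> = (\<Sum>i\<in>I. \<tau> (adj (y i * P l) * (y i * P l)))"
      unfolding conj by (rule pos_fun_sum[OF pos_fun_tau])
    finally have "Re (of_real l * \<tau> (P l)) = (\<Sum>i\<in>I. nsq \<tau> (y i * P l))" by (simp add: nsq_def)
    also have "\<dots> \<ge> 0" by (intro sum_nonneg nsq_nonneg pos_fun_tau V_mult y sD(2) l)
    finally have "l * Re (\<tau> (P l)) \<ge> 0" by simp
    then show ?thesis using tau_projection_pos[OF sD(2,3)[OF l(1)] l(2)] by (simp add: zero_le_mult_iff)
  qed
  define L1 where "L1 = {l\<in>L. l \<ge> \<epsilon>}"
  define p where "p = (\<Sum>l\<in>L1. P l)"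
  define q where "q = (\<Sum>l\<in>L - L1. P l)"
  have fin: "finite L1" "finite (L - L1)" "L1 \<subseteq> L" using sD(1) by (auto simp: L1_def)
  have pq: "e - p = q" unfolding p_def q_def sD(5)[symmetric] using fin sD(1)
    by (simp add: sum.subset_diff[of L1 L])
  have pV: "p \<in> V" "is_projection p"
    unfolding p_def using sD(1) by (auto intro!: V_sum sum_projections sD simp: sD(4) L1_def)
  have qV: "q \<in> V" "is_projection q"
    unfolding q_def using sD(1) by (auto intro!: V_sum sum_projections sD simp: sD(4) L1_def)
  have Aq: "A * q = (\<Sum>l\<in>L - L1. sc (of_real l) (P l))"
    unfolding q_def sum_distrib_left by (intro sum.cong refl spectral_eigen(1)[OF s]) auto
  have qAq: "adj q * (A * q) = (\<Sum>l\<in>L - L1. sc (of_real l) (P l))"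
  proof -
    have "q * P l = P l" if "l \<in> L - L1" for l
    proof -
      have "q * P l = (\<Sum>m\<in>L - L1. if m = l then P l else 0)"
        unfolding q_def sum_distrib_right using that by (intro sum.cong) (auto simp: sD(4))
      then show ?thesis using that fin by simp
    qed
    then show ?thesis
      unfolding Aq using qV(2) by (simp add: is_projection_def sum_distrib_left sc_mult_right)
  qed
  show ?thesis
  proof (rule that[OF pV])
    fix \<omega> assume w: "pos_fun \<omega>"
    have lP: "l * Re (\<omega> (P l)) \<ge> 0" if "l \<in> L" for l
      using nonneg[OF that] pos_fun_projection(1)[OF w sD(2,3)[OF that]] pos_fun_zero[OF w]
      by (cases "P l = 0") auto
    have "\<epsilon> * Re (\<omega> p) = (\<Sum>l\<in>L1. \<epsilon> * Re (\<omega> (P l)))"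
      by (simp add: p_def pos_fun_sum[OF w] sum_distrib_left)
    also have "\<dots> \<le> (\<Sum>l\<in>L1. l * Re (\<omega> (P l)))"
      using fin(3) by (intro sum_mono mult_right_mono pos_fun_projection(1)[OF w] sD) (auto simp: L1_def)
    also have "\<dots> \<le> (\<Sum>l\<in>L. l * Re (\<omega> (P l)))"
      using sD(1) fin(3) lP by (intro sum_mono2) auto
    also have "\<dots> = Re (\<omega> A)"
      by (subst sD(6)) (simp add: pos_fun_sum[OF w] pos_funD(2)[OF w])
    also have "\<dots> = (\<Sum>i\<in>I. nsq \<omega> (y i))" by (simp add: A_def pos_fun_sum[OF w] nsq_def)
    finally show "Re (\<omega> p) \<le> (\<Sum>i\<in>I. nsq \<omega> (y i)) / \<epsilon>" using eps by (simp add: field_simps)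
  next
    fix \<omega> i assume w: "pos_fun \<omega>" and one: "\<omega> e = 1" and i: "i \<in> I"
    have "nsq \<omega> (y i * q) \<le> (\<Sum>j\<in>I. nsq \<omega> (y j * q))"
      by (rule member_le_sum[OF i _ I]) (auto intro!: nsq_nonneg w V_mult y qV)
    also have "\<dots> = Re (\<omega> (adj q * (A * q)))" by (simp add: conj pos_fun_sum[OF w] nsq_def)
    also have "\<dots> = (\<Sum>l\<in>L - L1. l * Re (\<omega> (P l)))"
      unfolding qAq by (simp add: pos_fun_sum[OF w] pos_funD(2)[OF w])
    also have "\<dots> \<le> (\<Sum>l\<in>L - L1. \<epsilon> * Re (\<omega> (P l)))"
      by (intro sum_mono mult_right_mono pos_fun_projection(1)[OF w] sD) (auto simp: L1_def)
    also have "\<dots> = \<epsilon> * Re (\<omega> q)" by (simp add: q_def pos_fun_sum[OF w] sum_distrib_left)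
    also have "\<dots> \<le> \<epsilon> * 1"
      using eps pos_fun_projection_le[OF w qV] one by (intro mult_left_mono) auto
    finally have yq: "nsq \<omega> (y i * q) \<le> \<epsilon>" by simp
    have ne: "nsq \<omega> e = 1" by (simp add: nsq_def unit_left V_unit one)
    have nq: "nsq \<omega> q \<le> 1" using pos_fun_projection_le[OF w qV] one by (simp add: nsq_projection qV)
    have qd: "q = adj e * (y i * q) + adj (adj (e - y i)) * q"
      by (simp add: star_star left_diff_distrib unit_left V_mult y[OF i] qV)
    have "Re (\<omega> q) = Re (\<omega> (adj e * (y i * q))) + Re (\<omega> (adj (adj (e - y i)) * q))"
      by (subst qd) (simp only: pos_funD(1)[OF w] plus_complex.sel)
    also have "\<dots> \<le> sqrt (nsq \<omega> e) * sqrt (nsq \<omega> (y i * q)) + sqrt (nsq \<omega> (adj (e - y i))) * sqrt (nsq \<omega> q)"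
      using cauchy_schwarz[OF w V_unit V_mult[OF y[OF i] qV(1)]]
        cauchy_schwarz[OF w V_star[OF V_diff[OF V_unit y[OF i]]] qV(1)] by linarith
    also have "\<dots> \<le> 1 * sqrt \<epsilon> + sqrt (nsq \<omega> (adj (e - y i))) * 1"
      using yq nq by (intro add_mono mult_mono)
        (auto simp: ne nsq_nonneg[OF w] qV V_star V_diff V_unit V_mult y[OF i])
    finally show "Re (\<omega> (e - p)) \<le> sqrt \<epsilon> + sqrt (nsq \<omega> (adj (e - y i)))" by (simp add: pq)
  qed
qed

text \<open>A maximal orthonormal set for the inner product \<open>\<tau> (adj x * y)\<close>; it
  exists because orthonormal sets are independent. A nonzero remainder \<open>z\<close> could be
  normalised and adjoined.\<close>

lemma orthonormal_basis:
  obtains B where "finite B" "B \<subseteq> V"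
    "\<And>b c. b \<in> B \<Longrightarrow> c \<in> B \<Longrightarrow> \<tau> (adj b * c) = (if b = c then 1 else 0)"
    "\<And>x. x \<in> V \<Longrightarrow> x = (\<Sum>b\<in>B. sc (\<tau> (adj b * x)) b)"
proof -
  obtain N where N: "\<forall>S. S \<subseteq> V \<longrightarrow> independent S \<longrightarrow> finite S \<and> card S \<le> N"
    by (rule exE[OF independent_bound])
  define on where "on B \<longleftrightarrow> finite B \<and> B \<subseteq> V \<and> (\<forall>b\<in>B. \<forall>c\<in>B. \<tau> (adj b * c) = (if b = c then 1 else 0))" for B
  have coeff: "\<tau> (adj b * (\<Sum>c\<in>B. sc (u c) c)) = u b" if "on B" "b \<in> B" for B b u
  proof -
    have "\<tau> (adj b * (\<Sum>c\<in>B. sc (u c) c)) = (\<Sum>c\<in>B. if c = b then u b else 0)"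
      unfolding sum_distrib_left pos_fun_sum[OF pos_fun_tau] using that
      by (intro sum.cong) (auto simp: sc_mult_right tau_sc on_def)
    then show ?thesis using that by (simp add: on_def)
  qed
  have indep: "independent B" if "on B" for B
  proof (rule ccontr)
    assume "\<not> independent B"
    moreover have "finite B" using that by (simp add: on_def)
    ultimately obtain u v where u: "(\<Sum>w\<in>B. sc (u w) w) = 0" "v \<in> B" "u v \<noteq> 0"
      by (auto simp: dependent_finite)
    then show False using coeff[OF that u(2), of u] by (simp add: pos_fun_zero[OF pos_fun_tau])
  qed
  have bound: "card B < Suc N" if "on B" for B
    using N indep[OF that] that unfolding on_def by (auto simp: less_Suc_eq_le)
  have "on {}" by (simp add: on_def)
  then obtain B where B: "on B" "\<And>C. on C \<Longrightarrow> card C \<le> card B"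
    using ex_has_greatest_nat[of on, of _ card "Suc N"] bound by blast
  show ?thesis
  proof (rule that)
    show "finite B" "B \<subseteq> V" using B(1) by (auto simp: on_def)
    show "\<tau> (adj b * c) = (if b = c then 1 else 0)" if "b \<in> B" "c \<in> B" for b c
      using B(1) that by (simp add: on_def)
    fix x assume x: "x \<in> V"
    define z where "z = x - (\<Sum>b\<in>B. sc (\<tau> (adj b * x)) b)"
    have zV: "z \<in> V" unfolding z_def using \<open>B \<subseteq> V\<close> by (intro V_diff V_sum V_sc x) auto
    have bz: "\<tau> (adj b * z) = 0" if "b \<in> B" for b
      using coeff[OF B(1) that, of "\<lambda>b. \<tau> (adj b * x)"]
      by (simp add: z_def right_diff_distrib pos_fun_diff[OF pos_fun_tau])
    have zb: "\<tau> (adj z * b) = 0" if "b \<in> B" for b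
    proof -
      have "\<tau> (adj (adj b * z)) = cnj (\<tau> (adj b * z))"
        using that \<open>B \<subseteq> V\<close> by (intro pos_fun_star pos_fun_tau V_mult V_star zV) auto
      then show ?thesis by (simp add: star_mult star_star bz[OF that])
    qed
    have "z = 0"
    proof (rule ccontr)
      assume "z \<noteq> 0"
      define r where "r = nsq \<tau> z"
      have r: "\<tau> (adj z * z) = of_real r" unfolding r_def by (rule pos_fun_nsq[OF pos_fun_tau zV])
      have "r > 0" using nsq_nonneg[OF pos_fun_tau zV] tau_faithful[OF zV] \<open>z \<noteq> 0\<close> r
        by (auto simp: r_def order_le_less)
      define w where "w = sc (of_real (1 / sqrt r)) z"
      have ww: "\<tau> (adj w * w) = 1"
      proof -
        have "\<tau> (adj w * w) = of_real (1 / sqrt r * (1 / sqrt r) * r)"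
          by (simp only: w_def star_sc sc_mult_left sc_mult_right tau_sc r complex_cnj_complex_of_real
            of_real_mult mult.assoc)
        also have "1 / sqrt r * (1 / sqrt r) * r = 1" using \<open>r > 0\<close> by simp
        finally show ?thesis by simp
      qed
      have bw: "\<tau> (adj b * w) = 0" "\<tau> (adj w * b) = 0" if "b \<in> B" for b
        using bz[OF that] zb[OF that] by (simp_all add: w_def star_sc sc_mult_left sc_mult_right tau_sc)
      have "w \<notin> B" using bw ww by force
      have "on (insert w B)" using B(1) bw ww V_sc[OF zV] \<open>w \<notin> B\<close>
        by (auto simp: on_def w_def[symmetric]) (auto simp: w_def)
      then show False using B(2)[of "insert w B"] \<open>w \<notin> B\<close> B(1) by (simp add: on_def)
    qed
    then show "x = (\<Sum>b\<in>B. sc (\<tau> (adj b * x)) b)" by (simp add: z_def)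
  qed
qed

end

section \<open>States on a finite-dimensional C*-algebra\<close>

interpretation base: proper_star_alg "scaleC :: complex \<Rightarrow> 'a::fd_cstar_algebra \<Rightarrow> 'a" UNIV 1
proof (intro proper_star_alg.intro star_alg.intro vector_space_scaleC star_alg_axioms.intro
    proper_star_alg_axioms.intro)
  interpret vs: vector_space "scaleC :: complex \<Rightarrow> 'a \<Rightarrow> 'a" by (rule vector_space_scaleC)
  show "vs.subspace UNIV" by simp
  obtain B :: "'a set" where B: "finite B" "\<And>x. \<exists>c. x = (\<Sum>b\<in>B. c b *\<^sub>C b)"
    using finite_dimensional by blast
  have "x \<in> vs.span B" for x
  proof -
    obtain c where c: "x = (\<Sum>b\<in>B. c b *\<^sub>C b)" using B(2) by blast
    show ?thesis unfolding c by (intro vs.span_sum vs.span_scale vs.span_base)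
  qed
  with B(1) show "\<exists>B. finite B \<and> (UNIV :: 'a set) \<subseteq> vs.span B" by blast
  fix x :: 'a assume "adj x * x = 0"
  then show "x = 0" using cstar_identity[of x] by simp
qed (simp_all add: mult_scaleC_left mult_scaleC_right adj_adj adj_add adj_scaleC adj_mult)

lemma minimal_projection_iff: "minimal_projection p \<longleftrightarrow> base.minimal p"
  by (simp add: minimal_projection_def base.minimal_def proj_le_def)

lemma canonical_trace_eq: "canonical_trace = base.tr"
  unfolding canonical_trace_def
proof (rule the_equality)
  show "clinear base.tr \<and> (\<forall>a b. base.tr (a * b) = base.tr (b * a)) \<and>
      (\<forall>p. minimal_projection p \<longrightarrow> base.tr p = 1)"
    by (simp add: clinear_iff base.tr_add base.tr_sc base.tr_commute base.tr_minimal minimal_projection_iff)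
next
  fix t :: "'a \<Rightarrow> complex"
  assume t: "clinear t \<and> (\<forall>a b. t (a * b) = t (b * a)) \<and> (\<forall>p. minimal_projection p \<longrightarrow> t p = 1)"
  show "t = base.tr"
  proof
    fix x
    show "t x = base.tr x"
      by (rule base.tr_unique) (use t in \<open>auto simp: clinear_iff minimal_projection_iff\<close>)
  qed
qed

interpretation A: tracial_star_alg "scaleC :: complex \<Rightarrow> 'a::fd_cstar_algebra \<Rightarrow> 'a" UNIV 1 canonical_trace
proof (intro tracial_star_alg.intro base.star_alg_axioms tracial_star_alg_axioms.intro)
  fix x :: 'a
  assume "canonical_trace (adj x * x) = 0"
  then show "x = 0" unfolding canonical_trace_eq by (intro base.tr_faithful) auto
next
  show "canonical_trace (adj x * x) \<in> nonneg_Reals" for x :: 'a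
    unfolding canonical_trace_eq by (rule base.tr_pos) simp
next
  show "canonical_trace (x * y) = canonical_trace (y * x)" for x y :: 'a
    unfolding canonical_trace_eq by (rule base.tr_commute) simp_all
qed (simp_all add: canonical_trace_eq base.tr_add base.tr_sc)

lemma clinear_canonical_trace: "clinear canonical_trace"
  by (simp add: clinear_iff A.tau_add A.tau_sc)

lemma states_pos_fun: "\<psi> \<in> states \<Longrightarrow> base.pos_fun \<psi>"
  by (simp add: states_def base.pos_fun_def clinear_iff)

lemma states_clinear: "\<psi> \<in> states \<Longrightarrow> clinear \<psi>"
  and states_one: "\<psi> \<in> states \<Longrightarrow> \<psi> 1 = 1"
  by (simp_all add: states_def)

lemma density_unique:
  assumes "\<And>a. canonical_trace (d * a) = canonical_trace (d' * a)"
  shows "d = d'"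
proof -
  have "canonical_trace ((d - d') * adj (d - d')) = 0"
    by (simp add: left_diff_distrib base.pos_fun_diff[OF A.pos_fun_tau] assms)
  then have "canonical_trace (adj (adj (d - d')) * adj (d - d')) = 0" by (simp add: base.star_star)
  then have "adj (d - d') = 0" by (rule A.tau_faithful[rotated]) simp
  then have "adj (adj (d - d')) = 0" by simp
  then show ?thesis by (simp add: base.star_star)
qed

text \<open>One fixed choice, used for the expansion of densities, for the product bases and for the
  coordinates of the net of states.\<close>

definition onb :: "'a::fd_cstar_algebra set" where
  "onb = (SOME B. finite B \<and>
    (\<forall>b\<in>B. \<forall>c\<in>B. canonical_trace (adj b * c) = (if b = c then 1 else 0)) \<and>
    (\<forall>x. x = (\<Sum>b\<in>B. canonical_trace (adj b * x) *\<^sub>C b)))"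

lemma onb:
  fixes b c x :: "'a::fd_cstar_algebra"
  shows "finite (onb :: 'a set)"
    "b \<in> onb \<Longrightarrow> c \<in> onb \<Longrightarrow> canonical_trace (adj b * c) = (if b = c then 1 else 0)"
    "x = (\<Sum>b\<in>onb. canonical_trace (adj b * x) *\<^sub>C b)"
proof -
  have "\<exists>B :: 'a set. finite B \<and>
    (\<forall>b\<in>B. \<forall>c\<in>B. canonical_trace (adj b * c) = (if b = c then 1 else 0)) \<and>
    (\<forall>x. x = (\<Sum>b\<in>B. canonical_trace (adj b * x) *\<^sub>C b))"
  proof (rule A.orthonormal_basis)
    fix B :: "'a set"
    assume B: "finite B" "\<And>b c. b \<in> B \<Longrightarrow> c \<in> B \<Longrightarrow> canonical_trace (adj b * c) = (if b = c then 1 else 0)"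
      "\<And>x. x \<in> UNIV \<Longrightarrow> x = (\<Sum>b\<in>B. canonical_trace (adj b * x) *\<^sub>C b)"
    show ?thesis
      by (intro exI[of _ B] conjI ballI allI B UNIV_I)
  qed
  note * = someI_ex[OF this, folded onb_def]
  show "finite (onb :: 'a set)" by (rule conjunct1[OF *])
  show "canonical_trace (adj b * c) = (if b = c then 1 else 0)" if "b \<in> onb" "c \<in> onb"
    by (rule conjunct1[OF conjunct2[OF *], rule_format, OF that])
  show "x = (\<Sum>b\<in>onb. canonical_trace (adj b * x) *\<^sub>C b)"
    by (rule spec[OF conjunct2[OF conjunct2[OF *]]])
qed

lemma clinear_sum:
  assumes "clinear \<psi>"
  shows "\<psi> (sum f I) = (\<Sum>i\<in>I. \<psi> (f i))"
proof -
  have "\<psi> (0 *\<^sub>C 0) = 0 * \<psi> 0" using assms unfolding clinear_iff by blast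
  then have "\<psi> 0 = 0" by (simp add: module.scale_zero_left[OF module_iff_vector_space[THEN iffD2, OF vector_space_scaleC]])
  then show ?thesis
    using assms by (induction I rule: infinite_finite_induct) (auto simp: clinear_iff)
qed

text \<open>Riesz representation for the trace inner product. The explicit formula later turns a
  difference of densities into finitely many scalar differences.\<close>

lemma density_expansion: "clinear \<psi> \<Longrightarrow> density \<psi> = (\<Sum>b\<in>onb. \<psi> b *\<^sub>C adj b)"
  and density: "clinear \<psi> \<Longrightarrow> \<psi> a = canonical_trace (density \<psi> * a)"
proof -
  assume lin: "clinear \<psi>"
  define d where "d = (\<Sum>b\<in>onb. \<psi> b *\<^sub>C adj b)"
  have d: "\<psi> a = canonical_trace (d * a)" for a
  proof -
    have "\<psi> a = (\<Sum>b\<in>onb. \<psi> (canonical_trace (adj b * a) *\<^sub>C b))"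
      by (subst onb(3)[of a]) (rule clinear_sum[OF lin])
    also have "\<dots> = canonical_trace (d * a)"
      using lin
      by (simp add: d_def sum_distrib_right base.pos_fun_sum[OF A.pos_fun_tau] mult_scaleC_left A.tau_sc
          clinear_iff mult.commute)
    finally show ?thesis .
  qed
  have eq: "density \<psi> = d"
    unfolding density_def by (rule the_equality) (use d density_unique in metis)+
  then show "density \<psi> = (\<Sum>b\<in>onb. \<psi> b *\<^sub>C adj b)" by (simp add: d_def)
  show "\<psi> a = canonical_trace (density \<psi> * a)" using d eq by simp
qed

section \<open>Spectral data of the density of a state\<close>

lemma density_selfadjoint:
  assumes "\<psi> \<in> states"
  shows "adj (density \<psi>) = density \<psi>"
proof (rule density_unique)
  fix a
  let ?D = "density \<psi>"
  have "canonical_trace (adj ?D * a) = canonical_trace (adj (adj a * ?D))"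
    by (simp add: base.star_mult base.star_star)
  also have "\<dots> = cnj (canonical_trace (?D * adj a))"
    by (subst base.pos_fun_star[OF A.pos_fun_tau]) (simp_all add: A.tau_commute)
  also have "\<dots> = cnj (\<psi> (adj a))" using density[OF states_clinear[OF assms]] by simp
  also have "\<dots> = \<psi> a" by (simp add: base.pos_fun_star[OF states_pos_fun[OF assms]])
  also have "\<dots> = canonical_trace (?D * a)" by (rule density[OF states_clinear[OF assms]])
  finally show "canonical_trace (adj ?D * a) = canonical_trace (?D * a)" .
qed

text \<open>Vanishing projections are excluded so that each \<open>P l\<close> has trace at least 1;
  the weight of \<open>P l\<close> then forces \<open>0 \<le> l\<close> and
  \<open>l \<le> 1\<close>.\<close>

definition eigen_resolution :: "('a::fd_cstar_algebra \<Rightarrow> complex) \<Rightarrow> real set \<Rightarrow> (real \<Rightarrow> 'a) \<Rightarrow> bool" where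
  "eigen_resolution \<psi> L P \<longleftrightarrow> base.spectral (density \<psi>) L P \<and> (\<forall>l\<in>L. P l \<noteq> 0)"

lemma eigen_resolution_exists:
  assumes "\<psi> \<in> states"
  obtains L P where "eigen_resolution \<psi> L P"
proof -
  obtain L P where s: "base.spectral (density \<psi>) L P"
    using base.spectral_theorem[OF UNIV_I density_selfadjoint[OF assms]] .
  note sD = base.spectralD[OF s]
  have red: "(\<Sum>l\<in>{l\<in>L. P l \<noteq> 0}. f l) = sum f L" if "\<And>l. P l = 0 \<Longrightarrow> f l = 0" for f :: "real \<Rightarrow> 'a"
    using sD(1) that by (intro sum.mono_neutral_left) auto
  have "base.spectral (density \<psi>) {l\<in>L. P l \<noteq> 0} P"
    unfolding base.spectral_def
  proof (intro conjI ballI impI)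
    show "(\<Sum>l\<in>{l\<in>L. P l \<noteq> 0}. P l) = 1" using red[of P] sD(5) by simp
    show "density \<psi> = (\<Sum>l\<in>{l\<in>L. P l \<noteq> 0}. complex_of_real l *\<^sub>C P l)"
      using red[of "\<lambda>l. complex_of_real l *\<^sub>C P l"] sD(6) by (metis base.scale_zero_right)
  qed (use sD in auto)
  then show ?thesis using that[of "{l\<in>L. P l \<noteq> 0}" P] by (simp add: eigen_resolution_def)
qed

context
  fixes \<psi> :: "'a::fd_cstar_algebra \<Rightarrow> complex" and L P
  assumes st: "\<psi> \<in> states" and er: "eigen_resolution \<psi> L P"
begin

lemma er_spectral: "base.spectral (density \<psi>) L P"
  using er by (simp add: eigen_resolution_def)

lemmas er_finite = base.spectralD(1)[OF er_spectral]
  and er_projection = base.spectralD(3)[OF er_spectral]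
  and er_orthogonal = base.spectralD(4)[OF er_spectral]
  and er_sum = base.spectralD(5)[OF er_spectral]
  and er_density = base.spectralD(6)[OF er_spectral]
  and er_eigen = base.spectral_eigen[OF er_spectral]

lemma er_trace_ge_1: "l \<in> L \<Longrightarrow> Re (canonical_trace (P l)) \<ge> 1"
  unfolding canonical_trace_eq
  by (rule base.tr_projection_ge_1) (use er er_projection in \<open>auto simp: eigen_resolution_def\<close>)

lemma er_trace_real: "l \<in> L \<Longrightarrow> canonical_trace (P l) = of_real (Re (canonical_trace (P l)))"
  using base.pos_fun_projection(2)[OF A.pos_fun_tau UNIV_I er_projection] by (simp add: complex_eq_iff)

lemma er_weight: "l \<in> L \<Longrightarrow> \<psi> (P l) = of_real (l * Re (canonical_trace (P l)))"
  using density[OF states_clinear[OF st], of "P l"] er_trace_real[of l]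
  by (simp add: er_eigen A.tau_sc)

lemma er_weight_Re: "l \<in> L \<Longrightarrow> Re (\<psi> (P l)) = l * Re (canonical_trace (P l))"
  by (simp add: er_weight)

lemma er_nonneg: "l \<in> L \<Longrightarrow> l \<ge> 0"
  using base.pos_fun_projection(1)[OF states_pos_fun[OF st] UNIV_I er_projection, of l] er_trace_ge_1[of l]
  by (simp add: er_weight_Re zero_le_mult_iff)

lemma er_le_1:
  assumes "l \<in> L"
  shows "l \<le> 1"
proof -
  have "l * 1 \<le> l * Re (canonical_trace (P l))"
    by (rule mult_left_mono[OF er_trace_ge_1[OF assms] er_nonneg[OF assms]])
  also have "\<dots> \<le> 1"
    using base.pos_fun_projection_le[OF states_pos_fun[OF st] UNIV_I er_projection[OF assms]]
    by (simp add: er_weight_Re assms states_one[OF st])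
  finally show ?thesis by simp
qed

lemma er_sum_weights: "(\<Sum>l\<in>{l\<in>L. l > 0}. Re (\<psi> (P l))) = 1"
proof -
  have "(\<Sum>l\<in>{l\<in>L. l > 0}. Re (\<psi> (P l))) = (\<Sum>l\<in>L. Re (\<psi> (P l)))"
    using er_nonneg er_finite by (intro sum.mono_neutral_left) (auto simp: er_weight_Re order_le_less)
  also have "\<dots> = Re (\<psi> (\<Sum>l\<in>L. P l))"
    by (simp add: base.pos_fun_sum[OF states_pos_fun[OF st]])
  finally show ?thesis by (simp add: er_sum states_one[OF st])
qed

text \<open>If \<psi> takes the value 1 at \<open>q\<close>, then 0 is the sum of the nonnegative
  terms \<open>l\<close> times the trace of \<open>P l * (1 - q)\<close>; so \<open>1 - q\<close>
  annihilates \<open>P l\<close> for each \<open>l > 0\<close>.\<close>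

lemma er_support: "supp_proj \<psi> = (\<Sum>l\<in>{l\<in>L. l > 0}. P l)"
  and er_support_least: "is_projection q \<Longrightarrow> \<psi> q = 1 \<Longrightarrow> proj_le (supp_proj \<psi>) q"
proof -
  let ?s = "\<Sum>l\<in>{l\<in>L. l > 0}. P l"
  define s where "s = ?s"
  note w = states_pos_fun[OF st]
  have proj: "is_projection s"
    unfolding s_def using er_finite
    by (intro base.sum_projections) (auto simp: er_projection er_orthogonal)
  have one: "\<psi> s = 1"
    unfolding s_def base.pos_fun_sum[OF w] using arg_cong[OF er_sum_weights, of complex_of_real]
    by (simp add: er_weight er_weight_Re)
  have least: "proj_le s q" if q: "is_projection q" "\<psi> q = 1" for q
  proof -
    have q': "is_projection (1 - q)" using base.is_projection_compl[OF UNIV_I q(1)] .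
    have cq: "adj (1 - q) = 1 - q" "(1 - q) * (1 - q) = 1 - q" using q' by (auto simp: is_projection_def)
    have nn: "Re (canonical_trace (P l * (1 - q))) \<ge> 0" if "l \<in> L" for l
      using A.tau_projection_mult[OF UNIV_I er_projection[OF that], of "1 - q"] by (simp add: cq)
    have "0 = \<psi> (1 - q)" by (simp add: base.pos_fun_diff[OF w] q states_one[OF st])
    also have "\<dots> = canonical_trace (density \<psi> * (1 - q))" by (rule density[OF states_clinear[OF st]])
    also have "\<dots> = (\<Sum>l\<in>L. of_real l * canonical_trace (P l * (1 - q)))"
      by (subst er_density) (simp add: sum_distrib_right base.pos_fun_sum[OF A.pos_fun_tau] mult_scaleC_left A.tau_sc)
    finally have "(\<Sum>l\<in>L. l * Re (canonical_trace (P l * (1 - q)))) = 0"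
      by (simp add: complex_eq_iff)
    then have z: "\<forall>l\<in>L. l * Re (canonical_trace (P l * (1 - q))) = 0"
      using er_nonneg nn by (subst (asm) sum_nonneg_eq_0_iff[OF er_finite]) auto
    have "q * P l = P l" if l: "l \<in> L" "l > 0" for l
    proof -
      have pl: "adj (P l) = P l" "P l * P l = P l" using er_projection[OF l(1)] by (auto simp: is_projection_def)
      have "adj ((1 - q) * P l) * ((1 - q) * P l) = P l * ((1 - q) * (1 - q)) * P l"
        by (simp only: base.star_mult cq(1) pl mult.assoc)
      then have "canonical_trace (adj ((1 - q) * P l) * ((1 - q) * P l)) = canonical_trace (P l * (P l * (1 - q)))"
        by (simp add: cq(2) A.tau_commute[of "P l * (1 - q)" "P l"])
      also have "\<dots> = canonical_trace (P l * (1 - q))" by (simp add: pl flip: mult.assoc)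
      finally have eq: "canonical_trace (adj ((1 - q) * P l) * ((1 - q) * P l)) = canonical_trace (P l * (1 - q))" .
      have "Re (canonical_trace (P l * (1 - q))) = 0" using z l by auto
      then have "canonical_trace (adj ((1 - q) * P l) * ((1 - q) * P l)) = 0"
        using A.tau_pos[OF UNIV_I, of "(1 - q) * P l"] eq by (simp add: complex_eq_iff complex_nonneg_Reals_iff)
      then have "(1 - q) * P l = 0" by (rule A.tau_faithful[OF UNIV_I])
      then show ?thesis by (simp add: left_diff_distrib)
    qed
    then show ?thesis by (simp add: proj_le_def s_def sum_distrib_left)
  qed
  show eq: "supp_proj \<psi> = ?s"
    unfolding supp_proj_def s_def[symmetric]
  proof (rule the_equality)
    show "is_projection s \<and> \<psi> s = 1 \<and> (\<forall>q. is_projection q \<and> \<psi> q = 1 \<longrightarrow> proj_le s q)"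
      using proj one least by blast
    fix p assume p: "is_projection p \<and> \<psi> p = 1 \<and> (\<forall>q. is_projection q \<and> \<psi> q = 1 \<longrightarrow> proj_le p q)"
    then have "p * s = s" "s * p = p" using proj one least by (auto simp: proj_le_def)
    then show "p = s"
    proof -
      have "adj s * adj p = adj s" by (simp only: base.star_mult[symmetric] \<open>p * s = s\<close>)
      then show ?thesis
        using p \<open>s * p = p\<close> by (simp add: base.is_projection_star proj)
    qed
  qed
  show "is_projection q \<Longrightarrow> \<psi> q = 1 \<Longrightarrow> proj_le (supp_proj \<psi>) q"
    unfolding eq s_def[symmetric] by (rule least)
qed

text \<open>The value does not depend on the decomposition: evaluating
  \<open>P l * density \<psi> * Q m\<close> from both sides shows that \<open>P l * Q m\<close>
  vanishes unless \<open>l = m\<close>.\<close>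

lemma er_functional_calculus: "functional_calculus f (density \<psi>) = (\<Sum>l\<in>L. f l *\<^sub>R P l)"
proof -
  have spec: "spectral_decomposition a M Q \<longleftrightarrow> base.spectral a M Q" for a M and Q :: "real \<Rightarrow> 'a"
    by (auto simp: spectral_decomposition_def base.spectral_def scaleR_scaleC)
  have uniq: "(\<Sum>m\<in>M. f m *\<^sub>R Q m) = (\<Sum>l\<in>L. f l *\<^sub>R P l)" if s: "base.spectral (density \<psi>) M Q" for M Q
  proof -
    note sD = base.spectralD[OF s]
    have PQ: "f l *\<^sub>R (P l * Q m) = f m *\<^sub>R (P l * Q m)" if lm: "l \<in> L" "m \<in> M" for l m
    proof (cases "l = m")
      case False
      have "complex_of_real l *\<^sub>C (P l * Q m) = P l * density \<psi> * Q m"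
        by (simp add: er_eigen lm mult_scaleC_left)
      also have "\<dots> = complex_of_real m *\<^sub>C (P l * Q m)"
        by (simp add: base.spectral_eigen[OF s] lm mult_scaleC_right mult.assoc)
      finally have "P l * Q m = 0" using False by simp
      then show ?thesis by simp
    qed simp
    have "(\<Sum>l\<in>L. f l *\<^sub>R P l) = (\<Sum>l\<in>L. f l *\<^sub>R P l) * (\<Sum>m\<in>M. Q m)" by (simp add: sD(5))
    also have "\<dots> = (\<Sum>l\<in>L. \<Sum>m\<in>M. f m *\<^sub>R (P l * Q m))"
      unfolding sum_product by (intro sum.cong refl) (simp only: mult_scaleR_left, rule PQ)
    also have "\<dots> = (\<Sum>l\<in>L. P l) * (\<Sum>m\<in>M. f m *\<^sub>R Q m)"
      unfolding sum_product by (intro sum.cong refl) simp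
    finally show ?thesis by (simp add: er_sum)
  qed
  show ?thesis
    unfolding functional_calculus_def
  proof (rule the_equality)
    show "\<exists>L' P'. spectral_decomposition (density \<psi>) L' P' \<and> (\<Sum>l\<in>L. f l *\<^sub>R P l) = (\<Sum>l\<in>L'. f l *\<^sub>R P' l)"
      using er_spectral by (auto simp: spec)
  qed (use uniq in \<open>auto simp: spec\<close>)
qed

lemma er_log_op:
  assumes w: "base.pos_fun \<omega>"
  shows "Re (\<omega> (log_op (density \<psi>))) = (\<Sum>l\<in>{l\<in>L. l > 0}. Re (\<omega> (P l)) * log 2 l)"
proof -
  have "Re (\<omega> (log_op (density \<psi>))) = (\<Sum>l\<in>L. Re (\<omega> (P l)) * (if l = 0 then 0 else log 2 l))"
    unfolding log_op_def er_functional_calculus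
    by (simp add: base.pos_fun_sum[OF w] scaleR_scaleC base.pos_funD(2)[OF w] mult.commute)
  also have "\<dots> = (\<Sum>l\<in>{l\<in>L. l > 0}. Re (\<omega> (P l)) * (if l = 0 then 0 else log 2 l))"
    using er_nonneg er_finite by (intro sum.mono_neutral_right) (auto simp: order_le_less)
  also have "\<dots> = (\<Sum>l\<in>{l\<in>L. l > 0}. Re (\<omega> (P l)) * log 2 l)" by (intro sum.cong) auto
  finally show ?thesis .
qed

end

lemma support_projection: "\<psi> \<in> states \<Longrightarrow> is_projection (supp_proj \<psi>)"
  and support_one: "\<psi> \<in> states \<Longrightarrow> \<psi> (supp_proj \<psi>) = 1"
proof -
  assume st: "\<psi> \<in> states"
  then obtain L P where er: "eigen_resolution \<psi> L P" by (rule eigen_resolution_exists)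
  show "is_projection (supp_proj \<psi>)"
    unfolding er_support[OF st er] using er_finite[OF st er]
    by (intro base.sum_projections) (auto simp: er_projection[OF st er] er_orthogonal[OF st er])
  show "\<psi> (supp_proj \<psi>) = 1"
    unfolding er_support[OF st er] base.pos_fun_sum[OF states_pos_fun[OF st]]
    using arg_cong[OF er_sum_weights[OF st er], of complex_of_real]
    by (simp add: er_weight[OF st er] er_weight_Re[OF st er])
qed

text \<open>Replaces the order of projections by a single value of \<psi>, which is easy to follow
  through tensor powers.\<close>

lemma support_le_iff:
  assumes \<psi>: "\<psi> \<in> states" and q: "is_projection q"
  shows "proj_le (supp_proj \<psi>) q \<longleftrightarrow> \<psi> q = 1"
proof -
  obtain L P where er: "eigen_resolution \<psi> L P" using \<psi> by (rule eigen_resolution_exists)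
  note w = states_pos_fun[OF \<psi>]
  let ?s = "supp_proj \<psi>"
  have s: "is_projection ?s" "\<psi> ?s = 1" using support_projection support_one \<psi> by auto
  show ?thesis
  proof
    assume "proj_le ?s q"
    then have qs: "q * ?s = ?s" by (simp add: proj_le_def)
    then have sq: "?s * q = ?s"
    proof -
      have "adj ?s * adj q = adj ?s" by (simp only: base.star_mult[symmetric] qs)
      then show ?thesis by (simp only: base.is_projection_star[OF s(1)] base.is_projection_star[OF q])
    qed
    have "adj (q - ?s) * (q - ?s) = q - ?s"
      using q s(1) by (simp add: is_projection_def base.star_diff left_diff_distrib right_diff_distrib qs sq)
    then have "\<psi> (q - ?s) \<in> nonneg_Reals" using base.pos_funD(3)[OF w UNIV_I, of "q - ?s"] by simp
    moreover have "Re (\<psi> q) \<le> 1"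
      using base.pos_fun_projection_le[OF w UNIV_I q] by (simp add: states_one[OF \<psi>])
    ultimately show "\<psi> q = 1"
      by (simp add: base.pos_fun_diff[OF w] s complex_nonneg_Reals_iff complex_eq_iff)
  next
    assume "\<psi> q = 1"
    then show "proj_le ?s q" by (rule er_support_least[OF \<psi> er q])
  qed
qed

lemma relative_entropy_eq:
  assumes \<psi>: "\<psi> \<in> states" and \<phi>: "\<phi> \<in> states"
    and er: "eigen_resolution \<psi> L P" and er': "eigen_resolution \<phi> M Q"
  shows "relative_entropy \<psi> \<phi> = (if \<psi> (supp_proj \<phi>) = 1
    then ereal ((\<Sum>l\<in>{l\<in>L. l > 0}. Re (\<psi> (P l)) * log 2 l) - (\<Sum>m\<in>{m\<in>M. m > 0}. Re (\<psi> (Q m)) * log 2 m))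
    else \<infinity>)"
  unfolding relative_entropy_def
  by (simp add: support_le_iff[OF \<psi> support_projection[OF \<phi>]] base.pos_fun_diff[OF states_pos_fun[OF \<psi>]]
      er_log_op[OF \<psi> er states_pos_fun[OF \<psi>]] er_log_op[OF \<phi> er' states_pos_fun[OF \<psi>]]
      flip: density[OF states_clinear[OF \<psi>]])

section \<open>The tensor powers\<close>

interpretation tv: vector_space "scale_tensor :: complex \<Rightarrow> 'a::cstar_algebra tensor \<Rightarrow> 'a tensor"
proof
  fix a b :: complex and x y :: "'a tensor"
  show "scale_tensor a (x + y) = scale_tensor a x + scale_tensor a y"
    by transfer (simp add: fscale_add mr_zero)
  have "fscale (a + b) f = fscale a f + fscale b f" for f :: "'a list \<Rightarrow>\<^sub>0 complex"
    by (rule poly_mapping_eqI) (simp add: lookup_add distrib_right)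
  then show "scale_tensor (a + b) x = scale_tensor a x + scale_tensor b x"
    by transfer (simp add: mr_zero)
  have "fscale a (fscale b f) = fscale (a * b) f" for f :: "'a list \<Rightarrow>\<^sub>0 complex"
    by (rule poly_mapping_eqI) simp
  then show "scale_tensor a (scale_tensor b x) = scale_tensor (a * b) x"
    by transfer (simp add: mr_zero)
  have "fscale 1 f = f" for f :: "'a list \<Rightarrow>\<^sub>0 complex"
    by (rule poly_mapping_eqI) simp
  then show "scale_tensor 1 x = x" by transfer (simp add: mr_zero)
qed

lemma scale_tensor_mult_left: "scale_tensor c x * y = scale_tensor c (x * y)"
  by transfer (simp add: fmult_scale_left mr_zero)

lemma scale_tensor_mult_right: "x * scale_tensor c y = scale_tensor c (x * y)"
  by transfer (simp add: fmult_scale_right mr_zero)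

lemma adj_tensor_add: "adj (x + y) = adj x + adj (y :: 'a::cstar_algebra tensor)"
  by transfer (simp add: fadj_add mr_zero)

lemma adj_scale_tensor: "adj (scale_tensor c x) = scale_tensor (cnj c) (adj x)"
  by transfer (simp add: fadj_fscale mr_zero)

lemma adj_adj_tensor: "adj (adj x) = (x :: 'a::cstar_algebra tensor)"
proof transfer
  fix f :: "'a list \<Rightarrow>\<^sub>0 complex"
  have "fadj (fadj f) = f"
    by (induction f rule: poly_mapping_single_induct)
       (simp_all add: fadj_single fadj_add comp_def adj_adj)
  then show "fadj (fadj f) - f \<in> multilinear_relations" by (simp add: mr_zero)
qed

lemma adj_tensor_mult: "adj (x * y) = adj y * adj (x :: 'a::cstar_algebra tensor)"
proof transfer
  fix f g :: "'a list \<Rightarrow>\<^sub>0 complex"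
  have "fadj (fmult f g) = fmult (fadj g) (fadj f)"
  proof (induction f rule: poly_mapping_single_induct)
    case (single xs c)
    show ?case
    proof (induction g rule: poly_mapping_single_induct)
      case (single ys d)
      have "map adj (map2 (*) xs ys) = map2 (*) (map adj ys) (map adj xs)" if "length xs = length ys"
        using that by (induction xs ys rule: list_induct2) (auto simp: adj_mult)
      then show ?case by (auto simp: fmult_single fadj_single mult.commute)
    qed (simp add: fmult_add_left fmult_add_right fadj_add)
  qed (simp add: fmult_add_left fmult_add_right fadj_add)
  then show "fadj (fmult f g) - fmult (fadj g) (fadj f) \<in> multilinear_relations" by (simp add: mr_zero)
qed

lemma tensor_power_subspace: "tv.subspace (tensor_power n :: 'a::cstar_algebra tensor set)"
proof (rule tv.subspaceI)
  show "0 \<in> tensor_power n"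
    unfolding tensor_power_def by (auto intro!: exI[of _ 0] simp: zero_tensor.abs_eq)
  fix x y :: "'a tensor" assume "x \<in> tensor_power n" "y \<in> tensor_power n"
  then obtain f g where fg: "x = abs_tensor f" "y = abs_tensor g"
    "\<forall>xs\<in>Poly_Mapping.keys f. length xs = n" "\<forall>xs\<in>Poly_Mapping.keys g. length xs = n"
    by (auto simp: tensor_power_def)
  then have "x + y = abs_tensor (f + g)" "\<forall>xs\<in>Poly_Mapping.keys (f + g). length xs = n"
    using Poly_Mapping.keys_add[of f g] by (auto simp: plus_tensor.abs_eq)
  then show "x + y \<in> tensor_power n" unfolding tensor_power_def by blast
next
  fix c and x :: "'a tensor" assume "x \<in> tensor_power n"
  then obtain f where f: "x = abs_tensor f" "\<forall>xs\<in>Poly_Mapping.keys f. length xs = n"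
    by (auto simp: tensor_power_def)
  then have "scale_tensor c x = abs_tensor (fscale c f)" "\<forall>xs\<in>Poly_Mapping.keys (fscale c f). length xs = n"
    by (auto simp: scale_tensor.abs_eq in_keys_iff)
  then show "scale_tensor c x \<in> tensor_power n" unfolding tensor_power_def by blast
qed

lemma tensor_power_eq_span:
  "tensor_power n = tv.span (pure_tensor ` {xs :: 'a::cstar_algebra list. length xs = n})"
proof
  show "tv.span (pure_tensor ` {xs :: 'a list. length xs = n}) \<subseteq> tensor_power n"
    by (rule tv.span_minimal) (auto simp: pure_tensor_in_tensor_power tensor_power_subspace)
  have "abs_tensor f \<in> tv.span (pure_tensor ` {xs :: 'a list. length xs = n})"
    if "\<forall>xs\<in>Poly_Mapping.keys f. length xs = n" for f
    using that
  proof (induction f rule: Poly_Mapping.update_induct)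
    case const
    then show ?case by (simp add: tv.span_zero flip: zero_tensor.abs_eq)
  next
    case (update f a b)
    have eq: "Poly_Mapping.update a b f = f + Poly_Mapping.single a b"
      using update(1) by (intro poly_mapping_eqI)
        (auto simp: lookup_update lookup_add lookup_single when_def in_keys_iff)
    have keys: "a \<in> Poly_Mapping.keys (Poly_Mapping.update a b f)"
      "Poly_Mapping.keys f \<subseteq> Poly_Mapping.keys (Poly_Mapping.update a b f)"
      using update(1,2) by (auto simp: in_keys_iff lookup_update)
    have "abs_tensor (Poly_Mapping.single a b) = scale_tensor b (pure_tensor a)"
      by (simp add: pure_tensor_def scale_tensor.abs_eq fscale_single)
    moreover have "length a = n" using update.prems keys(1) by blast
    ultimately have "abs_tensor (Poly_Mapping.single a b) \<in> tv.span (pure_tensor ` {xs :: 'a list. length xs = n})"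
      by (auto intro: tv.span_scale[OF tv.span_base])
    moreover have "abs_tensor f \<in> tv.span (pure_tensor ` {xs :: 'a list. length xs = n})"
      using update.IH update.prems keys(2) by blast
    ultimately show ?case by (simp add: eq tv.span_add flip: plus_tensor.abs_eq)
  qed
  then show "tensor_power n \<subseteq> tv.span (pure_tensor ` {xs :: 'a list. length xs = n})"
    by (auto simp: tensor_power_def)
qed

lemma tensor_power_induct [consumes 1, case_names zero pure]:
  assumes "t \<in> tensor_power n" "P 0"
    "\<And>c xs t. length xs = n \<Longrightarrow> P t \<Longrightarrow> P (scale_tensor c (pure_tensor xs) + t)"
  shows "P t"
  using assms(1) unfolding tensor_power_eq_span
  by (induction rule: tv.span_induct_alt) (use assms in auto)

lemma tensor_power_scale_add:
  "length xs = n \<Longrightarrow> t \<in> tensor_power n \<Longrightarrow> scale_tensor c (pure_tensor xs) + t \<in> tensor_power n"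
  by (intro tv.subspace_add tv.subspace_scale tensor_power_subspace pure_tensor_in_tensor_power)

lemma tensor_power_mult:
  assumes "s \<in> tensor_power n" "t \<in> tensor_power n"
  shows "s * t \<in> tensor_power n"
  using assms(1)
proof (induction rule: tensor_power_induct)
  case zero
  then show ?case by (simp add: tv.subspace_0 tensor_power_subspace)
next
  case (pure c xs s)
  have "pure_tensor xs * t \<in> tensor_power n"
    using assms(2)
  proof (induction rule: tensor_power_induct)
    case zero
    then show ?case by (simp add: tv.subspace_0 tensor_power_subspace)
  next
    case (pure d ys t)
    then show ?case
      using \<open>length xs = n\<close> by (simp add: distrib_left scale_tensor_mult_right pure_tensor_mult tensor_power_scale_add)
  qed
  with pure show ?case
    by (auto simp: distrib_right scale_tensor_mult_left intro!: tv.subspace_add tv.subspace_scale tensor_power_subspace)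
qed

lemma pure_tensor_zero: "(0 :: 'a::cstar_algebra) \<in> set xs \<Longrightarrow> pure_tensor xs = 0"
proof -
  interpret vs: vector_space "scaleC :: complex \<Rightarrow> 'a \<Rightarrow> 'a" by (rule vector_space_scaleC)
  assume "0 \<in> set xs"
  then obtain us vs where "xs = us @ 0 # vs" by (auto simp: in_set_conv_decomp)
  then show ?thesis using pure_tensor_scaleC[of us 0 0 vs] by simp
qed

lemma pure_tensor_sum:
  "pure_tensor (us @ (\<Sum>i\<in>I. c i *\<^sub>C f i) # vs) = (\<Sum>i\<in>I. scale_tensor (c i) (pure_tensor (us @ f i # vs)))"
  by (induction I rule: infinite_finite_induct)
     (simp_all add: pure_tensor_add pure_tensor_scaleC pure_tensor_zero)

lemma adj_in_tensor_power: "t \<in> tensor_power n \<Longrightarrow> adj t \<in> tensor_power n"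
proof (induction rule: tensor_power_induct)
  case zero
  have "adj 0 = (0 :: 'a tensor)" using adj_tensor_add[of 0 "0 :: 'a tensor"] by simp
  then show ?case by (simp add: tv.subspace_0 tensor_power_subspace)
next
  case (pure c xs t)
  then show ?case by (simp add: adj_tensor_add adj_scale_tensor adj_pure_tensor tensor_power_scale_add)
qed

lemma map2_replicate_one: "length xs = n \<Longrightarrow> map2 (*) (replicate n 1) xs = (xs :: 'a::monoid_mult list)"
  "length xs = n \<Longrightarrow> map2 (*) xs (replicate n 1) = (xs :: 'a::monoid_mult list)"
  by (auto intro!: nth_equalityI)

lemma tensor_unit:
  assumes "t \<in> tensor_power n"
  shows "pure_tensor (replicate n 1) * t = t" "t * pure_tensor (replicate n 1) = t"
  using assms
  by (induction rule: tensor_power_induct)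
     (simp_all add: distrib_left distrib_right scale_tensor_mult_left scale_tensor_mult_right
       pure_tensor_mult map2_replicate_one)

lemma tensor_power_basis:
  "tensor_power n \<subseteq> tv.span (pure_tensor ` {bs. set bs \<subseteq> onb \<and> length bs = n})"
proof -
  let ?S = "pure_tensor ` {bs :: 'a list. set bs \<subseteq> onb \<and> length bs = n}"
  \<comment> \<open>The slots are expanded one at a time; \<open>us\<close> is the part that already
    consists of basis elements.\<close>
  have "pure_tensor (us @ xs) \<in> tv.span ?S" if "set us \<subseteq> onb" "length us + length xs = n" for us xs
    using that
  proof (induction xs arbitrary: us)
    case Nil
    then show ?case by (auto intro!: tv.span_base)
  next
    case (Cons x xs)
    have "pure_tensor (us @ x # xs) =
        (\<Sum>b\<in>onb. scale_tensor (canonical_trace (adj b * x)) (pure_tensor ((us @ [b]) @ xs)))"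
      by (subst onb(3)[of x]) (simp add: pure_tensor_sum)
    also have "\<dots> \<in> tv.span ?S"
      using Cons.prems by (intro tv.span_sum tv.span_scale Cons.IH) auto
    finally show ?case .
  qed
  from this[of "[]"] show ?thesis
    unfolding tensor_power_eq_span by (intro tv.span_minimal tv.subspace_span) auto
qed

abbreviation (input) pf :: "('a::cstar_algebra \<Rightarrow> complex) \<Rightarrow> 'a tensor \<Rightarrow> complex" where
  "pf \<equiv> product_functional"

lemma product_functional_zero: "pf \<psi> 0 = 0"
  using product_functional_add[of \<psi> 0 0] by simp

lemma product_functional_sum:
  "pf \<psi> (\<Sum>i\<in>I. f i) = (\<Sum>i\<in>I. pf \<psi> (f i))"
  by (induction I rule: infinite_finite_induct) (simp_all add: product_functional_zero product_functional_add)

lemma prod_list_delta: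
  fixes bs cs :: "'a::fd_cstar_algebra list"
  assumes "length bs = length cs" "set bs \<subseteq> onb" "set cs \<subseteq> onb"
  shows "(\<Prod>x\<leftarrow>map2 (*) (map adj bs) cs. canonical_trace x) = (if bs = cs then 1 else 0)"
  using assms by (induction bs cs rule: list_induct2) (auto simp: onb(2))

text \<open>Words over \<open>onb\<close> are orthonormal for the product trace, so the value at
  \<open>adj t * t\<close> is the sum of the squared moduli of the coordinates of \<open>t\<close>.
  Both claims are read off from this.\<close>

lemma tensor_trace_faithful:
  fixes t :: "'a::fd_cstar_algebra tensor"
  assumes "t \<in> tensor_power n"
  shows "pf canonical_trace (adj t * t) \<in> nonneg_Reals"
    and "pf canonical_trace (adj t * t) = 0 \<Longrightarrow> t = 0"
proof -
  let ?L = "{bs :: 'a list. set bs \<subseteq> onb \<and> length bs = n}"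
  let ?\<tau> = "product_functional (canonical_trace :: 'a \<Rightarrow> complex)"
  have fin: "finite ?L" by (rule finite_lists_length_eq[OF onb(1)])
  have orth: "?\<tau> (adj (pure_tensor bs) * pure_tensor cs) = (if bs = cs then 1 else 0)"
    if "bs \<in> ?L" "cs \<in> ?L" for bs cs
    using that by (simp add: adj_pure_tensor pure_tensor_mult prod_list_delta
        product_functional_pure[OF clinear_canonical_trace] del: map_map)
  \<comment> \<open>Distinct basis words stay distinct in the quotient because the trace pairing
    separates them.\<close>
  have inj: "inj_on pure_tensor ?L"
  proof (rule inj_onI, rule ccontr)
    fix bs cs assume "bs \<in> ?L" "cs \<in> ?L" "pure_tensor bs = pure_tensor cs" "bs \<noteq> cs"
    then show False using orth[of bs bs] orth[of bs cs] by simp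
  qed
  from assms have "t \<in> tv.span (pure_tensor ` ?L)" using tensor_power_basis[of n] by blast
  then obtain u where "t = (\<Sum>v\<in>pure_tensor ` ?L. scale_tensor (u v) v)"
    using fin by (auto simp: tv.span_finite)
  then have t: "t = (\<Sum>bs\<in>?L. scale_tensor (u (pure_tensor bs)) (pure_tensor bs))"
    by (simp add: sum.reindex[OF inj])
  define c where "c bs = u (pure_tensor bs)" for bs
  have adj_sum: "adj (\<Sum>i\<in>I. f i) = (\<Sum>i\<in>I. adj (f i))" for f :: "'a list \<Rightarrow> 'a tensor" and I
  proof -
    have "adj 0 = (0 :: 'a tensor)" using adj_tensor_add[of 0 "0 :: 'a tensor"] by simp
    then show ?thesis by (induction I rule: infinite_finite_induct) (simp_all add: adj_tensor_add)
  qed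
  have "?\<tau> (adj t * t) = (\<Sum>bs\<in>?L. \<Sum>cs\<in>?L. c cs * cnj (c bs) * ?\<tau> (adj (pure_tensor bs) * pure_tensor cs))"
    unfolding t by (simp add: c_def adj_sum adj_scale_tensor sum_product scale_tensor_mult_left
        scale_tensor_mult_right product_functional_sum product_functional_scale mult.left_commute)
  also have "\<dots> = (\<Sum>bs\<in>?L. \<Sum>cs\<in>?L. if bs = cs then of_real ((cmod (c bs))\<^sup>2) else 0)"
    by (intro sum.cong refl) (simp add: orth flip: complex_norm_square)
  also have "\<dots> = of_real (\<Sum>bs\<in>?L. (cmod (c bs))\<^sup>2)"
    using fin by (simp add: sum.delta)
  finally have *: "?\<tau> (adj t * t) = of_real (\<Sum>bs\<in>?L. (cmod (c bs))\<^sup>2)" .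
  show "?\<tau> (adj t * t) \<in> nonneg_Reals" unfolding * by (subst nonneg_Reals_of_real_iff) (simp add: sum_nonneg)
  assume "?\<tau> (adj t * t) = 0"
  then have "(\<Sum>bs\<in>?L. (cmod (c bs))\<^sup>2) = 0" unfolding * by (simp only: of_real_eq_0_iff)
  then have "\<forall>bs\<in>?L. (cmod (c bs))\<^sup>2 = 0" using fin by (subst (asm) sum_nonneg_eq_0_iff) auto
  then show "t = 0" unfolding t c_def by (intro sum.neutral) auto
qed

interpretation T: tracial_star_alg "scale_tensor :: complex \<Rightarrow> 'a::fd_cstar_algebra tensor \<Rightarrow> 'a tensor"
  "tensor_power n" "pure_tensor (replicate n 1)" "pf canonical_trace" for n
proof (intro tracial_star_alg.intro star_alg.intro tv.vector_space_axioms star_alg_axioms.intro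
    tracial_star_alg_axioms.intro)
  have "finite (pure_tensor ` {bs :: 'a list. set bs \<subseteq> onb \<and> length bs = n})"
    by (rule finite_imageI[OF finite_lists_length_eq[OF onb(1)]])
  then show "\<exists>B. finite B \<and> tensor_power n \<subseteq> tv.span (B :: 'a tensor set)"
    using tensor_power_basis by blast
next
  fix s t :: "'a tensor" assume st: "s \<in> tensor_power n" "t \<in> tensor_power n"
  have comm: "pf canonical_trace (pure_tensor xs * pure_tensor ys) =
      pf canonical_trace (pure_tensor ys * pure_tensor xs)"
    if "length xs = n" "length ys = n" for xs ys :: "'a list"
  proof -
    have "length xs = length ys" using that by simp
    then have "(\<Prod>x\<leftarrow>map2 (*) xs ys. canonical_trace x) = (\<Prod>x\<leftarrow>map2 (*) ys xs. canonical_trace x)"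
      by (induction xs ys rule: list_induct2) (auto simp: A.tau_commute)
    then show ?thesis using that
      by (simp add: pure_tensor_mult product_functional_pure[OF clinear_canonical_trace])
  qed
  show "pf canonical_trace (s * t) = pf canonical_trace (t * s)"
    using st(1)
  proof (induction rule: tensor_power_induct)
    case (pure c xs s)
    have "pf canonical_trace (pure_tensor xs * t) =
        pf canonical_trace (t * pure_tensor xs)"
      using st(2)
      by (induction rule: tensor_power_induct)
         (simp_all add: distrib_left distrib_right scale_tensor_mult_left scale_tensor_mult_right
           product_functional_add product_functional_scale \<open>length xs = n\<close> comm)
    with pure.IH show ?case
      by (simp add: distrib_left distrib_right scale_tensor_mult_left scale_tensor_mult_right
          product_functional_add product_functional_scale)
  qed simp
qed (simp_all add: scale_tensor_mult_left scale_tensor_mult_right adj_adj_tensor adj_tensor_add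
    adj_scale_tensor adj_tensor_mult tensor_power_subspace tensor_power_mult adj_in_tensor_power
    pure_tensor_in_tensor_power tensor_unit product_functional_add product_functional_scale
    tensor_trace_faithful)

section \<open>Product states\<close>

abbreviation ptrace :: "'a::fd_cstar_algebra tensor \<Rightarrow> complex" where
  "ptrace \<equiv> pf canonical_trace"

lemma ptrace_pure: "ptrace (pure_tensor xs) = (\<Prod>x\<leftarrow>xs. canonical_trace x)"
  by (rule product_functional_pure[OF clinear_canonical_trace])

lemma density_root:
  assumes "\<psi> \<in> states"
  shows "\<exists>h. density \<psi> = adj h * h"
proof -
  obtain L P where er: "eigen_resolution \<psi> L P" using assms by (rule eigen_resolution_exists)
  note [simp] = er_orthogonal[OF assms er] base.is_projection_star[OF er_projection[OF assms er]]
  define h where "h = (\<Sum>l\<in>L. complex_of_real (sqrt l) *\<^sub>C P l)"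
  have "adj h = h" by (simp add: h_def base.star_sum base.star_sc)
  have "h * h = (\<Sum>l\<in>L. \<Sum>m\<in>L. if l = m then complex_of_real l *\<^sub>C P l else 0)"
    unfolding h_def sum_product
    by (intro sum.cong refl)
       (auto simp: mult_scaleC_left mult_scaleC_right er_nonneg[OF assms er] simp flip: of_real_mult)
  also have "\<dots> = density \<psi>"
    using er_finite[OF assms er] by (subst er_density[OF assms er]) (simp add: sum.delta)
  finally have "density \<psi> = adj h * h" by (simp add: \<open>adj h = h\<close>)
  then show ?thesis ..
qed

lemma product_density:
  assumes "clinear \<psi>" "t \<in> tensor_power n"
  shows "pf \<psi> t = ptrace (pure_tensor (replicate n (density \<psi>)) * t)"
  using assms(2)
proof (induction rule: tensor_power_induct)
  case (pure c xs t)
  have "(\<Prod>x\<leftarrow>xs. \<psi> x) = (\<Prod>x\<leftarrow>map2 (*) (replicate (length xs) (density \<psi>)) xs. canonical_trace x)"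
    by (induction xs) (simp_all flip: density[OF assms(1)])
  then show ?case using pure
    by (simp add: distrib_left scale_tensor_mult_right product_functional_add product_functional_scale
        pure_tensor_mult ptrace_pure product_functional_pure[OF assms(1)] del: map_map)
qed (simp add: product_functional_zero)

text \<open>Square roots are taken slot by slot. The slots may differ, as is needed for the hybrid
  words that interpolate between two product states.\<close>

lemma pos_fun_pure:
  assumes "\<And>d. d \<in> set ds \<Longrightarrow> \<exists>h. d = adj h * h" "length ds = n"
  shows "T.pos_fun n (\<lambda>x. ptrace (pure_tensor ds * x))"
proof -
  define r where "r d = (SOME h. d = adj h * h)" for d :: 'a
  have r: "d = adj (r d) * r d" if "d \<in> set ds" for d
    unfolding r_def using someI_ex[OF assms(1)[OF that]] .
  have "map2 (*) (map adj (map r ds)) (map r ds) = ds"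
    using r by (induction ds) auto
  then have "pure_tensor ds = adj (pure_tensor (map r ds)) * pure_tensor (map r ds)"
    by (simp only: adj_pure_tensor pure_tensor_mult length_map)
  then show ?thesis
    using T.pos_fun_mult[OF pure_tensor_in_tensor_power, of "map r ds" n] assms(2) by simp
qed

lemma pos_fun_product:
  assumes "\<psi> \<in> states"
  shows "T.pos_fun n (pf \<psi>)"
  unfolding T.pos_fun_def
proof (intro conjI allI ballI)
  fix x :: "'a tensor" assume x: "x \<in> tensor_power n"
  have "T.pos_fun n (\<lambda>x. ptrace (pure_tensor (replicate n (density \<psi>)) * x))"
    by (rule pos_fun_pure) (use density_root[OF assms] in auto)
  from T.pos_funD(3)[OF this x] show "pf \<psi> (adj x * x) \<in> nonneg_Reals"
    using product_density[OF states_clinear[OF assms] tensor_power_mult[OF adj_in_tensor_power[OF x] x]] by simp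
qed (simp_all add: product_functional_add product_functional_scale)

lemma product_unit: "\<psi> \<in> states \<Longrightarrow> pf \<psi> (pure_tensor (replicate n 1)) = 1"
  by (simp add: product_functional_pure[OF states_clinear] states_one prod_list_replicate)

lemma trace_density: "\<psi> \<in> states \<Longrightarrow> canonical_trace (density \<psi>) = 1"
  using density[OF states_clinear, of \<psi> 1] states_one[of \<psi>] by simp

section \<open>Dependence of a product state on its factor\<close>

lemma square_root_one: "\<exists>h. (1 :: 'a::fd_cstar_algebra) = adj h * h"
  by (rule exI[of _ 1]) simp

text \<open>The slot with \<open>adj b\<close> is not positive, so it is filled with 1 instead and
  \<open>adj b\<close> is moved into a second factor \<open>Y\<close>. Cauchy-Schwarz for the
  positive functional with density \<open>W\<close> gives a bound that does not depend on the number
  of slots, because densities have trace 1 and \<open>b\<close> is normalised.\<close>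

lemma onb_slot_bound:
  fixes \<psi> \<psi>' :: "'a::fd_cstar_algebra \<Rightarrow> complex"
  assumes st: "\<psi> \<in> states" "\<psi>' \<in> states" and b: "b \<in> onb"
    and q: "q \<in> tensor_power (k + Suc m)" "is_projection q"
  shows "\<bar>Re (c * ptrace (pure_tensor (replicate k (density \<psi>) @ adj b # replicate m (density \<psi>')) * q))\<bar>
    \<le> cmod c * sqrt (Re (canonical_trace (1 :: 'a)))"
proof -
  define D D' where "D = density \<psi>" and "D' = density \<psi>'"
  define W where "W = pure_tensor (replicate k D @ 1 # replicate m D')"
  define Y where "Y = scale_tensor c (pure_tensor (replicate k 1 @ adj b # replicate m 1))"
  define \<omega> where "\<omega> x = ptrace (W * x)" for x
  let ?n = "k + Suc m"
  have w: "T.pos_fun ?n \<omega>"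
    unfolding \<omega>_def W_def
    by (rule pos_fun_pure) (use density_root st square_root_one in \<open>auto simp: D_def D'_def\<close>)
  have rep: "map2 (*) (replicate j x) (replicate j y) = replicate j (x * y)" for j and x y :: 'a
    by (induction j) auto
  have YV: "Y \<in> tensor_power ?n"
    unfolding Y_def by (intro tv.subspace_scale tensor_power_subspace pure_tensor_in_tensor_power) simp
  have "W * Y = scale_tensor c (pure_tensor (replicate k D @ adj b # replicate m D'))"
    unfolding W_def Y_def by (simp add: scale_tensor_mult_right pure_tensor_mult rep)
  then have "c * ptrace (pure_tensor (replicate k D @ adj b # replicate m D') * q) = ptrace (W * Y * q)"
    by (simp add: scale_tensor_mult_left product_functional_scale)
  also have "\<dots> = \<omega> (adj (adj Y) * q)" by (simp add: \<omega>_def adj_adj_tensor mult.assoc)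
  finally have eq: "c * ptrace (pure_tensor (replicate k D @ adj b # replicate m D') * q) = \<omega> (adj (adj Y) * q)" .
  have "T.nsq \<omega> (adj Y) = Re (ptrace (W * (Y * adj Y)))" by (simp add: T.nsq_def \<omega>_def adj_adj_tensor)
  also have "W * (Y * adj Y) = scale_tensor (c * cnj c) (pure_tensor (replicate k D @ (adj b * b) # replicate m D'))"
    unfolding W_def Y_def
    by (simp add: scale_tensor_mult_left scale_tensor_mult_right adj_scale_tensor adj_pure_tensor
        pure_tensor_mult rep adj_adj mult.commute)
  also have "Re (ptrace \<dots>) = (cmod c)\<^sup>2"
    by (simp add: product_functional_scale ptrace_pure prod_list_replicate onb(2)[OF b b] D_def D'_def
        trace_density st cmod_power2 flip: power2_eq_square)
  finally have nY: "T.nsq \<omega> (adj Y) = (cmod c)\<^sup>2" .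
  have "T.nsq \<omega> q = Re (\<omega> q)" by (rule T.nsq_projection[OF q(2)])
  also have "\<dots> \<le> Re (\<omega> (pure_tensor (replicate ?n 1)))"
    by (rule T.pos_fun_projection_le[OF w q])
  also have "\<dots> = Re (ptrace W)"
    unfolding \<omega>_def by (subst tensor_unit) (auto simp: W_def intro!: pure_tensor_in_tensor_power)
  also have "\<dots> = Re (canonical_trace (1 :: 'a))"
    by (simp add: W_def ptrace_pure prod_list_replicate D_def D'_def trace_density st)
  finally have nq: "T.nsq \<omega> q \<le> Re (canonical_trace (1 :: 'a))" .
  have "\<bar>Re (\<omega> (adj (adj Y) * q))\<bar> \<le> sqrt (T.nsq \<omega> (adj Y)) * sqrt (T.nsq \<omega> q)"
    by (rule T.cauchy_schwarz[OF w adj_in_tensor_power[OF YV] q(1)])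
  also have "\<dots> \<le> cmod c * sqrt (Re (canonical_trace (1 :: 'a)))"
    unfolding nY using nq by (intro mult_mono) (auto intro!: T.nsq_nonneg[OF w q(1)])
  finally show ?thesis unfolding eq[unfolded D_def D'_def] .
qed

text \<open>Hybrid argument: the copies of one density are exchanged for the other one slot at a
  time, and each exchange costs the same amount. The error is therefore linear in
  \<open>n\<close>.\<close>

lemma product_state_diff:
  fixes \<psi> \<psi>' :: "'a::fd_cstar_algebra \<Rightarrow> complex"
  assumes st: "\<psi> \<in> states" "\<psi>' \<in> states" and q: "q \<in> tensor_power n" "is_projection q"
  shows "\<bar>Re (pf \<psi> q) - Re (pf \<psi>' q)\<bar>
    \<le> real n * ((\<Sum>b\<in>onb. cmod (\<psi> b - \<psi>' b)) * sqrt (Re (canonical_trace (1 :: 'a))))"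
proof -
  define D D' where "D = density \<psi>" and "D' = density \<psi>'"
  define a where "a k = Re (ptrace (pure_tensor (replicate k D @ replicate (n - k) D') * q))" for k
  have D: "D - D' = (\<Sum>b\<in>onb. (\<psi> b - \<psi>' b) *\<^sub>C adj b)"
    by (simp add: D_def D'_def density_expansion states_clinear st base.scale_left_diff_distrib sum_subtractf)
  have step: "\<bar>a (Suc k) - a k\<bar> \<le> (\<Sum>b\<in>onb. cmod (\<psi> b - \<psi>' b)) * sqrt (Re (canonical_trace (1 :: 'a)))"
    if "k < n" for k
  proof -
    define m where "m = n - Suc k"
    have n: "n = k + Suc m" using that by (simp add: m_def)
    have "pure_tensor (replicate (Suc k) D @ replicate m D') =
        pure_tensor (replicate k D @ (D' + (D - D')) # replicate m D')"
      by (simp add: replicate_app_Cons_same)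
    also have "\<dots> = pure_tensor (replicate k D @ replicate (Suc m) D') +
        (\<Sum>b\<in>onb. scale_tensor (\<psi> b - \<psi>' b) (pure_tensor (replicate k D @ adj b # replicate m D')))"
      by (simp add: pure_tensor_add D pure_tensor_sum)
    finally have "a (Suc k) - a k =
        (\<Sum>b\<in>onb. Re ((\<psi> b - \<psi>' b) * ptrace (pure_tensor (replicate k D @ adj b # replicate m D') * q)))"
      by (simp add: a_def n distrib_right sum_distrib_right scale_tensor_mult_left product_functional_add
          product_functional_sum product_functional_scale)
    then have "\<bar>a (Suc k) - a k\<bar> \<le>
        (\<Sum>b\<in>onb. \<bar>Re ((\<psi> b - \<psi>' b) * ptrace (pure_tensor (replicate k D @ adj b # replicate m D') * q))\<bar>)"
      by simp
    also have "\<dots> \<le> (\<Sum>b\<in>onb. cmod (\<psi> b - \<psi>' b) * sqrt (Re (canonical_trace (1 :: 'a))))"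
      unfolding D_def D'_def by (intro sum_mono onb_slot_bound st q[unfolded n])
    finally show ?thesis by (simp add: sum_distrib_right)
  qed
  have "a n - a 0 = (\<Sum>k<n. a (Suc k) - a k)" by (rule sum_lessThan_telescope[symmetric])
  then have "\<bar>a n - a 0\<bar> \<le> (\<Sum>k<n. \<bar>a (Suc k) - a k\<bar>)" by simp
  also have "\<dots> \<le> (\<Sum>k<n. (\<Sum>b\<in>onb. cmod (\<psi> b - \<psi>' b)) * sqrt (Re (canonical_trace (1 :: 'a))))"
    by (intro sum_mono step) simp
  finally show ?thesis
    by (simp add: a_def D_def D'_def product_density[OF states_clinear[OF st(1)] q(1)]
        product_density[OF states_clinear[OF st(2)] q(1)])
qed

section \<open>Typical words\<close>

definition words :: "'b set \<Rightarrow> nat \<Rightarrow> 'b list set" where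
  "words S n = {xs. set xs \<subseteq> S \<and> length xs = n}"

lemma finite_words: "finite S \<Longrightarrow> finite (words S n)"
  unfolding words_def by (rule finite_lists_length_eq)

lemma words_0: "words S 0 = {[]}"
  by (auto simp: words_def)

lemma sum_words_Suc: "(\<Sum>xs\<in>words S (Suc n). F xs) = (\<Sum>x\<in>S. \<Sum>xs\<in>words S n. F (x # xs))"
proof -
  have "words S (Suc n) = (\<lambda>(x, xs). x # xs) ` (S \<times> words S n)"
    by (auto simp: words_def length_Suc_conv image_iff)
  moreover have "inj_on (\<lambda>(x, xs). x # xs) (S \<times> words S n)" by (auto simp: inj_on_def)
  ultimately show ?thesis by (simp add: sum.reindex sum.cartesian_product split_def)
qed

text \<open>Total mass, mean and variance of a sum of \<open>n\<close> independent centred variables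
  with law \<mu>.\<close>

lemma words_moments:
  fixes \<mu> f :: "'b \<Rightarrow> real"
  assumes "(\<Sum>x\<in>S. \<mu> x) = 1" "(\<Sum>x\<in>S. \<mu> x * f x) = 0"
  shows "(\<Sum>xs\<in>words S n. \<Prod>x\<leftarrow>xs. \<mu> x) = 1"
    "(\<Sum>xs\<in>words S n. (\<Prod>x\<leftarrow>xs. \<mu> x) * (\<Sum>x\<leftarrow>xs. f x)) = 0"
    "(\<Sum>xs\<in>words S n. (\<Prod>x\<leftarrow>xs. \<mu> x) * (\<Sum>x\<leftarrow>xs. f x)\<^sup>2) = n * (\<Sum>x\<in>S. \<mu> x * (f x)\<^sup>2)"
proof -
  show 1: "(\<Sum>xs\<in>words S n. \<Prod>x\<leftarrow>xs. \<mu> x) = 1" for n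
    using assms(1) by (induction n) (simp_all add: words_0 sum_words_Suc flip: sum_distrib_left)
  show 2: "(\<Sum>xs\<in>words S n. (\<Prod>x\<leftarrow>xs. \<mu> x) * (\<Sum>x\<leftarrow>xs. f x)) = 0" for n
  proof (induction n)
    case (Suc n)
    have "(\<Sum>xs\<in>words S (Suc n). (\<Prod>x\<leftarrow>xs. \<mu> x) * (\<Sum>x\<leftarrow>xs. f x)) =
        (\<Sum>x\<in>S. \<mu> x * f x * (\<Sum>xs\<in>words S n. \<Prod>x\<leftarrow>xs. \<mu> x) +
          \<mu> x * (\<Sum>xs\<in>words S n. (\<Prod>x\<leftarrow>xs. \<mu> x) * (\<Sum>x\<leftarrow>xs. f x)))"
      unfolding sum_words_Suc sum_distrib_left sum.distrib[symmetric]
      by (intro sum.cong refl) (simp add: algebra_simps)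
    then show ?case using assms by (simp add: 1 Suc.IH)
  qed (simp add: words_0)
  show "(\<Sum>xs\<in>words S n. (\<Prod>x\<leftarrow>xs. \<mu> x) * (\<Sum>x\<leftarrow>xs. f x)\<^sup>2) = n * (\<Sum>x\<in>S. \<mu> x * (f x)\<^sup>2)"
  proof (induction n)
    case (Suc n)
    have "(\<Sum>xs\<in>words S (Suc n). (\<Prod>x\<leftarrow>xs. \<mu> x) * (\<Sum>x\<leftarrow>xs. f x)\<^sup>2) =
        (\<Sum>x\<in>S. \<mu> x * (f x)\<^sup>2 * (\<Sum>xs\<in>words S n. \<Prod>x\<leftarrow>xs. \<mu> x) +
          2 * (\<mu> x * f x) * (\<Sum>xs\<in>words S n. (\<Prod>x\<leftarrow>xs. \<mu> x) * (\<Sum>x\<leftarrow>xs. f x)) +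
          \<mu> x * (\<Sum>xs\<in>words S n. (\<Prod>x\<leftarrow>xs. \<mu> x) * (\<Sum>x\<leftarrow>xs. f x)\<^sup>2))"
      unfolding sum_words_Suc sum_distrib_left sum.distrib[symmetric]
      by (intro sum.cong refl) (simp add: algebra_simps power2_eq_square)
    also have "\<dots> = (\<Sum>x\<in>S. \<mu> x * (f x)\<^sup>2) + (\<Sum>x\<in>S. \<mu> x) * (n * (\<Sum>x\<in>S. \<mu> x * (f x)\<^sup>2))"
      by (simp add: 1 2 Suc.IH sum.distrib sum_distrib_right)
    finally show ?case by (simp add: assms(1) algebra_simps)
  qed (simp add: words_0)
qed

definition typical :: "'b set \<Rightarrow> ('b \<Rightarrow> real) \<Rightarrow> real \<Rightarrow> nat \<Rightarrow> real \<Rightarrow> 'b list set" where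
  "typical S f m n \<delta> = {xs\<in>words S n. \<bar>(\<Sum>x\<leftarrow>xs. f x) - n * m\<bar> \<le> n * \<delta>}"

text \<open>Chebyshev's inequality. \<open>v\<close> only has to dominate the raw second moment,
  which is at least the variance and can be bounded uniformly over all states.\<close>

lemma typical_weight:
  fixes \<mu> f :: "'b \<Rightarrow> real"
  assumes S: "finite S" and \<mu>: "\<And>x. x \<in> S \<Longrightarrow> \<mu> x \<ge> 0" "(\<Sum>x\<in>S. \<mu> x) = 1"
    and m: "(\<Sum>x\<in>S. \<mu> x * f x) = m" and v: "(\<Sum>x\<in>S. \<mu> x * (f x)\<^sup>2) \<le> v"
    and n: "n > 0" and \<delta>: "\<delta> > 0"
  shows "(\<Sum>xs\<in>typical S f m n \<delta>. \<Prod>x\<leftarrow>xs. \<mu> x) \<ge> 1 - v / (n * \<delta>\<^sup>2)"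
proof -
  define g where "g x = f x - m" for x
  have g0: "(\<Sum>x\<in>S. \<mu> x * g x) = 0"
    using \<mu>(2) m by (simp add: g_def right_diff_distrib sum_subtractf flip: sum_distrib_right)
  have "(\<Sum>x\<in>S. \<mu> x * (g x)\<^sup>2) = (\<Sum>x\<in>S. \<mu> x * (f x)\<^sup>2) - 2 * m * (\<Sum>x\<in>S. \<mu> x * f x) + m\<^sup>2 * (\<Sum>x\<in>S. \<mu> x)"
    unfolding sum_distrib_left sum_subtractf[symmetric] sum.distrib[symmetric]
    by (intro sum.cong refl) (simp add: g_def power2_eq_square algebra_simps)
  then have gv: "(\<Sum>x\<in>S. \<mu> x * (g x)\<^sup>2) \<le> v"
    using v unfolding \<mu>(2) m using zero_le_power2[of m] by (simp add: power2_eq_square del: zero_le_square)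
  have sg: "(\<Sum>x\<leftarrow>xs. g x) = (\<Sum>x\<leftarrow>xs. f x) - n * m" if "xs \<in> words S n" for xs
  proof -
    have "(\<Sum>x\<leftarrow>xs. g x) = (\<Sum>x\<leftarrow>xs. f x) - length xs * m"
      by (induction xs) (simp_all add: g_def algebra_simps)
    then show ?thesis using that by (simp add: words_def)
  qed
  have pn: "(\<Prod>x\<leftarrow>xs. \<mu> x) \<ge> 0" if "xs \<in> words S n" for xs
  proof -
    have "set xs \<subseteq> S" using that by (simp add: words_def)
    then show ?thesis using \<mu>(1) by (induction xs) auto
  qed
  let ?T = "typical S f m n \<delta>"
  have fin: "finite (words S n)" "?T \<subseteq> words S n" using finite_words[OF S] by (auto simp: typical_def)
  have nd: "(n * \<delta>)\<^sup>2 > 0" using n \<delta> by simp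
  have "1 - (\<Sum>xs\<in>?T. \<Prod>x\<leftarrow>xs. \<mu> x) = (\<Sum>xs\<in>words S n - ?T. \<Prod>x\<leftarrow>xs. \<mu> x)"
    using words_moments(1)[OF \<mu>(2) g0, of n] fin by (simp add: sum_diff)
  also have "\<dots> \<le> (\<Sum>xs\<in>words S n - ?T. (\<Prod>x\<leftarrow>xs. \<mu> x) * (\<Sum>x\<leftarrow>xs. g x)\<^sup>2 / (n * \<delta>)\<^sup>2)"
  proof (rule sum_mono)
    fix xs assume xs: "xs \<in> words S n - ?T"
    then have "n * \<delta> \<le> \<bar>\<Sum>x\<leftarrow>xs. g x\<bar>" using sg by (auto simp: typical_def)
    then have "(n * \<delta>)\<^sup>2 \<le> (\<Sum>x\<leftarrow>xs. g x)\<^sup>2" using \<delta> by (simp add: abs_le_square_iff[symmetric])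
    then have "(\<Prod>x\<leftarrow>xs. \<mu> x) * (n * \<delta>)\<^sup>2 \<le> (\<Prod>x\<leftarrow>xs. \<mu> x) * (\<Sum>x\<leftarrow>xs. g x)\<^sup>2"
      using pn xs by (intro mult_left_mono) auto
    then show "(\<Prod>x\<leftarrow>xs. \<mu> x) \<le> (\<Prod>x\<leftarrow>xs. \<mu> x) * (\<Sum>x\<leftarrow>xs. g x)\<^sup>2 / (n * \<delta>)\<^sup>2"
      using nd by (simp only: pos_le_divide_eq)
  qed
  also have "\<dots> \<le> (\<Sum>xs\<in>words S n. (\<Prod>x\<leftarrow>xs. \<mu> x) * (\<Sum>x\<leftarrow>xs. g x)\<^sup>2 / (n * \<delta>)\<^sup>2)"
    using fin pn by (intro sum_mono2) auto
  also have "\<dots> = n * (\<Sum>x\<in>S. \<mu> x * (g x)\<^sup>2) / (n * \<delta>)\<^sup>2"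
    by (simp add: words_moments(3)[OF \<mu>(2) g0] flip: sum_divide_distrib)
  also have "\<dots> \<le> n * v / (n * \<delta>)\<^sup>2" using gv by (intro divide_right_mono mult_left_mono) auto
  also have "\<dots> = v / (n * \<delta>\<^sup>2)" using n by (simp add: power2_eq_square)
  finally show ?thesis by simp
qed

section \<open>Projections indexed by words of eigenvalues\<close>

definition word_sum :: "(real \<Rightarrow> 'a::cstar_algebra) \<Rightarrow> real list set \<Rightarrow> 'a tensor" where
  "word_sum P X = (\<Sum>xs\<in>X. pure_tensor (map P xs))"

lemma word_in_power: "xs \<in> words S n \<Longrightarrow> pure_tensor (map P xs) \<in> tensor_power n"
  by (simp add: words_def pure_tensor_in_tensor_power)

lemma word_sum_in_power: "X \<subseteq> words S n \<Longrightarrow> word_sum P X \<in> tensor_power n"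
  unfolding word_sum_def by (rule tv.subspace_sum[OF tensor_power_subspace]) (auto intro: word_in_power)

lemma word_orthogonal:
  assumes P: "\<And>l m. l \<in> S \<Longrightarrow> m \<in> S \<Longrightarrow> P l * P m = (if l = m then P l else 0)"
    and xs: "xs \<in> words S n" "ys \<in> words S n"
  shows "pure_tensor (map P xs) * pure_tensor (map P ys) = (if xs = ys then pure_tensor (map P xs) else 0)"
proof (cases "xs = ys")
  case True
  have "map2 (*) (map P xs) (map P xs) = map P xs"
    using xs(1) P by (intro nth_equalityI) (auto simp: words_def subset_iff)
  then show ?thesis using True by (simp add: pure_tensor_mult)
next
  case False
  then obtain i where i: "i < n" "xs ! i \<noteq> ys ! i"
    using xs by (auto simp: words_def list_eq_iff_nth_eq)
  then have "map2 (*) (map P xs) (map P ys) ! i = 0"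
    using xs P by (auto simp: words_def subset_iff)
  then have "0 \<in> set (map2 (*) (map P xs) (map P ys))"
    using i(1) xs nth_mem[of i "map2 (*) (map P xs) (map P ys)"] by (simp add: words_def del: map_map)
  then show ?thesis using False xs by (simp add: words_def pure_tensor_mult pure_tensor_zero del: map_map)
qed

context
  fixes S :: "real set" and P :: "real \<Rightarrow> 'a::fd_cstar_algebra"
  assumes S: "finite S" and proj: "\<And>l. l \<in> S \<Longrightarrow> is_projection (P l)"
    and orth: "\<And>l m. l \<in> S \<Longrightarrow> m \<in> S \<Longrightarrow> P l * P m = (if l = m then P l else 0)"
begin

lemma word_projection:
  assumes "xs \<in> words S n"
  shows "is_projection (pure_tensor (map P xs))"
proof -
  have "map adj (map P xs) = map P xs"
    using assms proj by (auto simp: words_def is_projection_def)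
  then show ?thesis
    using word_orthogonal[OF orth assms assms] by (simp add: is_projection_def adj_pure_tensor del: map_map)
qed

lemma word_sum_projection:
  assumes "X \<subseteq> words S n"
  shows "is_projection (word_sum P X)"
  unfolding word_sum_def
proof (rule T.sum_projections)
  show "finite X" using assms finite_words[OF S] by (rule finite_subset)
  show "is_projection (pure_tensor (map P xs))" if "xs \<in> X" for xs
    using assms that word_projection by blast
  show "pure_tensor (map P xs) * pure_tensor (map P ys) = 0" if "xs \<in> X" "ys \<in> X" "xs \<noteq> ys" for xs ys
    using word_orthogonal[OF orth, where xs = xs and ys = ys and n = n] assms that by (simp add: subset_iff)
qed

lemma word_sum_typical:
  assumes \<psi>: "\<psi> \<in> states" and one: "(\<Sum>l\<in>S. Re (\<psi> (P l))) = 1"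
    and m: "(\<Sum>l\<in>S. Re (\<psi> (P l)) * f l) = m" and v: "(\<Sum>l\<in>S. Re (\<psi> (P l)) * (f l)\<^sup>2) \<le> v"
    and n: "n > 0" and \<delta>: "\<delta> > 0"
  shows "Re (pf \<psi> (word_sum P (typical S f m n \<delta>))) \<ge> 1 - v / (n * \<delta>\<^sup>2)"
proof -
  note w = states_pos_fun[OF \<psi>]
  have val: "Re (pf \<psi> (pure_tensor (map P xs))) = (\<Prod>l\<leftarrow>xs. Re (\<psi> (P l)))"
    if "xs \<in> words S n" for xs
  proof -
    have "set xs \<subseteq> S" using that by (simp add: words_def)
    then have "(\<Prod>l\<leftarrow>xs. \<psi> (P l)) = of_real (\<Prod>l\<leftarrow>xs. Re (\<psi> (P l)))"
    proof (induction xs)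
      case (Cons l xs)
      then have "\<psi> (P l) = of_real (Re (\<psi> (P l)))"
        using base.pos_fun_projection(2)[OF w UNIV_I proj] by (simp add: complex_eq_iff)
      then show ?case using Cons by (simp only: list.map prod_list.Cons of_real_mult) auto
    qed simp
    then show ?thesis by (simp add: product_functional_pure[OF states_clinear[OF \<psi>]] comp_def)
  qed
  have "Re (pf \<psi> (word_sum P (typical S f m n \<delta>))) =
      (\<Sum>xs\<in>typical S f m n \<delta>. \<Prod>l\<leftarrow>xs. Re (\<psi> (P l)))"
    unfolding word_sum_def product_functional_sum Re_sum
    by (intro sum.cong refl val) (simp add: typical_def)
  also have "\<dots> \<ge> 1 - v / (n * \<delta>\<^sup>2)"
    using base.pos_fun_projection(1)[OF w UNIV_I proj]
    by (intro typical_weight S one m v n \<delta>) auto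
  finally show ?thesis .
qed

text \<open>The letters are the eigenvalues themselves, so multiplying a word projection by the
  product density gives the factor \<open>prod_list xs\<close>, from either side. A word sum thus
  commutes with the product density, and cyclicity of the trace gives the second claim.\<close>

lemma word_eigen:
  assumes \<phi>: "\<phi> \<in> states" and eig: "\<And>l. l \<in> S \<Longrightarrow> density \<phi> * P l = complex_of_real l *\<^sub>C P l"
    and X: "X \<subseteq> words S n" and x: "x \<in> tensor_power n"
  shows "pf \<phi> (word_sum P X * x) =
      (\<Sum>xs\<in>X. of_real (prod_list xs) * ptrace (pure_tensor (map P xs) * x))"
    and "pf \<phi> (word_sum P X * x) = pf \<phi> (x * word_sum P X)"
proof -
  let ?D = "pure_tensor (replicate n (density \<phi>))"
  have DV: "?D \<in> tensor_power n" by (simp add: pure_tensor_in_tensor_power)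
  have eig': "P l * density \<phi> = complex_of_real l *\<^sub>C P l" if "l \<in> S" for l
    using arg_cong[OF eig[OF that], of adj] base.is_projection_star[OF proj[OF that]]
    by (simp add: base.star_mult base.star_sc density_selfadjoint[OF \<phi>])
  have scaled: "pure_tensor (map (\<lambda>l. complex_of_real l *\<^sub>C P l) xs) =
      scale_tensor (of_real (prod_list xs)) (pure_tensor (map P xs))" for xs
  proof -
    have "pure_tensor (us @ map (\<lambda>l. complex_of_real l *\<^sub>C P l) xs) =
        scale_tensor (of_real (prod_list xs)) (pure_tensor (us @ map P xs))" for us
    proof (induction xs arbitrary: us)
      case (Cons l xs)
      have "pure_tensor (us @ map (\<lambda>l. complex_of_real l *\<^sub>C P l) (l # xs)) =
          scale_tensor (of_real l) (pure_tensor ((us @ [P l]) @ map (\<lambda>l. complex_of_real l *\<^sub>C P l) xs))"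
        by (simp add: pure_tensor_scaleC)
      then show ?case unfolding Cons.IH by simp
    qed simp
    from this[of "[]"] show ?thesis by simp
  qed
  have Dw: "?D * pure_tensor (map P xs) = scale_tensor (of_real (prod_list xs)) (pure_tensor (map P xs))"
    "pure_tensor (map P xs) * ?D = scale_tensor (of_real (prod_list xs)) (pure_tensor (map P xs))"
    if "xs \<in> words S n" for xs
  proof -
    have l: "length xs = n" "set xs \<subseteq> S" using that by (auto simp: words_def)
    have "map2 (*) (replicate n (density \<phi>)) (map P xs) = map (\<lambda>l. complex_of_real l *\<^sub>C P l) xs"
      "map2 (*) (map P xs) (replicate n (density \<phi>)) = map (\<lambda>l. complex_of_real l *\<^sub>C P l) xs"
      using l by (auto intro!: nth_equalityI simp: eig eig' subset_iff)
    then show "?D * pure_tensor (map P xs) = scale_tensor (of_real (prod_list xs)) (pure_tensor (map P xs))"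
      "pure_tensor (map P xs) * ?D = scale_tensor (of_real (prod_list xs)) (pure_tensor (map P xs))"
      using l by (simp_all add: pure_tensor_mult scaled del: map_map)
  qed
  have TV: "word_sum P X \<in> tensor_power n" by (rule word_sum_in_power[OF X])
  have DT: "?D * word_sum P X = (\<Sum>xs\<in>X. scale_tensor (of_real (prod_list xs)) (pure_tensor (map P xs)))"
    unfolding word_sum_def sum_distrib_left using X Dw(1) by (intro sum.cong) auto
  have TD: "word_sum P X * ?D = (\<Sum>xs\<in>X. scale_tensor (of_real (prod_list xs)) (pure_tensor (map P xs)))"
    unfolding word_sum_def sum_distrib_right using X Dw(2) by (intro sum.cong) auto
  have "pf \<phi> (word_sum P X * x) = ptrace (?D * (word_sum P X * x))"
    by (rule product_density[OF states_clinear[OF \<phi>] tensor_power_mult[OF TV x]])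
  also have "?D * (word_sum P X * x) = ?D * word_sum P X * x" by (simp add: mult.assoc)
  finally have eq: "pf \<phi> (word_sum P X * x) = ptrace (?D * word_sum P X * x)" .
  show "pf \<phi> (word_sum P X * x) =
      (\<Sum>xs\<in>X. of_real (prod_list xs) * ptrace (pure_tensor (map P xs) * x))"
    unfolding eq DT by (simp add: sum_distrib_right scale_tensor_mult_left product_functional_sum product_functional_scale)
  have "ptrace (?D * word_sum P X * x) = ptrace (word_sum P X * (?D * x))"
    by (simp add: DT mult.assoc flip: TD)
  also have "\<dots> = ptrace (?D * x * word_sum P X)"
    by (rule T.tau_commute[OF TV tensor_power_mult[OF DV x]])
  also have "\<dots> = pf \<phi> (x * word_sum P X)"
    by (simp add: product_density[OF states_clinear[OF \<phi>] tensor_power_mult[OF x TV]] mult.assoc)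
  finally show "pf \<phi> (word_sum P X * x) = pf \<phi> (x * word_sum P X)"
    by (simp add: eq)
qed

text \<open>Each word has a nonnegative trace against \<open>z * adj z\<close>, so bounds on the
  eigenvalues carry over termwise.\<close>

lemma word_sum_bounds:
  assumes \<phi>: "\<phi> \<in> states" and eig: "\<And>l. l \<in> S \<Longrightarrow> density \<phi> * P l = complex_of_real l *\<^sub>C P l"
    and X: "X \<subseteq> words S n" and z: "z \<in> tensor_power n"
  shows "(\<And>xs. xs \<in> X \<Longrightarrow> prod_list xs \<le> \<kappa>) \<Longrightarrow>
      Re (pf \<phi> (word_sum P X * (z * adj z))) \<le> \<kappa> * Re (ptrace (word_sum P X * (z * adj z)))"
    and "(\<And>xs. xs \<in> X \<Longrightarrow> \<kappa> \<le> prod_list xs) \<Longrightarrow>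
      \<kappa> * Re (ptrace (word_sum P X * (z * adj z))) \<le> Re (pf \<phi> (word_sum P X * (z * adj z)))"
proof -
  let ?Z = "z * adj z"
  have nn: "Re (ptrace (pure_tensor (map P xs) * ?Z)) \<ge> 0" if "xs \<in> X" for xs
    using T.tau_projection_mult[OF word_in_power word_projection z, of xs S] X that by blast
  have 1: "Re (pf \<phi> (word_sum P X * ?Z)) =
      (\<Sum>xs\<in>X. prod_list xs * Re (ptrace (pure_tensor (map P xs) * ?Z)))"
    by (subst word_eigen(1)[OF \<phi> eig X]) (simp_all add: tensor_power_mult adj_in_tensor_power z)
  have 2: "\<kappa> * Re (ptrace (word_sum P X * ?Z)) = (\<Sum>xs\<in>X. \<kappa> * Re (ptrace (pure_tensor (map P xs) * ?Z)))"
    by (simp add: word_sum_def sum_distrib_right product_functional_sum sum_distrib_left)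
  show "Re (pf \<phi> (word_sum P X * ?Z)) \<le> \<kappa> * Re (ptrace (word_sum P X * ?Z))"
    if "\<And>xs. xs \<in> X \<Longrightarrow> prod_list xs \<le> \<kappa>"
    unfolding 1 2 by (intro sum_mono mult_right_mono that nn)
  show "\<kappa> * Re (ptrace (word_sum P X * ?Z)) \<le> Re (pf \<phi> (word_sum P X * ?Z))"
    if "\<And>xs. xs \<in> X \<Longrightarrow> \<kappa> \<le> prod_list xs"
    unfolding 1 2 by (intro sum_mono mult_right_mono that nn)
qed

end

lemma typical_prod_list:
  assumes "xs \<in> typical S (log 2) m n \<delta>" "\<And>l. l \<in> S \<Longrightarrow> l > 0"
  shows "prod_list xs \<le> 2 powr (n * (m + \<delta>))" "2 powr (n * (m - \<delta>)) \<le> prod_list xs"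
proof -
  have "set xs \<subseteq> S" using assms(1) by (auto simp: typical_def words_def)
  then have "prod_list xs > 0 \<and> log 2 (prod_list xs) = (\<Sum>l\<leftarrow>xs. log 2 l)"
    using assms(2) by (induction xs) (auto simp: log_mult)
  then have "prod_list xs = 2 powr (\<Sum>l\<leftarrow>xs. log 2 l)" by (metis powr_log_cancel zero_less_numeral numeral_One semiring_norm(85) numeral_eq_iff)
  moreover have "(\<Sum>l\<leftarrow>xs. log 2 l) \<le> n * (m + \<delta>)" "n * (m - \<delta>) \<le> (\<Sum>l\<leftarrow>xs. log 2 l)"
    using assms(1) by (auto simp: typical_def algebra_simps abs_le_iff)
  ultimately show "prod_list xs \<le> 2 powr (n * (m + \<delta>))" "2 powr (n * (m - \<delta>)) \<le> prod_list xs"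
    by simp_all
qed

section \<open>Hypothesis testing for a pair of states\<close>

text \<open>With \<open>t = - ln l\<close> this is the Taylor bound
  \<open>t^2 / 2 \<le> exp t\<close>. Eigenvalues of states can be arbitrarily small, so their
  logarithms are bounded only after weighting by the eigenvalue.\<close>

lemma log_square_bound:
  assumes "0 < l" "l \<le> (1::real)"
  shows "l * (log 2 l)\<^sup>2 \<le> 2 / (ln 2)\<^sup>2"
proof -
  define t where "t = - ln l"
  have t: "t \<ge> 0" using assms by (simp add: t_def)
  have "t\<^sup>2 / 2 \<le> exp t" using exp_lower_Taylor_quadratic[OF t] t by linarith
  also have "exp t = 1 / l" using assms by (simp add: t_def exp_minus inverse_eq_divide)
  finally have "l * t\<^sup>2 \<le> 2" using assms by (simp add: field_simps)
  then have "l * t\<^sup>2 / (ln 2)\<^sup>2 \<le> 2 / (ln 2)\<^sup>2" by (intro divide_right_mono) auto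
  then show ?thesis by (simp add: t_def log_def power_divide)
qed

lemma le_powr_minus: "2 powr a * x \<le> y \<Longrightarrow> x \<le> 2 powr (- a) * (y::real)"
  by (simp add: powr_minus field_simps)

lemma relative_entropy_cases:
  assumes "\<psi> \<in> states" "\<phi> \<in> states"
  shows "(\<psi> (supp_proj \<phi>) = 1 \<and> (\<exists>d. relative_entropy \<psi> \<phi> = ereal d)) \<or>
    (\<psi> (supp_proj \<phi>) \<noteq> 1 \<and> relative_entropy \<psi> \<phi> = \<infinity>)"
proof -
  obtain L P where er: "eigen_resolution \<psi> L P" using assms(1) by (rule eigen_resolution_exists)
  obtain M Q where er': "eigen_resolution \<phi> M Q" using assms(2) by (rule eigen_resolution_exists)
  show ?thesis using relative_entropy_eq[OF assms er er'] by (cases "\<psi> (supp_proj \<phi>) = 1") auto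
qed

text \<open>
  In the application \<open>R\<close> and \<open>S\<close> are the projections onto the words typical for \<open>\<psi>\<close> in an
  eigenbasis of \<open>D\<^sub>\<psi>\<close> and in an eigenbasis of \<open>D\<^sub>\<phi>\<close>, respectively; \<open>h\<close> is the negative entropy
  of \<open>\<psi>\<close> and \<open>g\<close> is the expectation of \<open>log D\<^sub>\<phi>\<close> in \<open>\<psi>\<close>.
\<close>
definition typical_pair ::
    "('a::fd_cstar_algebra \<Rightarrow> complex) \<Rightarrow> ('a \<Rightarrow> complex) \<Rightarrow> real \<Rightarrow> real \<Rightarrow> nat \<Rightarrow> real \<Rightarrow> real \<Rightarrow>
      'a tensor \<Rightarrow> 'a tensor \<Rightarrow> bool" where
  "typical_pair \<psi> \<phi> h g n \<delta> \<eta> R S \<longleftrightarrow>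
      R \<in> tensor_power n \<and> is_projection R \<and> S \<in> tensor_power n \<and> is_projection S \<and>
      Re (pf \<psi> R) \<ge> 1 - \<eta> \<and> Re (pf \<psi> S) \<ge> 1 - \<eta> \<and>
      (\<forall>z\<in>tensor_power n.
        2 powr (n * (h - \<delta>)) * Re (ptrace (R * (z * adj z))) \<le> Re (pf \<psi> (R * (z * adj z))) \<and>
        Re (pf \<psi> (R * (z * adj z))) \<le> 2 powr (n * (h + \<delta>)) * Re (ptrace (R * (z * adj z))) \<and>
        2 powr (n * (g - \<delta>)) * Re (ptrace (S * (z * adj z))) \<le> Re (pf \<phi> (S * (z * adj z))) \<and>
        Re (pf \<phi> (S * (z * adj z))) \<le> 2 powr (n * (g + \<delta>)) * Re (ptrace (S * (z * adj z)))) \<and>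
      (\<forall>x\<in>tensor_power n. pf \<psi> (R * x) = pf \<psi> (x * R) \<and>
        pf \<phi> (S * x) = pf \<phi> (x * S))"

text \<open>The point is the order of quantifiers: \<open>C\<close> depends on \<phi> alone and
  bounds the second moments of both typical sets for every \<psi>.\<close>

lemma typical_projections:
  fixes \<phi> :: "'a::fd_cstar_algebra \<Rightarrow> complex"
  assumes \<phi>: "\<phi> \<in> states"
  obtains C where "C \<ge> 0" "\<And>\<psi> d n \<delta>. \<psi> \<in> states \<Longrightarrow> relative_entropy \<psi> \<phi> = ereal d \<Longrightarrow> n > 0 \<Longrightarrow> \<delta> > 0 \<Longrightarrow>
    \<exists>h g R S. d = h - g \<and> typical_pair \<psi> \<phi> h g n \<delta> (C / (n * \<delta>\<^sup>2)) R S"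
proof -
  obtain M Q where er': "eigen_resolution \<phi> M Q" using \<phi> by (rule eigen_resolution_exists)
  define M' where "M' = {m\<in>M. m > 0}"
  have M': "finite M'" "M' \<subseteq> M" "\<And>m. m \<in> M' \<Longrightarrow> m > 0" using er_finite[OF \<phi> er'] by (auto simp: M'_def)
  define t where "t = Re (canonical_trace (1 :: 'a))"
  have t: "t \<ge> 0" using base.pos_fun_projection(1)[OF A.pos_fun_tau UNIV_I base.is_projection_unit] by (simp add: t_def)
  \<comment> \<open>The first summand controls the log eigenvalues of \<psi>, by
    \<open>log_square_bound\<close> and the total trace \<open>t\<close>. The second controls those
    of \<phi>, whose \<psi>-weights are at most 1.\<close>
  define C where "C = 2 / (ln 2)\<^sup>2 * t + (\<Sum>m\<in>M'. (log 2 m)\<^sup>2)"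
  have C: "C \<ge> 2 / (ln 2)\<^sup>2 * t" "C \<ge> (\<Sum>m\<in>M'. (log 2 m)\<^sup>2)"
    using t by (simp_all add: C_def sum_nonneg)
  show ?thesis
  proof (rule that[of C])
    show "C \<ge> 0" using C(1) t by (simp add: order_trans[rotated])
    fix \<psi> :: "'a \<Rightarrow> complex" and d :: real and n :: nat and \<delta> :: real
    assume \<psi>: "\<psi> \<in> states" and d: "relative_entropy \<psi> \<phi> = ereal d" and n: "n > 0" and \<delta>: "\<delta> > 0"
    note w = states_pos_fun[OF \<psi>]
    obtain L P where er: "eigen_resolution \<psi> L P" using \<psi> by (rule eigen_resolution_exists)
    define L' where "L' = {l\<in>L. l > 0}"
    have L': "finite L'" "L' \<subseteq> L" "\<And>l. l \<in> L' \<Longrightarrow> l > 0" using er_finite[OF \<psi> er] by (auto simp: L'_def)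
    define h where "h = (\<Sum>l\<in>L'. Re (\<psi> (P l)) * log 2 l)"
    define g where "g = (\<Sum>m\<in>M'. Re (\<psi> (Q m)) * log 2 m)"
    have supp: "\<psi> (supp_proj \<phi>) = 1" using relative_entropy_cases[OF \<psi> \<phi>] d by auto
    have dhg: "d = h - g"
      using relative_entropy_eq[OF \<psi> \<phi> er er'] d supp by (simp add: h_def g_def L'_def M'_def)
    define R where "R = word_sum P (typical L' (log 2) h n \<delta>)"
    define S where "S = word_sum Q (typical M' (log 2) g n \<delta>)"
    have projP: "is_projection (P l)" if "l \<in> L'" for l using er_projection[OF \<psi> er] L' that by blast
    have projQ: "is_projection (Q l)" if "l \<in> M'" for l using er_projection[OF \<phi> er'] M' that by blast
    have orthP: "P l * P m = (if l = m then P l else 0)" if "l \<in> L'" "m \<in> L'" for l m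
      using er_orthogonal[OF \<psi> er] L'(2) that by blast
    have orthQ: "Q l * Q m = (if l = m then Q l else 0)" if "l \<in> M'" "m \<in> M'" for l m
      using er_orthogonal[OF \<phi> er'] M'(2) that by blast
    have eigP: "density \<psi> * P l = complex_of_real l *\<^sub>C P l" if "l \<in> L'" for l
      using er_eigen(1)[OF \<psi> er] L'(2) that by blast
    have eigQ: "density \<phi> * Q l = complex_of_real l *\<^sub>C Q l" if "l \<in> M'" for l
      using er_eigen(1)[OF \<phi> er'] M'(2) that by blast
    have XP: "typical L' (log 2) h n \<delta> \<subseteq> words L' n" and XQ: "typical M' (log 2) g n \<delta> \<subseteq> words M' n"
      by (auto simp: typical_def)
    have RV: "R \<in> tensor_power n" "is_projection R"
      unfolding R_def by (rule word_sum_in_power[OF XP], rule word_sum_projection[OF L'(1) projP orthP XP])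
    have SV: "S \<in> tensor_power n" "is_projection S"
      unfolding S_def by (rule word_sum_in_power[OF XQ], rule word_sum_projection[OF M'(1) projQ orthQ XQ])
    have oneP: "(\<Sum>l\<in>L'. Re (\<psi> (P l))) = 1" using er_sum_weights[OF \<psi> er] by (simp add: L'_def)
    \<comment> \<open>The support condition enters here: \<psi> gives no weight to the kernel of the
      density of \<phi>, which \<open>M'\<close> leaves out.\<close>
    have oneQ: "(\<Sum>l\<in>M'. Re (\<psi> (Q l))) = 1"
    proof -
      have "\<psi> (\<Sum>l\<in>M'. Q l) = 1" using supp by (simp add: er_support[OF \<phi> er'] M'_def)
      then show ?thesis by (simp add: base.pos_fun_sum[OF w] flip: Re_sum)
    qed
    have vP: "(\<Sum>l\<in>L'. Re (\<psi> (P l)) * (log 2 l)\<^sup>2) \<le> C"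
    proof -
      have "(\<Sum>l\<in>L'. Re (\<psi> (P l)) * (log 2 l)\<^sup>2) \<le> (\<Sum>l\<in>L'. 2 / (ln 2)\<^sup>2 * Re (canonical_trace (P l)))"
      proof (rule sum_mono)
        fix l assume l: "l \<in> L'"
        then have lL: "l \<in> L" using L' by blast
        have "Re (\<psi> (P l)) * (log 2 l)\<^sup>2 = l * (log 2 l)\<^sup>2 * Re (canonical_trace (P l))"
          by (simp add: er_weight_Re[OF \<psi> er lL])
        also have "\<dots> \<le> 2 / (ln 2)\<^sup>2 * Re (canonical_trace (P l))"
          using er_trace_ge_1[OF \<psi> er lL]
          by (intro mult_right_mono log_square_bound L' l er_le_1[OF \<psi> er lL]) auto
        finally show "Re (\<psi> (P l)) * (log 2 l)\<^sup>2 \<le> 2 / (ln 2)\<^sup>2 * Re (canonical_trace (P l))" .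
      qed
      also have "\<dots> = 2 / (ln 2)\<^sup>2 * Re (canonical_trace (\<Sum>l\<in>L'. P l))"
        by (simp add: base.pos_fun_sum[OF A.pos_fun_tau] sum_distrib_left)
      also have "\<dots> \<le> 2 / (ln 2)\<^sup>2 * t"
        unfolding t_def using L'(1) projP orthP
        by (intro mult_left_mono base.pos_fun_projection_le[OF A.pos_fun_tau] base.sum_projections) auto
      finally show ?thesis using C(1) by linarith
    qed
    have vQ: "(\<Sum>l\<in>M'. Re (\<psi> (Q l)) * (log 2 l)\<^sup>2) \<le> C"
    proof -
      have "(\<Sum>l\<in>M'. Re (\<psi> (Q l)) * (log 2 l)\<^sup>2) \<le> (\<Sum>l\<in>M'. 1 * (log 2 l)\<^sup>2)"
        using base.pos_fun_projection_le[OF w UNIV_I projQ]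
        by (intro sum_mono mult_right_mono) (auto simp: states_one[OF \<psi>])
      then show ?thesis using C(2) by simp
    qed
    have R1: "Re (pf \<psi> R) \<ge> 1 - C / (n * \<delta>\<^sup>2)"
      unfolding R_def by (rule word_sum_typical[OF L'(1) projP orthP \<psi> oneP h_def[symmetric] vP n \<delta>])
    have S1: "Re (pf \<psi> S) \<ge> 1 - C / (n * \<delta>\<^sup>2)"
      unfolding S_def by (rule word_sum_typical[OF M'(1) projQ orthQ \<psi> oneQ g_def[symmetric] vQ n \<delta>])
    note bP = word_sum_bounds[OF L'(1) projP orthP \<psi> eigP XP, folded R_def]
    note bQ = word_sum_bounds[OF M'(1) projQ orthQ \<phi> eigQ XQ, folded S_def]
    note tP = typical_prod_list[of _ L' h n \<delta>, OF _ L'(3)]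
    note tQ = typical_prod_list[of _ M' g n \<delta>, OF _ M'(3)]
    note cP = word_eigen(2)[OF L'(1) projP orthP \<psi> eigP XP, folded R_def]
    note cQ = word_eigen(2)[OF M'(1) projQ orthQ \<phi> eigQ XQ, folded S_def]
    show "\<exists>h g R S. d = h - g \<and> typical_pair \<psi> \<phi> h g n \<delta> (C / (n * \<delta>\<^sup>2)) R S"
      unfolding typical_pair_def
      by (intro exI[of _ h] exI[of _ g] exI[of _ R] exI[of _ S] conjI ballI dhg RV SV R1 S1
          bP bQ tP tQ cP cQ)
  qed
qed

text \<open>Both halves use the same R and S. R converts between \<psi> and the trace, S between the
  trace and \<phi>, and each conversion costs \<delta> in the exponent per copy.\<close>

lemma stein_bounds:
  fixes \<phi> :: "'a::fd_cstar_algebra \<Rightarrow> complex"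
  assumes \<phi>: "\<phi> \<in> states"
  obtains C where "C \<ge> 0"
    "\<And>\<psi> d n \<delta>. \<psi> \<in> states \<Longrightarrow> relative_entropy \<psi> \<phi> = ereal d \<Longrightarrow> n > 0 \<Longrightarrow> \<delta> > 0 \<Longrightarrow>
      \<exists>y\<in>tensor_power n. T.nsq (pf \<phi>) y \<le> 2 powr (- (n * (d - 2 * \<delta>))) \<and>
        T.nsq (pf \<psi>) (adj (pure_tensor (replicate n 1) - y)) \<le> C / (n * \<delta>\<^sup>2)"
    "\<And>\<psi> d n \<delta> q. \<psi> \<in> states \<Longrightarrow> relative_entropy \<psi> \<phi> = ereal d \<Longrightarrow> n > 0 \<Longrightarrow> \<delta> > 0 \<Longrightarrow>
      q \<in> tensor_power n \<Longrightarrow> is_projection q \<Longrightarrow>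
      2 powr (- (n * (d + 2 * \<delta>))) * (1 / 2 - 2 * (1 - Re (pf \<psi> q)) - C / (n * \<delta>\<^sup>2))
        \<le> Re (pf \<phi> q)"
proof -
  obtain C where C0: "C \<ge> 0" and C: "\<And>\<psi> d n \<delta>. \<psi> \<in> states \<Longrightarrow> relative_entropy \<psi> \<phi> = ereal d \<Longrightarrow> n > 0 \<Longrightarrow> \<delta> > 0 \<Longrightarrow>
    \<exists>h g R S. d = h - g \<and> typical_pair \<psi> \<phi> h g n \<delta> (C / (n * \<delta>\<^sup>2)) R S"
    by (rule typical_projections[OF \<phi>]) (rule that, assumption+)
  show ?thesis
  \<comment> \<open>Each use of \<open>nsq_add_le\<close> doubles the errors: replacing
    \<open>e\<close> by \<open>S * R\<close> costs \<open>4 * C\<close>, and the further factor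
    \<open>q\<close> in the second bound makes it \<open>8 * C\<close>. One constant serves
    both.\<close>
  proof (rule that[of "8 * C"])
    show "8 * C \<ge> 0" using C0 by simp
  next
    fix \<psi> :: "'a \<Rightarrow> complex" and d :: real and n :: nat and \<delta> :: real
    assume \<psi>: "\<psi> \<in> states" and d: "relative_entropy \<psi> \<phi> = ereal d" and n: "n > 0" and \<delta>: "\<delta> > 0"
    from C[OF this] obtain h g R S where dhg: "d = h - g"
      and pair: "typical_pair \<psi> \<phi> h g n \<delta> (C / (n * \<delta>\<^sup>2)) R S"
      by blast
    from pair have R: "R \<in> tensor_power n" "is_projection R" and S: "S \<in> tensor_power n" "is_projection S"
      and R1: "Re (pf \<psi> R) \<ge> 1 - C / (n * \<delta>\<^sup>2)" and S1: "Re (pf \<psi> S) \<ge> 1 - C / (n * \<delta>\<^sup>2)"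
      and bounds: "\<And>z. z \<in> tensor_power n \<Longrightarrow>
        2 powr (n * (h - \<delta>)) * Re (ptrace (R * (z * adj z))) \<le> Re (pf \<psi> (R * (z * adj z)))"
        "\<And>z. z \<in> tensor_power n \<Longrightarrow>
        Re (pf \<psi> (R * (z * adj z))) \<le> 2 powr (n * (h + \<delta>)) * Re (ptrace (R * (z * adj z)))"
        "\<And>z. z \<in> tensor_power n \<Longrightarrow>
        2 powr (n * (g - \<delta>)) * Re (ptrace (S * (z * adj z))) \<le> Re (pf \<phi> (S * (z * adj z)))"
        "\<And>z. z \<in> tensor_power n \<Longrightarrow>
        Re (pf \<phi> (S * (z * adj z))) \<le> 2 powr (n * (g + \<delta>)) * Re (ptrace (S * (z * adj z)))"
      and comm: "\<And>x. x \<in> tensor_power n \<Longrightarrow> pf \<psi> (R * x) = pf \<psi> (x * R)"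
        "\<And>x. x \<in> tensor_power n \<Longrightarrow> pf \<phi> (S * x) = pf \<phi> (x * S)"
      by (simp_all only: typical_pair_def)
    let ?e = "pure_tensor (replicate n (1 :: 'a))" and ?\<omega> = "pf \<psi>" and ?\<sigma> = "pf \<phi>"
    define \<epsilon> where "\<epsilon> = C / (n * \<delta>\<^sup>2)"
    note w = pos_fun_product[OF \<psi>, of n] and w\<phi> = pos_fun_product[OF \<phi>, of n]
    note [simp] = T.V_mult[where n = n] T.V_star[where n = n] T.V_diff[where n = n] T.V_unit[where n = n] R(1) S(1)
      T.unit_left[where n = n] T.unit_right[where n = n]
    have RR: "R * R = R" "adj R = R" and SS: "S * S = S" "adj S = S"
      using R(2) S(2) by (auto simp: is_projection_def)
    have RRx: "R * (R * x) = R * x" and SSx: "S * (S * x) = S * x" for x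
      by (simp_all add: RR SS flip: mult.assoc)
    have one: "?\<omega> ?e = 1" by (rule product_unit[OF \<psi>])
    have cR: "is_projection (?e - R)" and cS: "is_projection (?e - S)"
      by (rule T.is_projection_compl[OF R], rule T.is_projection_compl[OF S])
    have nR: "T.nsq ?\<omega> (?e - R) \<le> \<epsilon>" and nS: "T.nsq ?\<omega> (?e - S) \<le> \<epsilon>"
      using R1 S1 by (simp_all add: T.nsq_projection[OF cR] T.nsq_projection[OF cS] T.pos_fun_diff[OF w] one \<epsilon>_def)
    have SR: "T.nsq ?\<omega> (?e - S * R) \<le> 4 * \<epsilon>"
    proof -
      have eq: "?e - S * R = (?e - S) + S * (?e - R)" by (simp add: right_diff_distrib)
      have "T.nsq ?\<omega> (?e - S * R) \<le>
          2 * T.nsq ?\<omega> (?e - S) + 2 * T.nsq ?\<omega> (S * (?e - R))"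
        unfolding eq by (rule T.nsq_add_le[OF w]) simp_all
      also have "\<dots> \<le> 2 * \<epsilon> + 2 * \<epsilon>"
        using nS nR T.nsq_projection_mult_le[OF w S, of "?e - R"] by simp
      finally show ?thesis by simp
    qed
    {
      let ?y = "R * S"
      \<comment> \<open>The outer S cycles away because it commutes with the density of \<phi>. What
        remains is at most the trace of R, which is small because the eigenvalues on R are large
        compared with their total weight 1.\<close>
      have "?\<sigma> (adj ?y * ?y) = ?\<sigma> (S * (R * S))"
        by (simp add: T.star_mult RR SS RRx mult.assoc)
      also have "\<dots> = ?\<sigma> (R * S)" by (simp add: comm(2) mult.assoc SS)
      also have "\<dots> = ?\<sigma> (S * R)" by (simp add: comm(2))
      finally have "T.nsq ?\<sigma> ?y = Re (?\<sigma> (S * (R * adj R)))"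
        by (simp add: T.nsq_def RR)
      also have "\<dots> \<le> 2 powr (n * (g + \<delta>)) * Re (ptrace (S * (R * adj R)))" by (rule bounds(4)[OF R(1)])
      also have "\<dots> \<le> 2 powr (n * (g + \<delta>) + - (n * (h - \<delta>)))"
        unfolding powr_add
      proof (rule mult_left_mono)
        have "Re (ptrace ((?e - S) * (R * adj R))) \<ge> 0" by (rule T.tau_projection_mult[where n = n, OF _ cS]) simp_all
        then have "Re (ptrace (S * (R * adj R))) \<le> Re (ptrace R)"
          by (simp add: RR left_diff_distrib T.pos_fun_diff[OF T.pos_fun_tau])
        also have "\<dots> \<le> 2 powr (- (n * (h - \<delta>))) * 1"
        proof (rule le_powr_minus)
          have "2 powr (n * (h - \<delta>)) * Re (ptrace R) \<le> Re (?\<omega> R)"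
            using bounds(1)[OF T.V_unit[where n = n]] by simp
          also have "\<dots> \<le> 1" using T.pos_fun_projection_le[OF w R] by (simp add: one)
          finally show "2 powr (n * (h - \<delta>)) * Re (ptrace R) \<le> 1" .
        qed
        finally show "Re (ptrace (S * (R * adj R))) \<le> 2 powr (- (n * (h - \<delta>)))" by simp
      qed simp
      also have "n * (g + \<delta>) + - (n * (h - \<delta>)) = - (n * (d - 2 * \<delta>))"
        by (simp add: dhg algebra_simps)
      finally have "T.nsq ?\<sigma> ?y \<le> 2 powr (- (n * (d - 2 * \<delta>)))" .
      moreover have "adj (?e - ?y) = ?e - S * R" by (simp add: T.star_diff T.star_mult RR SS)
      moreover have "4 * \<epsilon> \<le> 8 * C / (n * \<delta>\<^sup>2)" using C0 by (simp add: \<epsilon>_def divide_right_mono)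
      ultimately show "\<exists>y\<in>tensor_power n. T.nsq ?\<sigma> y \<le> 2 powr (- (n * (d - 2 * \<delta>))) \<and>
          T.nsq ?\<omega> (adj (?e - y)) \<le> 8 * C / (n * \<delta>\<^sup>2)"
        using SR by (intro bexI[of _ ?y]) auto
    }
    {
      fix q :: "'a tensor" assume q: "q \<in> tensor_power n" "is_projection q"
      have qq: "q * q = q" "adj q = q" using q(2) by (auto simp: is_projection_def)
      have qqx: "q * (q * x) = q * x" for x by (simp add: qq flip: mult.assoc)
      note [simp] = q(1)
      \<comment> \<open>\<open>e - ?z\<close> is small in the seminorm of \<psi> when \<psi> almost
        accepts \<open>q\<close>, S and R, so \<open>?z\<close> keeps a weight near 1/2 at least.
        The order of the factors lets R meet \<psi> and S meet \<phi> below.\<close>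
      let ?z = "q * (S * R)"
      have cq: "is_projection (?e - q)" by (rule T.is_projection_compl[OF q])
      have eq: "?e - ?z = (?e - q) + q * (?e - S * R)" by (simp add: right_diff_distrib)
      have "T.nsq ?\<omega> (?e - ?z) \<le>
          2 * T.nsq ?\<omega> (?e - q) + 2 * T.nsq ?\<omega> (q * (?e - S * R))"
        unfolding eq by (rule T.nsq_add_le[OF w]) simp_all
      also have "\<dots> \<le> 2 * (1 - Re (?\<omega> q)) + 2 * (4 * \<epsilon>)"
        using SR T.nsq_projection_mult_le[OF w q, of "?e - S * R"]
        by (simp add: T.nsq_projection[OF cq] T.pos_fun_diff[OF w] one)
      finally have "T.nsq ?\<omega> (?e - ?z) \<le> 2 * (1 - Re (?\<omega> q)) + 8 * \<epsilon>" by simp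
      moreover have "T.nsq ?\<omega> ?e \<le>
          2 * T.nsq ?\<omega> (?e - ?z) + 2 * T.nsq ?\<omega> ?z"
        using T.nsq_add_le[OF w, of "?e - ?z" ?z] by simp
      moreover have "T.nsq ?\<omega> ?e = 1" by (simp add: T.nsq_projection one)
      ultimately have z: "T.nsq ?\<omega> ?z \<ge> 1 / 2 - 2 * (1 - Re (?\<omega> q)) - 8 * \<epsilon>"
        by simp
      have "?\<omega> (adj ?z * ?z) = ?\<omega> (R * (S * q * S * R))"
        by (simp add: T.star_mult RR SS qq qqx mult.assoc)
      also have "\<dots> = ?\<omega> (S * q * S * R)" by (simp add: comm(1) mult.assoc RR)
      also have "\<dots> = ?\<omega> (R * (S * q * S))" by (simp add: comm(1))
      also have "S * q * S = S * q * adj (S * q)"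
        by (simp add: T.star_mult SS qq qqx mult.assoc)
      finally have "T.nsq ?\<omega> ?z = Re (?\<omega> (R * (S * q * adj (S * q))))"
        by (simp add: T.nsq_def)
      also have "\<dots> \<le> 2 powr (n * (h + \<delta>)) * Re (ptrace (R * (S * q * adj (S * q))))" by (rule bounds(2)) simp
      also have "\<dots> \<le> 2 powr (n * (h + \<delta>)) * Re (ptrace (S * (q * adj q)))"
      proof (rule mult_left_mono)
        have "Re (ptrace ((?e - R) * (S * q * adj (S * q)))) \<ge> 0" by (rule T.tau_projection_mult[where n = n, OF _ cR]) simp_all
        then have "Re (ptrace (R * (S * q * adj (S * q)))) \<le> Re (ptrace (S * q * adj (S * q)))"
          by (simp add: left_diff_distrib T.pos_fun_diff[OF T.pos_fun_tau])
        also have "ptrace (S * q * adj (S * q)) = ptrace (adj (S * q) * (S * q))" by (rule T.tau_commute[where n = n]) simp_all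
        also have "adj (S * q) * (S * q) = q * (S * q)"
          by (simp add: T.star_mult SS SSx qq mult.assoc)
        also have "ptrace (q * (S * q)) = ptrace (S * q * q)" by (rule T.tau_commute[where n = n]) simp_all
        also have "S * q * q = S * (q * adj q)" by (simp add: qq mult.assoc)
        finally show "Re (ptrace (R * (S * q * adj (S * q)))) \<le> Re (ptrace (S * (q * adj q)))" .
      qed simp
      also have "\<dots> \<le> 2 powr (n * (h + \<delta>)) * (2 powr (- (n * (g - \<delta>))) * Re (?\<sigma> (S * q)))"
      proof (rule mult_left_mono)
        have "2 powr (n * (g - \<delta>)) * Re (ptrace (S * (q * adj q))) \<le> Re (?\<sigma> (S * q))"
          using bounds(3)[OF q(1)] by (simp add: qq)
        then show "Re (ptrace (S * (q * adj q))) \<le> 2 powr (- (n * (g - \<delta>))) * Re (?\<sigma> (S * q))"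
          by (rule le_powr_minus)
      qed simp
      also have "\<dots> = 2 powr (n * (d + 2 * \<delta>)) * Re (?\<sigma> (S * q))"
      proof -
        have "n * (h + \<delta>) + - (n * (g - \<delta>)) = n * (d + 2 * \<delta>)" by (simp add: dhg algebra_simps)
        then show ?thesis by (simp only: mult.assoc[symmetric] powr_add[symmetric])
      qed
      also have "\<dots> \<le> 2 powr (n * (d + 2 * \<delta>)) * Re (?\<sigma> q)"
      proof (rule mult_left_mono)
        \<comment> \<open>S and \<open>q\<close> need not commute, but S can be cycled inside
          \<phi>; this makes the difference of the two values the seminorm of
          \<open>q * (e - S)\<close>.\<close>
        have "?\<sigma> (S * (q * S)) = ?\<sigma> (q * S)"
          using comm(2)[of "q * S"] by (simp add: mult.assoc SS)
        moreover have "adj (q * (?e - S)) * (q * (?e - S)) = q - S * q - (q * S - S * (q * S))"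
          by (simp add: T.star_mult T.star_diff SS qq qqx left_diff_distrib right_diff_distrib mult.assoc)
        ultimately have "?\<sigma> q - ?\<sigma> (S * q) =
            ?\<sigma> (adj (q * (?e - S)) * (q * (?e - S)))"
          by (simp add: T.pos_fun_diff[OF w\<phi>])
        then have "Re (?\<sigma> q) - Re (?\<sigma> (S * q)) =
            T.nsq ?\<sigma> (q * (?e - S))"
          by (simp add: T.nsq_def flip: minus_complex.sel)
        moreover have "T.nsq ?\<sigma> (q * (?e - S)) \<ge> 0" by (rule T.nsq_nonneg[OF w\<phi>]) simp
        ultimately show "Re (?\<sigma> (S * q)) \<le> Re (?\<sigma> q)" by simp
      qed simp
      finally have "T.nsq ?\<omega> ?z \<le> 2 powr (n * (d + 2 * \<delta>)) * Re (?\<sigma> q)" .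
      with z have "1 / 2 - 2 * (1 - Re (?\<omega> q)) - 8 * \<epsilon> \<le>
          2 powr (n * (d + 2 * \<delta>)) * Re (?\<sigma> q)" by linarith
      then have "2 powr (- (n * (d + 2 * \<delta>))) * (1 / 2 - 2 * (1 - Re (?\<omega> q)) - 8 * \<epsilon>) \<le>
          2 powr (- (n * (d + 2 * \<delta>))) * (2 powr (n * (d + 2 * \<delta>)) * Re (?\<sigma> q))"
        by (intro mult_left_mono) auto
      also have "\<dots> = Re (?\<sigma> q)" by (simp only: mult.assoc[symmetric] powr_add[symmetric]) simp
      finally show "2 powr (- (n * (d + 2 * \<delta>))) *
          (1 / 2 - 2 * (1 - Re (?\<omega> q)) - 8 * C / (n * \<delta>\<^sup>2)) \<le> Re (?\<sigma> q)"
        by (simp add: \<epsilon>_def)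
    }
  qed
qed

section \<open>Universal projections and the converse\<close>

text \<open>States take values in [0,1] on projections, so a spectral decomposition bounds them on
  self-adjoint elements; the general case follows by real and imaginary parts.\<close>

lemma states_bounded:
  fixes x :: "'a::fd_cstar_algebra"
  obtains K where "K \<ge> 0" "\<And>\<psi>. \<psi> \<in> states \<Longrightarrow> cmod (\<psi> x) \<le> K"
proof -
  have sa: "\<exists>K. \<forall>\<psi>\<in>states. cmod (\<psi> y) \<le> K" if "adj y = y" for y :: 'a
  proof -
    obtain L P where s: "base.spectral y L P" using base.spectral_theorem[OF UNIV_I \<open>adj y = y\<close>] .
    note sD = base.spectralD[OF s]
    have "cmod (\<psi> y) \<le> (\<Sum>l\<in>L. \<bar>l\<bar>)" if \<psi>: "\<psi> \<in> states" for \<psi>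
    proof -
      note w = states_pos_fun[OF \<psi>]
      have "\<psi> y = (\<Sum>l\<in>L. of_real l * \<psi> (P l))"
        by (subst sD(6)) (simp add: base.pos_fun_sum[OF w] base.pos_funD(2)[OF w])
      also have "cmod \<dots> \<le> (\<Sum>l\<in>L. \<bar>l\<bar>)"
      proof (rule sum_norm_le)
        fix l assume "l \<in> L"
        then have p: "is_projection (P l)" by (rule sD(3))
        have "cmod (\<psi> (P l)) \<le> 1"
          using base.pos_fun_projection[OF w UNIV_I p] base.pos_fun_projection_le[OF w UNIV_I p]
          by (simp add: cmod_eq_Re states_one[OF \<psi>])
        then have "\<bar>l\<bar> * cmod (\<psi> (P l)) \<le> \<bar>l\<bar> * 1" by (intro mult_left_mono) auto
        then show "cmod (of_real l * \<psi> (P l)) \<le> \<bar>l\<bar>" by (simp add: norm_mult)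
      qed
      finally show ?thesis .
    qed
    then show ?thesis by blast
  qed
  define y z where "y = x + adj x" and "z = \<i> *\<^sub>C (x - adj x)"
  have "adj y = y" by (simp add: y_def base.star_add base.star_star add.commute)
  moreover have "adj z = z"
    by (simp add: z_def base.star_sc base.star_diff base.star_star base.scale_right_diff_distrib)
  ultimately obtain K1 K2 where K: "\<And>\<psi>. \<psi> \<in> states \<Longrightarrow> cmod (\<psi> y) \<le> K1" "\<And>\<psi>. \<psi> \<in> states \<Longrightarrow> cmod (\<psi> z) \<le> K2"
    using sa[of y] sa[of z] by blast
  show ?thesis
  proof (rule that[of "\<bar>K1\<bar> + \<bar>K2\<bar>"])
    fix \<psi> :: "'a \<Rightarrow> complex" assume \<psi>: "\<psi> \<in> states"
    note w = states_pos_fun[OF \<psi>]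
    have "2 * \<psi> x = \<psi> y - \<i> * \<psi> z"
      by (simp add: y_def z_def base.pos_funD(1,2)[OF w] base.pos_fun_diff[OF w] algebra_simps)
    then have "cmod (2 * \<psi> x) = cmod (\<psi> y - \<i> * \<psi> z)" by (rule arg_cong)
    then have "2 * cmod (\<psi> x) = cmod (\<psi> y - \<i> * \<psi> z)" by (simp only: norm_mult norm_numeral)
    also have "\<dots> \<le> cmod (\<psi> y) + cmod (\<psi> z)"
      using norm_triangle_ineq4[of "\<psi> y" "\<i> * \<psi> z"] by (simp add: norm_mult)
    finally show "cmod (\<psi> x) \<le> \<bar>K1\<bar> + \<bar>K2\<bar>" using K[OF \<psi>] by linarith
  qed simp
qed

text \<open>
  Representatives are chosen in the cells of a grid of mesh \<open>1 / n\<^sup>2\<close>; in particular they belong to \<open>F\<close>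
  itself, so that no continuity of the relative entropy is needed.
\<close>
lemma polynomial_net:
  obtains K where "K > 0" "\<And>(F :: ('a::fd_cstar_algebra \<Rightarrow> complex) set) n. F \<subseteq> states \<Longrightarrow> n > 0 \<Longrightarrow>
    \<exists>N\<subseteq>F. finite N \<and> real (card N) \<le> (2 * K * (real n)\<^sup>2 + 5) ^ (2 * card (onb :: 'a set)) \<and>
      (\<forall>\<psi>\<in>F. \<exists>\<psi>'\<in>N. (\<Sum>b\<in>onb. cmod (\<psi> b - \<psi>' b)) \<le> 2 * real (card (onb :: 'a set)) / (real n)\<^sup>2)"
proof -
  have "\<forall>b :: 'a. \<exists>K\<ge>0. \<forall>\<psi>\<in>states. cmod (\<psi> b) \<le> K"
  proof
    fix b :: 'a
    show "\<exists>K\<ge>0. \<forall>\<psi>\<in>states. cmod (\<psi> b) \<le> K" by (rule states_bounded[of b]) blast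
  qed
  from choice[OF this] obtain k where "\<forall>b :: 'a. k b \<ge> 0 \<and> (\<forall>\<psi>\<in>states. cmod (\<psi> b) \<le> k b)" ..
  then have k: "\<And>b :: 'a. k b \<ge> 0" "\<And>b \<psi>. \<psi> \<in> states \<Longrightarrow> cmod (\<psi> (b :: 'a)) \<le> k b" by simp_all
  define K where "K = (\<Sum>b\<in>(onb :: 'a set). k b) + 1"
  have K: "cmod (\<psi> b) \<le> K" if "\<psi> \<in> states" "b \<in> onb" for \<psi> and b :: 'a
  proof -
    have "k b \<le> sum k onb" by (rule member_le_sum[OF that(2)]) (auto simp: k(1) onb(1))
    then show ?thesis using k(2)[OF that(1), of b] by (simp add: K_def)
  qed
  have Kpos: "K > 0" unfolding K_def using sum_nonneg[of onb k] k(1) by (simp add: add_nonneg_pos)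
  show ?thesis
  proof (rule that[OF Kpos])
    fix F :: "('a \<Rightarrow> complex) set" and n :: nat
    assume F: "F \<subseteq> states" and n: "n > 0"
    \<comment> \<open>The grid cell of a state in the coordinates given by \<open>onb\<close>.
      Restricting to \<open>onb\<close> makes the cells elements of a finite product, which bounds
      their number.\<close>
    define c where "c \<psi> = restrict (\<lambda>b :: 'a. (\<lfloor>Re (\<psi> b) * (real n)\<^sup>2\<rfloor>, \<lfloor>Im (\<psi> b) * (real n)\<^sup>2\<rfloor>)) onb" for \<psi>
    \<comment> \<open>The additional 1 covers rounding down of negative coordinates.\<close>
    define M where "M = \<lceil>K * (real n)\<^sup>2\<rceil> + 1"
    have rng: "\<lfloor>r * (real n)\<^sup>2\<rfloor> \<in> {-M..M}" if "\<bar>r\<bar> \<le> K" for r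
    proof -
      have "\<bar>r * (real n)\<^sup>2\<bar> \<le> K * (real n)\<^sup>2" using that by (simp add: abs_mult mult_right_mono)
      then show ?thesis unfolding M_def by (simp add: abs_le_iff) linarith
    qed
    have sub: "c ` F \<subseteq> (\<Pi>\<^sub>E b\<in>onb. {-M..M} \<times> {-M..M})"
    proof (intro image_subsetI PiE_I)
      fix \<psi> and b :: 'a assume "\<psi> \<in> F" "b \<in> onb"
      then have "cmod (\<psi> b) \<le> K" using K F by blast
      then have "\<bar>Re (\<psi> b)\<bar> \<le> K" "\<bar>Im (\<psi> b)\<bar> \<le> K"
        using abs_Re_le_cmod[of "\<psi> b"] abs_Im_le_cmod[of "\<psi> b"] by linarith+
      from rng[OF this(1)] rng[OF this(2)] show "c \<psi> b \<in> {-M..M} \<times> {-M..M}"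
        using \<open>b \<in> onb\<close> by (simp add: c_def)
    qed (simp add: c_def)
    have finPi: "finite (\<Pi>\<^sub>E b\<in>(onb :: 'a set). {-M..M} \<times> {-M..M})" by (intro finite_PiE onb(1)) simp
    have fin: "finite (c ` F)" by (rule finite_subset[OF sub finPi])
    define N where "N = inv_into F c ` (c ` F)"
    have "card N \<le> card (c ` F)" unfolding N_def by (rule card_image_le[OF fin])
    also have "\<dots> \<le> card (\<Pi>\<^sub>E b\<in>(onb :: 'a set). {-M..M} \<times> {-M..M})" by (rule card_mono[OF finPi sub])
    also have "\<dots> = (nat (2 * M + 1)) ^ (2 * card (onb :: 'a set))"
      by (simp add: card_PiE onb(1) card_cartesian_product power_mult power2_eq_square)
    finally have "real (card N) \<le> real (nat (2 * M + 1)) ^ (2 * card (onb :: 'a set))"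
      by (simp flip: of_nat_power)
    \<comment> \<open>The 5 comes from \<open>M \<le> K * n^2 + 2\<close> and
      \<open>2 * M + 1\<close> integers per coordinate; each basis element has two coordinates, real
      and imaginary part.\<close>
    also have "\<dots> \<le> (2 * K * (real n)\<^sup>2 + 5) ^ (2 * card (onb :: 'a set))"
    proof (rule power_mono)
      have "K * (real n)\<^sup>2 \<ge> 0" using Kpos by simp
      then have "M \<ge> 0" by (simp add: M_def)
      then have "real (nat (2 * M + 1)) = 2 * of_int M + 1" by simp
      also have "of_int M \<le> K * (real n)\<^sup>2 + 2"
        unfolding M_def of_int_add of_int_1 using of_int_ceiling_le_add_one[of "K * (real n)\<^sup>2"] by linarith
      finally show "real (nat (2 * M + 1)) \<le> 2 * K * (real n)\<^sup>2 + 5" by simp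
    qed simp
    finally have cardN: "real (card N) \<le> (2 * K * (real n)\<^sup>2 + 5) ^ (2 * card (onb :: 'a set))" .
    have near: "\<exists>\<psi>'\<in>N. (\<Sum>b\<in>onb. cmod (\<psi> b - \<psi>' b)) \<le> 2 * real (card (onb :: 'a set)) / (real n)\<^sup>2"
      if \<psi>: "\<psi> \<in> F" for \<psi>
    proof (rule bexI)
      define \<psi>' where "\<psi>' = inv_into F c (c \<psi>)"
      show "\<psi>' \<in> N" using \<psi> by (auto simp: N_def \<psi>'_def)
      have cc: "c \<psi>' = c \<psi>" unfolding \<psi>'_def by (rule f_inv_into_f[of "c \<psi>" c F]) (use \<psi> in blast)
      have close: "\<bar>r - r'\<bar> \<le> 1 / (real n)\<^sup>2" if "\<lfloor>r * (real n)\<^sup>2\<rfloor> = \<lfloor>r' * (real n)\<^sup>2\<rfloor>" for r r'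
      proof -
        have "\<bar>r * (real n)\<^sup>2 - r' * (real n)\<^sup>2\<bar> \<le> 1" using that by linarith
        then have "\<bar>r - r'\<bar> * (real n)\<^sup>2 \<le> 1" by (simp add: abs_mult flip: left_diff_distrib)
        then show ?thesis using n by (simp add: field_simps)
      qed
      have "(\<Sum>b\<in>onb. cmod (\<psi> b - \<psi>' b)) \<le> (\<Sum>b\<in>(onb :: 'a set). 2 / (real n)\<^sup>2)"
      proof (rule sum_mono)
        fix b :: 'a assume b: "b \<in> onb"
        have "c \<psi>' b = c \<psi> b" by (simp add: cc)
        then have "\<bar>Re (\<psi> b) - Re (\<psi>' b)\<bar> \<le> 1 / (real n)\<^sup>2" "\<bar>Im (\<psi> b) - Im (\<psi>' b)\<bar> \<le> 1 / (real n)\<^sup>2"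
          using b by (auto simp: c_def intro!: close)
        then show "cmod (\<psi> b - \<psi>' b) \<le> 2 / (real n)\<^sup>2"
          using cmod_le[of "\<psi> b - \<psi>' b"] by simp
      qed
      then show "(\<Sum>b\<in>onb. cmod (\<psi> b - \<psi>' b)) \<le> 2 * real (card (onb :: 'a set)) / (real n)\<^sup>2" by (simp add: mult.commute)
    qed
    have "N \<subseteq> F" unfolding N_def by (auto intro: inv_into_into)
    moreover have "finite N" unfolding N_def by (rule finite_imageI[OF fin])
    ultimately show "\<exists>N\<subseteq>F. finite N \<and> real (card N) \<le> (2 * K * (real n)\<^sup>2 + 5) ^ (2 * card (onb :: 'a set)) \<and>
      (\<forall>\<psi>\<in>F. \<exists>\<psi>'\<in>N. (\<Sum>b\<in>onb. cmod (\<psi> b - \<psi>' b)) \<le> 2 * real (card (onb :: 'a set)) / (real n)\<^sup>2)"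
      using cardN near by blast
  qed
qed

section \<open>Projections that serve a whole set of states\<close>

lemma support_power:
  fixes \<phi> :: "'a::fd_cstar_algebra \<Rightarrow> complex" and n :: nat
  assumes \<phi>: "\<phi> \<in> states"
  defines "s \<equiv> pure_tensor (replicate n (supp_proj \<phi>))"
  shows "s \<in> tensor_power n" "is_projection s"
    "\<psi> \<in> states \<Longrightarrow> Re (pf \<psi> s) = Re (\<psi> (supp_proj \<phi>)) ^ n"
proof -
  note sp = support_projection[OF \<phi>]
  show "s \<in> tensor_power n" by (simp add: s_def pure_tensor_in_tensor_power)
  have "map2 (*) (replicate n x) (replicate n x) = replicate n (x * x)" for x :: 'a
    by (induction n) auto
  then show "is_projection s"
    using sp by (simp add: is_projection_def s_def pure_tensor_mult adj_pure_tensor)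
  assume \<psi>: "\<psi> \<in> states"
  obtain r where r: "\<psi> (supp_proj \<phi>) = of_real r"
    using base.pos_fun_projection(2)[OF states_pos_fun[OF \<psi>] UNIV_I sp] by (auto simp: complex_eq_iff)
  then show "Re (pf \<psi> s) = Re (\<psi> (supp_proj \<phi>)) ^ n"
    by (simp add: s_def product_functional_pure[OF states_clinear[OF \<psi>]] prod_list_replicate
        flip: of_real_power)
qed

text \<open>\<open>c\<close> ranges over all real lower bounds of the entropies, so the predicate
  does not presuppose a finite infimum. The clause for entropies that are all infinite forces \<phi>
  to vanish on the projection, as a limit of minus infinity demands. The last two clauses bound the
  error on \<psi> in the two cases.\<close>

definition universal_projection ::
    "('a::fd_cstar_algebra \<Rightarrow> complex) \<Rightarrow> ('a \<Rightarrow> complex) set \<Rightarrow> real \<Rightarrow> real \<Rightarrow> real \<Rightarrow> nat \<Rightarrow> real \<Rightarrow>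
      'a tensor \<Rightarrow> bool" where
  "universal_projection \<phi> \<Psi> C K A n \<delta> p \<longleftrightarrow> p \<in> tensor_power n \<and> is_projection p \<and>
      (\<forall>c::real. (\<forall>\<psi>\<in>\<Psi>. ereal c \<le> relative_entropy \<psi> \<phi>) \<longrightarrow> Re (pf \<phi> p) \<le>
        real n * ((2 * K * (real n)\<^sup>2 + 5) ^ (2 * card (onb :: 'a set)) * 2 powr (- (n * (c - 2 * \<delta>))))) \<and>
      ((\<forall>\<psi>\<in>\<Psi>. relative_entropy \<psi> \<phi> = \<infinity>) \<longrightarrow> Re (pf \<phi> p) \<le> 0) \<and>
      (\<forall>\<psi>\<in>\<Psi>. relative_entropy \<psi> \<phi> = \<infinity> \<longrightarrow> 1 - Re (pf \<psi> p) \<le>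
        sqrt (1 / n) + sqrt (Re (\<psi> (supp_proj \<phi>)) ^ n)) \<and>
      (\<forall>\<psi>\<in>\<Psi>. relative_entropy \<psi> \<phi> \<noteq> \<infinity> \<longrightarrow> 1 - Re (pf \<psi> p) \<le>
        sqrt (1 / n) + sqrt (C / (n * \<delta>\<^sup>2)) + A / n)"

lemma universal_projections:
  fixes \<phi> :: "'a::fd_cstar_algebra \<Rightarrow> complex"
  assumes \<phi>: "\<phi> \<in> states" and \<Psi>: "\<Psi> \<subseteq> states"
  obtains C K A where "C \<ge> 0" "K > 0" "\<And>n \<delta>. n > 0 \<Longrightarrow> \<delta> > 0 \<Longrightarrow>
    \<exists>p. universal_projection \<phi> \<Psi> C K A n \<delta> p"
proof -
  obtain C where C: "C \<ge> 0"
    "\<And>\<psi> d n \<delta>. \<psi> \<in> states \<Longrightarrow> relative_entropy \<psi> \<phi> = ereal d \<Longrightarrow> n > 0 \<Longrightarrow> \<delta> > 0 \<Longrightarrow>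
      \<exists>y\<in>tensor_power n. T.nsq (pf \<phi>) y \<le> 2 powr (- (n * (d - 2 * \<delta>))) \<and>
        T.nsq (pf \<psi>) (adj (pure_tensor (replicate n 1) - y)) \<le> C / (n * \<delta>\<^sup>2)"
    by (rule stein_bounds[OF \<phi>]) (rule that, assumption+)
  obtain K where K: "K > 0" "\<And>(F :: ('a \<Rightarrow> complex) set) n. F \<subseteq> states \<Longrightarrow> n > 0 \<Longrightarrow>
    \<exists>N\<subseteq>F. finite N \<and> real (card N) \<le> (2 * K * (real n)\<^sup>2 + 5) ^ (2 * card (onb :: 'a set)) \<and>
      (\<forall>\<psi>\<in>F. \<exists>\<psi>'\<in>N. (\<Sum>b\<in>onb. cmod (\<psi> b - \<psi>' b)) \<le> 2 * real (card (onb :: 'a set)) / (real n)\<^sup>2)"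
    by (rule polynomial_net[where 'a = 'a]) (rule that, assumption+)
  define t where "t = sqrt (Re (canonical_trace (1 :: 'a)))"
  \<comment> \<open>\<open>A / n\<close> is \<open>n\<close>, the number of slots, times the net
    distance \<open>2 * card onb / n^2\<close>, times the factor \<open>t\<close> from the slot
    bound.\<close>
  define A where "A = 2 * real (card (onb :: 'a set)) * t"
  have t: "t \<ge> 0"
    using base.pos_fun_projection(1)[OF A.pos_fun_tau UNIV_I base.is_projection_unit] by (simp add: t_def)
  define F where "F = {\<psi>\<in>\<Psi>. relative_entropy \<psi> \<phi> \<noteq> \<infinity>}"
  have F: "F \<subseteq> states" "F \<subseteq> \<Psi>" using \<Psi> by (auto simp: F_def)
  show ?thesis
  proof (rule that[OF C(1) K(1)])
    fix n :: nat and \<delta> :: real assume n: "n > 0" and \<delta>: "\<delta> > 0"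
    let ?e = "pure_tensor (replicate n (1 :: 'a))"
    define s where "s = pure_tensor (replicate n (supp_proj \<phi>))"
    note s = support_power[OF \<phi>, where n = n, folded s_def]
    obtain N where N: "N \<subseteq> F" "finite N" "real (card N) \<le> (2 * K * (real n)\<^sup>2 + 5) ^ (2 * card (onb :: 'a set))"
      "\<And>\<psi>. \<psi> \<in> F \<Longrightarrow> \<exists>\<psi>'\<in>N. (\<Sum>b\<in>onb. cmod (\<psi> b - \<psi>' b)) \<le> 2 * real (card (onb :: 'a set)) / (real n)\<^sup>2"
      using K(2)[OF F(1) n] by blast
    have "\<forall>\<psi>\<in>F. \<exists>y. y \<in> tensor_power n \<and>
        (\<forall>c. ereal c \<le> relative_entropy \<psi> \<phi> \<longrightarrow> T.nsq (pf \<phi>) y \<le> 2 powr (- (n * (c - 2 * \<delta>)))) \<and>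
        T.nsq (pf \<psi>) (adj (?e - y)) \<le> C / (n * \<delta>\<^sup>2)"
    proof
      fix \<psi> assume \<psi>: "\<psi> \<in> F"
      then have st: "\<psi> \<in> states" using F by blast
      obtain d where d: "relative_entropy \<psi> \<phi> = ereal d"
        using relative_entropy_cases[OF st \<phi>] \<psi> by (auto simp: F_def)
      obtain y where y: "y \<in> tensor_power n" "T.nsq (pf \<phi>) y \<le> 2 powr (- (n * (d - 2 * \<delta>)))"
        "T.nsq (pf \<psi>) (adj (?e - y)) \<le> C / (n * \<delta>\<^sup>2)"
        using C(2)[OF st d n \<delta>] by blast
      have "T.nsq (pf \<phi>) y \<le> 2 powr (- (n * (c - 2 * \<delta>)))" if "ereal c \<le> relative_entropy \<psi> \<phi>" for c
      proof -
        have "2 powr (- (n * (d - 2 * \<delta>))) \<le> 2 powr (- (n * (c - 2 * \<delta>)))"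
          using that d by (intro powr_mono) (auto intro!: mult_left_mono)
        with y(2) show ?thesis by linarith
      qed
      with y show "\<exists>y. y \<in> tensor_power n \<and>
        (\<forall>c. ereal c \<le> relative_entropy \<psi> \<phi> \<longrightarrow> T.nsq (pf \<phi>) y \<le> 2 powr (- (n * (c - 2 * \<delta>)))) \<and>
        T.nsq (pf \<psi>) (adj (?e - y)) \<le> C / (n * \<delta>\<^sup>2)" by blast
    qed
    from bchoice[OF this] obtain Y where "\<forall>\<psi>\<in>F. Y \<psi> \<in> tensor_power n \<and>
        (\<forall>c. ereal c \<le> relative_entropy \<psi> \<phi> \<longrightarrow> T.nsq (pf \<phi>) (Y \<psi>) \<le> 2 powr (- (n * (c - 2 * \<delta>)))) \<and>
        T.nsq (pf \<psi>) (adj (?e - Y \<psi>)) \<le> C / (n * \<delta>\<^sup>2)" ..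
    then have Y: "\<And>\<psi>. \<psi> \<in> F \<Longrightarrow> Y \<psi> \<in> tensor_power n"
      "\<And>\<psi> c. \<psi> \<in> F \<Longrightarrow> ereal c \<le> relative_entropy \<psi> \<phi> \<Longrightarrow>
        T.nsq (pf \<phi>) (Y \<psi>) \<le> 2 powr (- (n * (c - 2 * \<delta>)))"
      "\<And>\<psi>. \<psi> \<in> F \<Longrightarrow> T.nsq (pf \<psi>) (adj (?e - Y \<psi>)) \<le> C / (n * \<delta>\<^sup>2)"
      by blast+
    \<comment> \<open>The index \<open>None\<close> carries the complement of the support power. It
      adds nothing to the \<phi>-weight, and it is the summand that detects states of infinite
      entropy.\<close>
    define I where "I = insert None (Some ` N)"
    define y where "y i = (case i of None \<Rightarrow> ?e - s | Some \<psi> \<Rightarrow> Y \<psi>)" for i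
    have finI: "finite I" using N(2) by (simp add: I_def)
    have yV: "y i \<in> tensor_power n" if "i \<in> I" for i
      using that N(1) Y(1) s(1) T.V_diff[OF T.V_unit, of s n] by (auto simp: I_def y_def)
    have cs: "is_projection (?e - s)" by (rule T.is_projection_compl[OF s(1,2)])
    obtain p where p: "p \<in> tensor_power n" "is_projection p"
      and p1: "\<And>\<omega>. T.pos_fun n \<omega> \<Longrightarrow> Re (\<omega> p) \<le> (\<Sum>i\<in>I. T.nsq \<omega> (y i)) / (1 / n)"
      and p2: "\<And>\<omega> i. T.pos_fun n \<omega> \<Longrightarrow> \<omega> ?e = 1 \<Longrightarrow> i \<in> I \<Longrightarrow>
        Re (\<omega> (?e - p)) \<le> sqrt (1 / n) + sqrt (T.nsq \<omega> (adj (?e - y i)))"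
      using T.union_projection[of I y n "1 / n", OF finI yV] n by auto
    note w\<phi> = pos_fun_product[OF \<phi>, of n]
    have "T.nsq (pf \<phi>) (y None) = 0"
      using s(3)[OF \<phi>]
      by (simp add: y_def T.nsq_projection[OF cs] T.pos_fun_diff[OF w\<phi>] product_unit[OF \<phi>] support_one[OF \<phi>])
    then have sumI: "(\<Sum>i\<in>I. T.nsq (pf \<phi>) (y i)) = (\<Sum>\<psi>\<in>N. T.nsq (pf \<phi>) (Y \<psi>))"
      using N(2) by (simp add: I_def sum.reindex) (simp add: y_def)
    have b\<phi>: "Re (pf \<phi> p) \<le> real n * (\<Sum>\<psi>\<in>N. T.nsq (pf \<phi>) (Y \<psi>))"
      using p1[OF w\<phi>] n by (simp add: sumI mult.commute)
    have compl: "Re (pf \<psi> (?e - p)) = 1 - Re (pf \<psi> p)" if "\<psi> \<in> states" for \<psi>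
      by (simp add: T.pos_fun_diff[OF pos_fun_product[OF that]] product_unit[OF that])
    show "\<exists>p. universal_projection \<phi> \<Psi> C K A n \<delta> p"
      unfolding universal_projection_def
    proof (intro exI[of _ p] conjI allI impI ballI p)
      fix c :: real assume c: "\<forall>\<psi>\<in>\<Psi>. ereal c \<le> relative_entropy \<psi> \<phi>"
      have "(\<Sum>\<psi>\<in>N. T.nsq (pf \<phi>) (Y \<psi>)) \<le> (\<Sum>\<psi>\<in>N. 2 powr (- (n * (c - 2 * \<delta>))))"
        using N(1) F(2) c by (intro sum_mono Y(2)) auto
      also have "\<dots> \<le> (2 * K * (real n)\<^sup>2 + 5) ^ (2 * card (onb :: 'a set)) * 2 powr (- (n * (c - 2 * \<delta>)))"
        using N(3) by (simp add: mult_right_mono)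
      finally show "Re (pf \<phi> p) \<le>
        real n * ((2 * K * (real n)\<^sup>2 + 5) ^ (2 * card (onb :: 'a set)) * 2 powr (- (n * (c - 2 * \<delta>))))"
        by (rule order_trans[OF b\<phi> mult_left_mono]) simp
    next
      assume "\<forall>\<psi>\<in>\<Psi>. relative_entropy \<psi> \<phi> = \<infinity>"
      then have "N = {}" using N(1) by (auto simp: F_def)
      then show "Re (pf \<phi> p) \<le> 0" using b\<phi> by simp
    next
      fix \<psi> assume "\<psi> \<in> \<Psi>" "relative_entropy \<psi> \<phi> = \<infinity>"
      then have \<psi>: "\<psi> \<in> states" using \<Psi> by blast
      have "adj (?e - y None) = s"
        using s(2) by (simp add: y_def is_projection_def)
      then have "T.nsq (pf \<psi>) (adj (?e - y None)) = Re (\<psi> (supp_proj \<phi>)) ^ n"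
        by (simp add: T.nsq_projection s(2) s(3)[OF \<psi>])
      then show "1 - Re (pf \<psi> p) \<le> sqrt (1 / n) + sqrt (Re (\<psi> (supp_proj \<phi>)) ^ n)"
        using p2[OF pos_fun_product[OF \<psi>] product_unit[OF \<psi>], of None] by (simp add: I_def compl[OF \<psi>])
    next
      fix \<psi> assume "\<psi> \<in> \<Psi>" "relative_entropy \<psi> \<phi> \<noteq> \<infinity>"
      then have "\<psi> \<in> F" and \<psi>: "\<psi> \<in> states" using F by (auto simp: F_def)
      then obtain \<psi>' where \<psi>'N: "\<psi>' \<in> N"
        and near: "(\<Sum>b\<in>onb. cmod (\<psi> b - \<psi>' b)) \<le> 2 * real (card (onb :: 'a set)) / (real n)\<^sup>2"
        using N(4) by blast
      then have "\<psi>' \<in> F" and \<psi>': "\<psi>' \<in> states" using N(1) F by auto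
      have "\<bar>Re (pf \<psi> p) - Re (pf \<psi>' p)\<bar> \<le>
          real n * ((\<Sum>b\<in>onb. cmod (\<psi> b - \<psi>' b)) * t)"
        unfolding t_def by (rule product_state_diff[OF \<psi> \<psi>' p])
      also have "\<dots> \<le> real n * (2 * real (card (onb :: 'a set)) / (real n)\<^sup>2 * t)"
        using near t by (intro mult_left_mono mult_right_mono) auto
      also have "\<dots> = A / n" using n by (simp add: A_def power2_eq_square)
      finally have 1: "Re (pf \<psi>' p) - Re (pf \<psi> p) \<le> A / n" by linarith
      have "1 - Re (pf \<psi>' p) \<le> sqrt (1 / n) + sqrt (T.nsq (pf \<psi>') (adj (?e - Y \<psi>')))"
        using p2[OF pos_fun_product[OF \<psi>'] product_unit[OF \<psi>'], of "Some \<psi>'"] \<psi>'N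
        by (simp add: I_def compl[OF \<psi>'] y_def)
      also have "\<dots> \<le> sqrt (1 / n) + sqrt (C / (n * \<delta>\<^sup>2))"
        using Y(3)[OF \<open>\<psi>' \<in> F\<close>] by simp
      finally show "1 - Re (pf \<psi> p) \<le> sqrt (1 / n) + sqrt (C / (n * \<delta>\<^sup>2)) + A / n"
        using 1 by linarith
    qed
  qed
qed

text \<open>One \<psi> at a time is enough: the infimum is taken only afterwards. In the finite case
  the bracket in the second half of \<open>stein_bounds\<close> tends to 1/2, so its contribution to
  the exponent vanishes after division by \<open>n\<close>.\<close>

lemma projection_sequence_converse:
  fixes \<phi> :: "'a::fd_cstar_algebra \<Rightarrow> complex"
  assumes \<phi>: "\<phi> \<in> states" and \<psi>: "\<psi> \<in> states" and q: "projection_sequence q"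
    and lim: "(\<lambda>n. pf \<psi> (q n)) \<longlonglongrightarrow> 1"
  shows "- relative_entropy \<psi> \<phi> \<le>
    liminf (\<lambda>n. ereal (1 / real n) * log2_ereal (Re (pf \<phi> (q n))))"
    (is "_ \<le> liminf ?a")
proof (cases "relative_entropy \<psi> \<phi>")
  case (real d)
  obtain C where C: "C \<ge> 0" "\<And>\<psi> d n \<delta> q. \<psi> \<in> states \<Longrightarrow> relative_entropy \<psi> \<phi> = ereal d \<Longrightarrow> n > 0 \<Longrightarrow> \<delta> > 0 \<Longrightarrow>
      q \<in> tensor_power n \<Longrightarrow> is_projection q \<Longrightarrow>
      2 powr (- (n * (d + 2 * \<delta>))) * (1 / 2 - 2 * (1 - Re (pf \<psi> q)) - C / (n * \<delta>\<^sup>2))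
        \<le> Re (pf \<phi> q)"
    by (rule stein_bounds[OF \<phi>]) (rule that, assumption+)
  have bound: "ereal (- d - \<eta>) \<le> liminf ?a" if \<eta>: "\<eta> > 0" for \<eta> :: real
  proof (rule Liminf_bounded)
    \<comment> \<open>Half of \<eta> pays for \<open>2 * \<delta>\<close>. The other half pays for
      \<open>2 / n\<close>, which comes from the eventual lower bound 1/4 on the bracket.\<close>
    define \<delta> where "\<delta> = \<eta> / 4"
    have \<delta>: "\<delta> > 0" using \<eta> by (simp add: \<delta>_def)
    have "(\<lambda>n. Re (pf \<psi> (q n))) \<longlonglongrightarrow> 1" using tendsto_Re[OF lim] by simp
    moreover have "(\<lambda>n. C / (real n * \<delta>\<^sup>2)) \<longlonglongrightarrow> 0"
    proof -
      have "(\<lambda>n. C / \<delta>\<^sup>2 * (1 / real n)) \<longlonglongrightarrow> C / \<delta>\<^sup>2 * 0" by (intro tendsto_mult tendsto_const lim_1_over_n)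
      then show ?thesis by (simp add: mult.commute)
    qed
    ultimately have "(\<lambda>n. 1 / 2 - 2 * (1 - Re (pf \<psi> (q n))) - C / (real n * \<delta>\<^sup>2)) \<longlonglongrightarrow>
        1 / 2 - 2 * (1 - 1) - 0" by (intro tendsto_intros)
    then have "\<forall>\<^sub>F n in sequentially. 1 / 4 < 1 / 2 - 2 * (1 - Re (pf \<psi> (q n))) - C / (real n * \<delta>\<^sup>2)"
      by (rule order_tendstoD) simp
    moreover have "\<forall>\<^sub>F n in sequentially. 2 / real n < \<eta> / 2"
      using \<eta> by real_asymp
    moreover have "\<forall>\<^sub>F n in sequentially. n > (0::nat)" by (rule eventually_gt_at_top)
    ultimately show "\<forall>\<^sub>F n in sequentially. ereal (- d - \<eta>) \<le> ?a n"
    proof eventually_elim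
      case (elim n)
      have qn: "q n \<in> tensor_power n" "is_projection (q n)" using q elim(3) by (auto simp: projection_sequence_def)
      have "2 powr (- (n * (d + 2 * \<delta>)) - 2) = 2 powr (- (n * (d + 2 * \<delta>))) * (1 / 4)"
        by (simp add: powr_diff)
      also have "\<dots> \<le> 2 powr (- (n * (d + 2 * \<delta>))) *
          (1 / 2 - 2 * (1 - Re (pf \<psi> (q n))) - C / (real n * \<delta>\<^sup>2))"
        using elim(1) by (intro mult_left_mono) auto
      also have "\<dots> \<le> Re (pf \<phi> (q n))" by (rule C(2)[OF \<psi> real elim(3) \<delta> qn])
      finally have le: "2 powr (- (n * (d + 2 * \<delta>)) - 2) \<le> Re (pf \<phi> (q n))" .
      then have pos: "Re (pf \<phi> (q n)) > 0"
        by (rule less_le_trans[rotated]) simp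
      have "- (n * (d + 2 * \<delta>)) - 2 \<le> log 2 (Re (pf \<phi> (q n)))"
        using le pos by (simp add: le_log_iff)
      then have le_log: "(- (n * (d + 2 * \<delta>)) - 2) / n \<le> log 2 (Re (pf \<phi> (q n))) / n"
        by (rule divide_right_mono) simp
      have "- d - \<eta> \<le> - (d + \<eta> / 2) - 2 / n" using elim(2) by linarith
      also have "\<dots> = (- (n * (d + 2 * \<delta>)) - 2) / n" using elim(3) by (simp add: \<delta>_def field_simps)
      also note le_log
      finally have "- d - \<eta> \<le> log 2 (Re (pf \<phi> (q n))) / n" .
      then show ?case using pos by (simp add: log2_ereal_def)
    qed
  qed
  have "ereal (- d) \<le> liminf ?a"
  proof (rule ereal_le_epsilon2)
    fix \<eta> :: real assume "\<eta> > 0"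
    from bound[OF this] show "ereal (- d) \<le> liminf ?a + ereal \<eta>"
      by (cases "liminf ?a") auto
  qed
  then show ?thesis by (simp add: real)
next
  case MInf
  then show ?thesis using relative_entropy_cases[OF \<psi> \<phi>] by auto
qed simp

text \<open>The converse applied to the sequence of units, on which both product states are 1 and
  the logarithm is 0.\<close>

lemma relative_entropy_nonneg:
  fixes \<phi> :: "'a::fd_cstar_algebra \<Rightarrow> complex"
  assumes "\<phi> \<in> states" "\<psi> \<in> states"
  shows "relative_entropy \<psi> \<phi> \<ge> 0"
proof -
  have "projection_sequence (\<lambda>n. pure_tensor (replicate n (1 :: 'a)))"
    by (simp add: projection_sequence_def pure_tensor_in_tensor_power)
  then have "- relative_entropy \<psi> \<phi> \<le> liminf (\<lambda>n. ereal (1 / real n) *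
      log2_ereal (Re (pf \<phi> (pure_tensor (replicate n (1 :: 'a))))))"
    by (rule projection_sequence_converse[OF assms]) (simp add: product_unit[OF assms(2)])
  also have "\<dots> = 0"
    by (simp add: product_unit[OF assms(1)] log2_ereal_def Liminf_const flip: zero_ereal_def)
  finally show ?thesis by simp
qed

theorem theorem2p2:
  fixes \<phi> :: "'a::fd_cstar_algebra \<Rightarrow> complex"
    and \<Psi> :: "('a \<Rightarrow> complex) set"
  assumes "\<phi> \<in> states" and "\<Psi> \<subseteq> states"
  shows "(\<exists>p :: nat \<Rightarrow> 'a tensor. projection_sequence p \<and>
            (\<forall>\<psi>\<in>\<Psi>. (\<lambda>n. product_functional \<psi> (p n)) \<longlonglongrightarrow> 1) \<and>
            (\<lambda>n. ereal (1 / real n) * log2_ereal (Re (product_functional \<phi> (p n))))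
              \<longlonglongrightarrow> - (INF \<psi>\<in>\<Psi>. relative_entropy \<psi> \<phi>)) \<and>
         (\<forall>q :: nat \<Rightarrow> 'a tensor. projection_sequence q \<longrightarrow>
            (\<forall>\<psi>\<in>\<Psi>. (\<lambda>n. product_functional \<psi> (q n)) \<longlonglongrightarrow> 1) \<longrightarrow>
            liminf (\<lambda>n. ereal (1 / real n) * log2_ereal (Re (product_functional \<phi> (q n))))
              \<ge> - (INF \<psi>\<in>\<Psi>. relative_entropy \<psi> \<phi>))"
proof (rule conjI)
  let ?c = "INF \<psi>\<in>\<Psi>. relative_entropy \<psi> \<phi>"
  let ?a = "\<lambda>(q :: nat \<Rightarrow> 'a tensor) n. ereal (1 / real n) * log2_ereal (Re (pf \<phi> (q n)))"
  have converse: "- ?c \<le> liminf (?a q)"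
    if "projection_sequence q" "\<forall>\<psi>\<in>\<Psi>. (\<lambda>n. pf \<psi> (q n)) \<longlonglongrightarrow> 1" for q
  proof -
    have "- liminf (?a q) \<le> relative_entropy \<psi> \<phi>" if "\<psi> \<in> \<Psi>" for \<psi>
      using projection_sequence_converse[OF assms(1), of \<psi> q] assms(2) that
        \<open>projection_sequence q\<close> \<open>\<forall>\<psi>\<in>\<Psi>. _\<close>
      by (subst ereal_uminus_le_reorder) blast
    then have "- liminf (?a q) \<le> ?c" by (rule INF_greatest)
    \<comment> \<open>With empty \<open>\<Psi>\<close> the infimum is infinity and the claim is
      trivial; the same argument covers it.\<close>
    then show ?thesis by (subst ereal_uminus_le_reorder)
  qed
  then show "\<forall>q :: nat \<Rightarrow> 'a tensor. projection_sequence q \<longrightarrow>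
      (\<forall>\<psi>\<in>\<Psi>. (\<lambda>n. pf \<psi> (q n)) \<longlonglongrightarrow> 1) \<longrightarrow> liminf (?a q) \<ge> - ?c"
    by blast
  define k where "k = 2 * card (onb :: 'a set)"
  \<comment> \<open>The exponent -1/4 makes \<delta> vanish while
    \<open>n * \<delta>^2 = sqrt n\<close> still tends to infinity, so the loss in the rate and the
    Chebyshev error disappear together.\<close>
  define \<delta> where "\<delta> n = real n powr (- 1 / 4)" for n :: nat
  obtain C K A where C: "C \<ge> 0" and K: "K > 0" and univ: "\<And>n \<delta>. n > 0 \<Longrightarrow> \<delta> > 0 \<Longrightarrow>
    \<exists>p. universal_projection \<phi> \<Psi> C K A n \<delta> p"
    by (rule universal_projections[OF assms]) (rule that, assumption+)
  let ?good = "\<lambda>n. universal_projection \<phi> \<Psi> C K A n (\<delta> n)"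
  define p where "p n = (SOME p. ?good n p)" for n
  have p: "?good n (p n)" if "n > 0" for n
  proof -
    have "\<delta> n > 0" using that by (simp add: \<delta>_def)
    from someI_ex[OF univ[OF that this]] show ?thesis unfolding p_def .
  qed
  have seq: "projection_sequence p"
    using p by (simp add: projection_sequence_def universal_projection_def)
  have lim: "(\<lambda>n. pf \<psi> (p n)) \<longlonglongrightarrow> 1" if "\<psi> \<in> \<Psi>" for \<psi>
  proof -
    have \<psi>: "\<psi> \<in> states" using assms(2) that by blast
    have "\<exists>u. u \<longlonglongrightarrow> 0 \<and> (\<forall>n>0. 1 - Re (pf \<psi> (p n)) \<le> u n)"
    proof (cases "relative_entropy \<psi> \<phi> = \<infinity>")
      case True
      define r where "r = Re (\<psi> (supp_proj \<phi>))"
      note sp = support_projection[OF assms(1)]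
      have "0 \<le> r" "r \<le> 1" "Im (\<psi> (supp_proj \<phi>)) = 0"
        using base.pos_fun_projection[OF states_pos_fun[OF \<psi>] UNIV_I sp]
          base.pos_fun_projection_le[OF states_pos_fun[OF \<psi>] UNIV_I sp]
        by (simp_all add: r_def states_one[OF \<psi>])
      moreover have "\<psi> (supp_proj \<phi>) \<noteq> 1" using relative_entropy_cases[OF \<psi> assms(1)] True by auto
      ultimately have r: "0 \<le> r" "r < 1" by (auto simp: r_def complex_eq_iff order_le_less)
      have "(\<lambda>n. sqrt (1 / real n) + sqrt (r ^ n)) \<longlonglongrightarrow> sqrt 0 + sqrt 0"
        by (intro tendsto_add tendsto_real_sqrt lim_1_over_n LIMSEQ_realpow_zero r)
      then have "(\<lambda>n. sqrt (1 / real n) + sqrt (r ^ n)) \<longlonglongrightarrow> 0" by simp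
      moreover have "\<forall>n>0. 1 - Re (pf \<psi> (p n)) \<le> sqrt (1 / real n) + sqrt (r ^ n)"
        using p that True unfolding universal_projection_def r_def by blast
      ultimately show ?thesis by blast
    next
      case False
      have "(\<lambda>n. sqrt (1 / real n) + sqrt C * sqrt (1 / (real n * (\<delta> n)\<^sup>2)) + A * (1 / real n)) \<longlonglongrightarrow>
          sqrt 0 + sqrt C * 0 + A * 0"
      proof (intro tendsto_add tendsto_mult tendsto_const tendsto_real_sqrt lim_1_over_n)
        show "(\<lambda>n. sqrt (1 / (real n * (\<delta> n)\<^sup>2))) \<longlonglongrightarrow> 0" unfolding \<delta>_def by real_asymp
      qed
      then have "(\<lambda>n. sqrt (1 / real n) + sqrt (C / (real n * (\<delta> n)\<^sup>2)) + A / real n) \<longlonglongrightarrow> 0"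
        by (simp add: real_sqrt_divide real_sqrt_mult)
      moreover have "\<forall>n>0. 1 - Re (pf \<psi> (p n)) \<le>
          sqrt (1 / real n) + sqrt (C / (real n * (\<delta> n)\<^sup>2)) + A / real n"
        using p that False unfolding universal_projection_def by blast
      ultimately show ?thesis by blast
    qed
    then obtain u where u: "u \<longlonglongrightarrow> 0" "\<And>n. n > 0 \<Longrightarrow> 1 - Re (pf \<psi> (p n)) \<le> u n" by blast
    have ev: "\<forall>\<^sub>F n in sequentially. n > (0::nat)" by (rule eventually_gt_at_top)
    have pn: "p n \<in> tensor_power n" "is_projection (p n)" if "n > 0" for n
      using p[OF that] by (auto simp: universal_projection_def)
    have "(\<lambda>n. Re (pf \<psi> (p n))) \<longlonglongrightarrow> 1"
    proof (rule tendsto_sandwich)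
      show "\<forall>\<^sub>F n in sequentially. 1 - u n \<le> Re (pf \<psi> (p n))"
        using ev
      proof eventually_elim
        case (elim n)
        show ?case using u(2)[OF elim] by simp
      qed
      show "\<forall>\<^sub>F n in sequentially. Re (pf \<psi> (p n)) \<le> 1"
        using ev
      proof eventually_elim
        case (elim n)
        show ?case
          using T.pos_fun_projection_le[OF pos_fun_product[OF \<psi>] pn[OF elim]] by (simp add: product_unit[OF \<psi>])
      qed
      show "(\<lambda>n. 1 - u n) \<longlonglongrightarrow> 1" using tendsto_diff[OF tendsto_const u(1), of 1] by simp
    qed simp
    then have "(\<lambda>n. complex_of_real (Re (pf \<psi> (p n)))) \<longlonglongrightarrow> of_real 1" by (rule tendsto_of_real)
    moreover have "\<forall>\<^sub>F n in sequentially. complex_of_real (Re (pf \<psi> (p n))) = pf \<psi> (p n)"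
      using ev
    proof eventually_elim
      case (elim n)
      show ?case
        using T.pos_fun_projection(2)[OF pos_fun_product[OF \<psi>] pn[OF elim]] by (simp add: complex_eq_iff)
    qed
    ultimately show ?thesis by (simp add: tendsto_cong)
  qed
  have "?a p \<longlonglongrightarrow> - ?c"
  proof (cases "\<forall>\<psi>\<in>\<Psi>. relative_entropy \<psi> \<phi> = \<infinity>")
    case True
    \<comment> \<open>This case includes an empty \<open>\<Psi>\<close>, whose infimum is the top
      element.\<close>
    then have c: "?c = \<infinity>" by (simp add: INF_eq_const cong: INF_cong) (cases "\<Psi> = {}"; simp add: top_ereal_def)
    have "\<forall>\<^sub>F n in sequentially. ?a p n = - \<infinity>"
      using eventually_gt_at_top[of 0]
    proof eventually_elim
      case (elim n)
      have "?good n (p n)" by (rule p[OF elim])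
      then have "Re (pf \<phi> (p n)) \<le> 0" "Re (pf \<phi> (p n)) \<ge> 0"
        using True T.pos_fun_projection(1)[OF pos_fun_product[OF assms(1)]] by (auto simp: universal_projection_def)
      then have "Re (pf \<phi> (p n)) = 0" by simp
      then show ?case using elim by (simp add: log2_ereal_def)
    qed
    then show ?thesis unfolding c by (subst tendsto_cong) auto
  next
    case False
    then obtain \<psi> where \<psi>: "\<psi> \<in> \<Psi>" "relative_entropy \<psi> \<phi> \<noteq> \<infinity>" by blast
    \<comment> \<open>Nonnegativity rules out an infimum of minus infinity, so the rate is a real
      number \<open>r\<close>.\<close>
    have "?c \<ge> 0" using assms by (intro INF_greatest relative_entropy_nonneg) auto
    moreover have "?c \<le> relative_entropy \<psi> \<phi>" by (rule INF_lower[OF \<psi>(1)])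
    ultimately obtain r where r: "?c = ereal r" using \<psi>(2) by (cases ?c) auto
    \<comment> \<open>The logarithm of the bound on \<phi>, divided by \<open>n\<close>. The factor
      \<open>n\<close> and the size of the net enter only through logarithms and vanish in the
      limit.\<close>
    define B where "B n = (log 2 (real n) + k * log 2 (2 * K * (real n)\<^sup>2 + 5)) / real n - (r - 2 * \<delta> n)" for n :: nat
    have "(\<lambda>n. (log 2 (real n) + k * log 2 (2 * K * (real n)\<^sup>2 + 5)) / real n) \<longlonglongrightarrow> 0"
      using K by real_asymp
    moreover have "\<delta> \<longlonglongrightarrow> 0" unfolding \<delta>_def by real_asymp
    ultimately have "B \<longlonglongrightarrow> 0 - (r - 2 * 0)" unfolding B_def by (intro tendsto_intros)
    then have Blim: "(\<lambda>n. ereal (B n)) \<longlonglongrightarrow> - ?c" by (simp add: r)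
    have "\<forall>\<^sub>F n in sequentially. ?a p n \<le> ereal (B n)"
      using eventually_gt_at_top[of 0]
    proof eventually_elim
      case (elim n)
      define x where "x = Re (pf \<phi> (p n))"
      have g: "?good n (p n)" by (rule p[OF elim])
      have "\<forall>\<psi>\<in>\<Psi>. ereal r \<le> relative_entropy \<psi> \<phi>" unfolding r[symmetric] by (auto intro: INF_lower)
      then have xle: "x \<le> real n * ((2 * K * (real n)\<^sup>2 + 5) ^ k * 2 powr (- (n * (r - 2 * \<delta> n))))"
        using g unfolding universal_projection_def x_def k_def by blast
      have "x \<ge> 0" using g T.pos_fun_projection(1)[OF pos_fun_product[OF assms(1)]] by (auto simp: universal_projection_def x_def)
      have Q: "2 * K * (real n)\<^sup>2 + 5 > 0" using K by (simp add: add_nonneg_pos)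
      show ?case
      proof (cases "x = 0")
        case True
        then show ?thesis using elim by (simp add: log2_ereal_def flip: x_def)
      next
        case False
        then have "log 2 x \<le> log 2 (real n * ((2 * K * (real n)\<^sup>2 + 5) ^ k * 2 powr (- (n * (r - 2 * \<delta> n)))))"
          using \<open>x \<ge> 0\<close> xle by (subst log_le_cancel_iff) auto
        also have "\<dots> = log 2 (real n) + k * log 2 (2 * K * (real n)\<^sup>2 + 5) + - (n * (r - 2 * \<delta> n))"
          using elim Q by (simp add: log_mult log_nat_power)
        finally have "log 2 x / n \<le> (log 2 (real n) + k * log 2 (2 * K * (real n)\<^sup>2 + 5) + - (n * (r - 2 * \<delta> n))) / n"
          by (rule divide_right_mono) simp
        also have "\<dots> = B n" using elim by (simp add: B_def add_divide_distrib diff_divide_distrib)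
        finally show ?thesis using False by (simp add: log2_ereal_def flip: x_def)
      qed
    qed
    then have "limsup (?a p) \<le> limsup (\<lambda>n. ereal (B n))" by (rule Limsup_mono)
    also have "\<dots> = - ?c" using Blim by (intro lim_imp_Limsup) auto
    finally have sup: "limsup (?a p) \<le> - ?c" .
    \<comment> \<open>The converse applies to \<open>p\<close> itself, so only the upper bound on
      the rate had to be estimated.\<close>
    have inf: "- ?c \<le> liminf (?a p)" using converse seq lim by blast
    have "liminf (?a p) \<le> limsup (?a p)" by (rule Liminf_le_Limsup) simp
    with sup inf show ?thesis
      by (subst tendsto_iff_Liminf_eq_Limsup) (auto intro: antisym order_trans)
  qed
  with seq lim show "\<exists>p :: nat \<Rightarrow> 'a tensor. projection_sequence p \<and>
      (\<forall>\<psi>\<in>\<Psi>. (\<lambda>n. pf \<psi> (p n)) \<longlonglongrightarrow> 1) \<and> ?a p \<longlonglongrightarrow> - ?c"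
    by blast
qed

end
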